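(* Let $A$ be a maximal indecomposable cyclotomic matrix over the ring $\mathbb{Z}[\sqrt{3}]$ which is not a matrix over $\mathbb{Z}$. Then $A$ is equivalent to one of the following matrices: $S_2'=\begin{pmatrix}\sqrt3&1\\1&-\sqrt3\end{pmatrix}$, $S_2^\dag=\begin{pmatrix}1&\sqrt3\\ \sqrt3&-1\end{pmatrix}$, or $S_4^{(\sqrt3)}$, the adjacency matrix of the uncharged $4$-cycle on vertices $a,b,d,c$ (in cyclic order) with edges $ab$ and $dc$ of weight $\sqrt3$, $bd$ of weight $1$ and $ca$ of weight $-1$ (all other entries $0$). Moreover, every indecomposable cyclotomic $\mathbb{Z}[\sqrt{3}]$-matrix is contained (as a principal submatrix) in a maximal one.
   Context: A real symmetric matrix $A$ is cyclotomic if its characteristic polynomial $\det(xI-A)$ has integer coefficients and all its eigenvalues lie in $[-2,2]$. A square matrix is indecomposable if it is not equivalent (in the sense below) to a block diagonal matrix with more than one block, equivalently its underlying graph (vertices $u\neq v$ adjacent iff $a_{uv}\ne0$) is connected. A maximal indecomposable cyclotomic matrix over a ring $T$ is an indecomposable cyclotomic $T$-matrix that is not a proper principal submatrix of any indecomposable cyclotomic $T$-matrix. Equivalence: with $K=\mathbb{Q}(\sqrt3)$, $A$ is strongly equivalent to $B$ if $A=\sigma(QBQ^\top)$ for some $Q\in O_n(\mathbb{Z})$ (signed permutation matrix) and some $\sigma\in\operatorname{Gal}(K/\mathbb{Q})$ applied entrywise; $A$ and $B$ are equivalent if $A$ is strongly equivalent to $B$ or to $-B$. The adjacency matrix of a weighted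 graph has $(u,v)$ entry the weight of edge $uv$ (zero if absent) and diagonal entries the vertex charges (here all $0$). *)

theory Defs
  imports "HOL-Analysis.Analysis" "Jordan_Normal_Form.Char_Poly"
begin

text \<open>Real square matrices (Jordan_Normal_Form type mat) model matrices over subrings of the reals.\<close>

definition Zsqrt3 :: "real set" where
  "Zsqrt3 = {of_int a + of_int b * sqrt 3 | a b. True}"

definition over_ring :: "real set \<Rightarrow> real mat \<Rightarrow> bool" where
  "over_ring T A \<longleftrightarrow> (\<forall>i<dim_row A. \<forall>j<dim_col A. A $$ (i, j) \<in> T)"

text \<open>The nontrivial Galois automorphism of Q(sqrt 3), on Z[sqrt 3] (all that is needed here).\<close>
definition sqrt3_conj :: "real \<Rightarrow> real" where
  "sqrt3_conj x = (THE y. \<exists>a b :: rat. x = of_rat a + of_rat b * sqrt 3 \<and> y = of_rat a - of_rat b * sqrt 3)"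

definition cyclotomic :: "real mat \<Rightarrow> bool" where
  "cyclotomic A \<longleftrightarrow> square_mat A \<and> transpose_mat A = A
     \<and> (\<forall>i. poly.coeff (char_poly A) i \<in> \<int>)
     \<and> (\<forall>z. eigenvalue (map_mat complex_of_real A) z \<longrightarrow> z \<in> \<real> \<and> -2 \<le> Re z \<and> Re z \<le> 2)"

definition adj_rel :: "real mat \<Rightarrow> (nat \<times> nat) set" where
  "adj_rel A = {(u, v). u < dim_row A \<and> v < dim_row A \<and> u \<noteq> v \<and> A $$ (u, v) \<noteq> 0}"

definition indecomposable :: "real mat \<Rightarrow> bool" where
  "indecomposable A \<longleftrightarrow> square_mat A \<and> dim_row A \<ge> 1
     \<and> (\<forall>u<dim_row A. \<forall>v<dim_row A. (u, v) \<in> (adj_rel A)\<^sup>*)"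

text \<open>B is the principal submatrix of A on the rows/columns f 0 < f 1 < ... < f (m-1).\<close>
definition principal_submatrix :: "real mat \<Rightarrow> real mat \<Rightarrow> bool" where
  "principal_submatrix B A \<longleftrightarrow> square_mat A \<and> square_mat B \<and>
     (\<exists>f. strict_mono_on {..<dim_row B} f \<and> (\<forall>i<dim_row B. f i < dim_row A) \<and>
          (\<forall>i<dim_row B. \<forall>j<dim_row B. B $$ (i, j) = A $$ (f i, f j)))"

definition proper_principal_submatrix :: "real mat \<Rightarrow> real mat \<Rightarrow> bool" where
  "proper_principal_submatrix B A \<longleftrightarrow> principal_submatrix B A \<and> dim_row B < dim_row A"

definition maximal_indec_cyclotomic :: "real set \<Rightarrow> real mat \<Rightarrow> bool" where
  "maximal_indec_cyclotomic T A \<longleftrightarrow> over_ring T A \<and> indecomposable A \<and> cyclotomic A \<and>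
     \<not> (\<exists>B. over_ring T B \<and> indecomposable B \<and> cyclotomic B \<and> proper_principal_submatrix A B)"

text \<open>Q ranges over O_n(Z) (integer orthogonal = signed permutation matrices), sigma over Gal(K/Q).\<close>
definition strongly_equiv :: "real mat \<Rightarrow> real mat \<Rightarrow> bool" where
  "strongly_equiv A B \<longleftrightarrow> (\<exists>n. A \<in> carrier_mat n n \<and> B \<in> carrier_mat n n \<and>
     (\<exists>Q \<in> carrier_mat n n. (\<forall>i<n. \<forall>j<n. Q $$ (i, j) \<in> \<int>) \<and> Q * transpose_mat Q = 1\<^sub>m n \<and>
       (\<exists>\<sigma> \<in> {id, sqrt3_conj}. A = map_mat \<sigma> (Q * B * transpose_mat Q))))"

definition equivalent :: "real mat \<Rightarrow> real mat \<Rightarrow> bool" where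
  "equivalent A B \<longleftrightarrow> strongly_equiv A B \<or> strongly_equiv A (- B)"

definition S2' :: "real mat" where
  "S2' = mat_of_rows_list 2 [[sqrt 3, 1], [1, - sqrt 3]]"

definition S2dag :: "real mat" where
  "S2dag = mat_of_rows_list 2 [[1, sqrt 3], [sqrt 3, -1]]"

text \<open>4-cycle a,b,d,c with indices a=0, b=1, c=2, d=3: ab = dc = sqrt 3, bd = 1, ca = -1.\<close>
definition S4sqrt3 :: "real mat" where
  "S4sqrt3 = mat_of_rows_list 4
     [[0, sqrt 3, -1, 0],
      [sqrt 3, 0, 0, 1],
      [-1, 0, 0, sqrt 3],
      [0, 1, sqrt 3, 0]]"

end

theory Submission
  imports Defs "Jordan_Normal_Form.Spectral_Radius"
begin

text \<open>
  A cyclotomic matrix has norm at most 2, so a row of squared length 4 is a row on which the bound is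
  attained, hence orthogonal to all other rows. An entry $\pm\sqrt 3$ leaves room for at most
  one further nonzero entry, of modulus 1, in its row, and orthogonality then forces the whole
  matrix. The Galois conjugate of the matrix has the same characteristic polynomial, which excludes
  all irrational entries other than $\pm\sqrt 3$. A matrix whose square is $4I$ cannot be extended,
  since all its rows are full.

  An integer matrix contained in no maximal one could be extended by one vertex forever, giving an
  infinite connected graph with adjacency matrix $A$ of norm at most 2. By Koenig's lemma the graph
  contains an induced ray. The ray realises the orthonormal basis vectors $e_j$ inside the Gram
  space of $2 - A$, and inside that of $2 + A$ as well, so every vertex has integer coordinates
  there, with the sum of squares bounded by Bessel's inequality. The two bounds leave only the
  vectors $\pm(e_k \pm e_{k+1})$, $\pm e_0$ and $0$. After prolonging the ray backwards, every
  finite piece is found inside a finite tessellation $2I - CC^T$ with $C^TC = 4I$, whose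
  square is $4I$.
\<close>

section \<open>Norm bound and Gram space of a ray\<close>

text \<open>The obstacle is the second assertion. Paths of every length are cyclotomic, so chains of
  indecomposable cyclotomic matrices can be infinite, and the union of such a chain is not a matrix:
  Zorn's lemma does not apply. Each finite piece has to be placed in a finite maximal matrix, and
  the infinity of the chain is what makes this possible, because it supplies a ray. Eigenvalue
  conditions are translated into \<open>sq_bound\<close> and back. In between only this bound is
  carried: it passes to subsets, makes sense for infinite graphs through their finite subsets, and
  can be stated over the reals and over the integers. One Gram space alone is too weak: in that of
  \<open>2 - A\<close> a vertex of charge -1 has squared norm 3, and Bessel's inequality admits any
  \<open>e_i + e_j\<close>. But the coordinates of a vertex in the two spaces have the same steps up
  to sign, so they end at the same index, and the two squared norms add up to 4 whatever the
  charge.\<close>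

definition sq_bound :: "'a set \<Rightarrow> ('a \<Rightarrow> 'a \<Rightarrow> 'b::linordered_idom) \<Rightarrow> bool" where
  "sq_bound V a \<longleftrightarrow> (\<forall>z. (\<Sum>u\<in>V. (\<Sum>v\<in>V. a u v * z v)\<^sup>2) \<le> 4 * (\<Sum>v\<in>V. (z v)\<^sup>2))"

lemma sq_bound_subset:
  fixes a :: "'a \<Rightarrow> 'a \<Rightarrow> 'b::linordered_idom"
  assumes "sq_bound V a" "W \<subseteq> V" "finite V"
  shows "sq_bound W a"
  unfolding sq_bound_def
proof
  fix z :: "'a \<Rightarrow> 'b"
  let ?z = "\<lambda>v. if v \<in> W then z v else 0"
  have eq: "(\<Sum>v\<in>V. a u v * ?z v) = (\<Sum>v\<in>W. a u v * z v)" for u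
    using assms(2,3) by (intro sum.mono_neutral_cong_right) auto
  have "(\<Sum>u\<in>W. (\<Sum>v\<in>W. a u v * z v)\<^sup>2) \<le> (\<Sum>u\<in>V. (\<Sum>v\<in>W. a u v * z v)\<^sup>2)"
    using assms by (intro sum_mono2) auto
  also have "\<dots> = (\<Sum>u\<in>V. (\<Sum>v\<in>V. a u v * ?z v)\<^sup>2)"
    using eq by simp
  also have "\<dots> \<le> 4 * (\<Sum>v\<in>V. (?z v)\<^sup>2)"
    using assms(1)[unfolded sq_bound_def, rule_format, of ?z] .
  also have "(\<Sum>v\<in>V. (?z v)\<^sup>2) = (\<Sum>v\<in>W. (z v)\<^sup>2)"
    using assms(2,3) by (intro sum.mono_neutral_cong_right) auto
  finally show "(\<Sum>u\<in>W. (\<Sum>v\<in>W. a u v * z v)\<^sup>2) \<le> 4 * (\<Sum>v\<in>W. (z v)\<^sup>2)" .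
qed

lemma sq_bound_reindex:
  fixes a :: "'a \<Rightarrow> 'a \<Rightarrow> 'b::linordered_idom" and f :: "'c \<Rightarrow> 'a"
  assumes "sq_bound (f ` W) a" "inj_on f W"
  shows "sq_bound W (\<lambda>i j. a (f i) (f j))"
  unfolding sq_bound_def
proof
  fix z :: "'c \<Rightarrow> 'b"
  define y where "y v = z (inv_into W f v)" for v
  have y: "y (f i) = z i" if "i \<in> W" for i
    using that assms(2) by (simp add: y_def)
  have "(\<Sum>u\<in>f ` W. (\<Sum>v\<in>f ` W. a u v * y v)\<^sup>2) \<le> 4 * (\<Sum>v\<in>f ` W. (y v)\<^sup>2)"
    using assms(1) unfolding sq_bound_def by blast
  then show "(\<Sum>u\<in>W. (\<Sum>v\<in>W. a (f u) (f v) * z v)\<^sup>2) \<le> 4 * (\<Sum>v\<in>W. (z v)\<^sup>2)"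
    using assms(2) by (simp add: sum.reindex y)
qed

lemma sq_bound_switch:
  fixes a :: "'a \<Rightarrow> 'a \<Rightarrow> 'b::linordered_idom"
  assumes "sq_bound V a" and s: "\<And>u. \<bar>s u\<bar> = 1"
  shows "sq_bound V (\<lambda>u v. s u * s v * a u v)"
  unfolding sq_bound_def
proof
  fix z :: "'a \<Rightarrow> 'b"
  have ss: "(s u)\<^sup>2 = 1" for u
    using s[of u] by (metis power2_abs power_one)
  have "(\<Sum>u\<in>V. (\<Sum>v\<in>V. a u v * (s v * z v))\<^sup>2) \<le> 4 * (\<Sum>v\<in>V. (s v * z v)\<^sup>2)"
    using assms(1)[unfolded sq_bound_def, rule_format, of "\<lambda>v. s v * z v"] .
  moreover have "(\<Sum>v\<in>V. s u * s v * a u v * z v)\<^sup>2 = (\<Sum>v\<in>V. a u v * (s v * z v))\<^sup>2" for u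
  proof -
    have "(\<Sum>v\<in>V. s u * s v * a u v * z v) = s u * (\<Sum>v\<in>V. a u v * (s v * z v))"
      by (simp add: sum_distrib_left algebra_simps)
    then show ?thesis by (simp add: power_mult_distrib ss)
  qed
  ultimately show "(\<Sum>u\<in>V. (\<Sum>v\<in>V. s u * s v * a u v * z v)\<^sup>2) \<le> 4 * (\<Sum>v\<in>V. (z v)\<^sup>2)"
    by (simp add: power_mult_distrib ss)
qed

lemma sq_bound_uminus: "sq_bound V (\<lambda>u v. - a u v) \<longleftrightarrow> sq_bound V a"
  by (simp add: sq_bound_def sum_negf)

lemma sq_bound_of_int:
  assumes "sq_bound V (\<lambda>u v. real_of_int (a u v))"
  shows "sq_bound V a"
  unfolding sq_bound_def
proof
  fix z :: "'a \<Rightarrow> int"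
  have "(\<Sum>u\<in>V. (\<Sum>v\<in>V. real_of_int (a u v) * of_int (z v))\<^sup>2) \<le> 4 * (\<Sum>v\<in>V. (of_int (z v))\<^sup>2)"
    using assms[unfolded sq_bound_def, rule_format, of "\<lambda>v. of_int (z v)"] .
  then have "real_of_int (\<Sum>u\<in>V. (\<Sum>v\<in>V. a u v * z v)\<^sup>2) \<le> of_int (4 * (\<Sum>v\<in>V. (z v)\<^sup>2))"
    by simp
  then show "(\<Sum>u\<in>V. (\<Sum>v\<in>V. a u v * z v)\<^sup>2) \<le> 4 * (\<Sum>v\<in>V. (z v)\<^sup>2)"
    by linarith
qed

lemma sq_bound_row:
  fixes a :: "'a \<Rightarrow> 'a \<Rightarrow> 'b::linordered_idom"
  assumes "sq_bound V a" "finite V" "u \<in> V"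
  shows "(\<Sum>v\<in>V. (a v u)\<^sup>2) \<le> 4"
proof -
  have "(\<Sum>v\<in>V. (\<Sum>w\<in>V. a v w * (if w = u then 1 else 0))\<^sup>2) \<le> 4 * (\<Sum>v\<in>V. (if v = u then 1 else 0)\<^sup>2)"
    using assms(1)[unfolded sq_bound_def, rule_format, of "\<lambda>w. if w = u then 1 else 0"] .
  moreover have "(\<Sum>v\<in>V. (if v = u then 1 else 0)\<^sup>2) = (\<Sum>v\<in>V. if v = u then 1 else (0::'b))"
    by (intro sum.cong) auto
  ultimately show ?thesis
    using assms(2,3) by (simp add: if_distrib[of "(*) _"] cong: if_cong)
qed

text \<open>A column of squared length at most 4 has room for at most four nonzero integers.\<close>

lemma finite_support:
  fixes a :: "'a \<Rightarrow> 'a \<Rightarrow> int"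
  assumes bound: "\<And>V. finite V \<Longrightarrow> sq_bound V a"
  shows "finite {v. a v u \<noteq> 0}"
proof (rule ccontr)
  assume "infinite {v. a v u \<noteq> 0}"
  then obtain V where V: "finite V" "card V = 5" "V \<subseteq> {v. a v u \<noteq> 0}"
    by (meson infinite_arbitrarily_large)
  have "(5::int) = (\<Sum>v\<in>V. 1)" using V by simp
  also have "\<dots> \<le> (\<Sum>v\<in>V. (a v u)\<^sup>2)"
  proof (intro sum_mono)
    fix v assume "v \<in> V"
    then have "a v u \<noteq> 0" using V by auto
    then have "0 < (a v u)\<^sup>2" by simp
    then show "1 \<le> (a v u)\<^sup>2" by linarith
  qed
  also have "\<dots> \<le> (\<Sum>v\<in>insert u V. (a v u)\<^sup>2)"
    using V by (intro sum_mono2) auto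
  also have "\<dots> \<le> 4"
    using sq_bound_row[OF bound, of "insert u V" u] V by simp
  finally show False by simp
qed

text \<open>Expanding the nonnegative squared norm of \<open>2z - az\<close> and bounding its last
  term by \<open>sq_bound\<close> leaves this inequality. It expresses the positivity of
  \<open>2 - a\<close>.\<close>

lemma sq_bound_form:
  fixes a :: "'a \<Rightarrow> 'a \<Rightarrow> 'b::linordered_idom"
  assumes "sq_bound V a"
  shows "(\<Sum>u\<in>V. \<Sum>v\<in>V. z u * a u v * z v) \<le> 2 * (\<Sum>v\<in>V. (z v)\<^sup>2)"
proof -
  define y where "y u = (\<Sum>v\<in>V. a u v * z v)" for u
  have "0 \<le> (\<Sum>u\<in>V. (2 * z u - y u)\<^sup>2)"
    by (simp add: sum_nonneg)
  also have "\<dots> = 4 * (\<Sum>u\<in>V. (z u)\<^sup>2) - 4 * (\<Sum>u\<in>V. z u * y u) + (\<Sum>u\<in>V. (y u)\<^sup>2)"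
    by (simp add: power2_diff sum.distrib sum_subtractf sum_distrib_left power_mult_distrib algebra_simps)
  also have "\<dots> \<le> 8 * (\<Sum>u\<in>V. (z u)\<^sup>2) - 4 * (\<Sum>u\<in>V. z u * y u)"
    using assms[unfolded sq_bound_def, rule_format, of z] by (simp add: y_def)
  finally have "4 * (\<Sum>u\<in>V. z u * y u) \<le> 4 * (2 * (\<Sum>u\<in>V. (z u)\<^sup>2))"
    by simp
  then have "(\<Sum>u\<in>V. z u * y u) \<le> 2 * (\<Sum>u\<in>V. (z u)\<^sup>2)"
    by (subst (asm) mult_le_cancel_left_pos) auto
  then show ?thesis
    by (simp add: y_def sum_distrib_left algebra_simps)
qed

section \<open>Inner products and coordinates in the Gram space of \<open>2 - a\<close>\<close>

definition gram :: "('a \<Rightarrow> 'a \<Rightarrow> int) \<Rightarrow> 'a \<Rightarrow> 'a \<Rightarrow> int" where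
  "gram a u v = (if u = v then 2 else 0) - a u v"

text \<open>The family \<open>p\<close> may repeat vertices: in Bessel's inequality the two test
  vertices can coincide or lie on the ray. Coefficients of equal vertices are collected in
  \<open>z\<close>.\<close>

lemma gram_psd:
  fixes a :: "'a \<Rightarrow> 'a \<Rightarrow> int" and p :: "'i \<Rightarrow> 'a" and c :: "'i \<Rightarrow> int"
  assumes "\<And>V. finite V \<Longrightarrow> sq_bound V a" and I: "finite I"
  shows "0 \<le> (\<Sum>i\<in>I. \<Sum>j\<in>I. c i * c j * gram a (p i) (p j))"
proof -
  define V where "V = p ` I"
  define z where "z v = (\<Sum>i\<in>I. if p i = v then c i else 0)" for v
  have fV: "finite V" using I by (simp add: V_def)
  have collapse: "(\<Sum>v\<in>V. z v * f v) = (\<Sum>i\<in>I. c i * f (p i))" for f :: "'a \<Rightarrow> int"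
  proof -
    have "(\<Sum>v\<in>V. z v * f v) = (\<Sum>v\<in>V. \<Sum>i\<in>I. if v = p i then c i * f v else 0)"
      unfolding z_def sum_distrib_right by (intro sum.cong) auto
    also have "\<dots> = (\<Sum>i\<in>I. \<Sum>v\<in>V. if v = p i then c i * f v else 0)"
      by (rule sum.swap)
    also have "\<dots> = (\<Sum>i\<in>I. c i * f (p i))"
      using fV by (intro sum.cong) (auto simp: V_def)
    finally show ?thesis .
  qed
  have "(\<Sum>i\<in>I. \<Sum>j\<in>I. c i * c j * gram a (p i) (p j)) = (\<Sum>i\<in>I. c i * (\<Sum>j\<in>I. c j * gram a (p i) (p j)))"
    by (simp add: sum_distrib_left algebra_simps)
  also have "\<dots> = (\<Sum>u\<in>V. z u * (\<Sum>v\<in>V. z v * gram a u v))"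
    unfolding collapse by simp
  also have "\<dots> = (\<Sum>u\<in>V. z u * (2 * z u - (\<Sum>v\<in>V. z v * a u v)))"
  proof (intro sum.cong refl)
    fix u assume "u \<in> V"
    then have "(\<Sum>v\<in>V. z v * (if u = v then 2 else 0)) = z u * 2"
      using fV by (simp add: if_distrib cong: if_cong)
    then show "z u * (\<Sum>v\<in>V. z v * gram a u v) = z u * (2 * z u - (\<Sum>v\<in>V. z v * a u v))"
      by (simp add: gram_def right_diff_distrib sum_subtractf)
  qed
  also have "\<dots> = 2 * (\<Sum>u\<in>V. (z u)\<^sup>2) - (\<Sum>u\<in>V. \<Sum>v\<in>V. z u * a u v * z v)"
    by (simp add: right_diff_distrib sum_subtractf sum_distrib_left power2_eq_square algebra_simps)
  finally show ?thesis
    using sq_bound_form[OF assms(1)[OF fV], of z] by simp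
qed

text \<open>With weight 1 on the ray edges, neighbouring ray vertices have inner product -1, just as
  \<open>e_i - e_{i+1}\<close> and \<open>e_{i+1} - e_{i+2}\<close> do. Any uncharged induced ray
  can be brought to this form by switching signs.\<close>

locale ray_graph =
  fixes a :: "nat \<Rightarrow> nat \<Rightarrow> int" and r :: "nat \<Rightarrow> nat"
  assumes sym: "a u v = a v u"
    and bound: "finite V \<Longrightarrow> sq_bound V a"
    and small: "\<bar>a u v\<bar> \<le> 1"
    and inj: "inj r"
    and uncharged: "a (r i) (r i) = 0"
    and edge: "a (r i) (r (Suc i)) = 1"
    and no_edge: "i < j \<Longrightarrow> j \<noteq> Suc i \<Longrightarrow> a (r i) (r j) = 0"
begin

abbreviation "b \<equiv> gram a"

lemma b_sym: "b u v = b v u"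
  by (simp add: gram_def sym)

lemma b_ray: "b (r i) (r j) = (if i = j then 2 else if j = Suc i \<or> i = Suc j then -1 else 0)"
proof -
  have lt: "b (r i) (r j) = (if j = Suc i then -1 else 0)" if "i < j" for i j
  proof -
    have "r i \<noteq> r j" using that inj by (metis injD less_irrefl)
    then show ?thesis using that edge[of i] no_edge[of i j] by (simp add: gram_def)
  qed
  consider "i < j" | "i = j" | "j < i" by linarith
  then show ?thesis
  proof cases
    case 1
    then show ?thesis using lt by simp
  next
    case 2
    then show ?thesis by (simp add: gram_def uncharged)
  next
    case 3
    then show ?thesis using lt[OF 3] b_sym[of "r i" "r j"] by simp
  qed
qed

lemma finite_ray_nbrs: "finite {i. b (r i) u \<noteq> 0}"
proof -
  have "{i. b (r i) u \<noteq> 0} \<subseteq> r -` ({v. a v u \<noteq> 0} \<union> {u})"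
    by (auto simp: gram_def)
  then show ?thesis
    using finite_vimageI[OF _ inj, of "{v. a v u \<noteq> 0} \<union> {u}"] finite_support[OF bound]
    by (meson finite.emptyI finite.insertI finite_UnI finite_subset)
qed

text \<open>
  Coordinate of a vertex along $e_j$, when the ray vertices are $e_i - e_{i+1}$ and the $e_j$ are
  recovered as the limits of telescoping sums.
\<close>
definition F :: "nat \<Rightarrow> nat \<Rightarrow> int" where
  "F u j = (\<Sum>i | j \<le> i \<and> b (r i) u \<noteq> 0. b (r i) u)"

lemma F_step: "F u j - F u (Suc j) = b (r j) u"
proof -
  let ?A = "{i. j \<le> i \<and> b (r i) u \<noteq> 0}" and ?B = "{i. Suc j \<le> i \<and> b (r i) u \<noteq> 0}"
  have fin: "finite ?B" by (rule finite_subset[OF _ finite_ray_nbrs[of u]]) auto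
  show ?thesis
  proof (cases "b (r j) u = 0")
    case True
    then have "?A = ?B" by (auto simp: Suc_le_eq le_less)
    then show ?thesis using True by (simp add: F_def)
  next
    case False
    then have "?A = insert j ?B" by (auto simp: Suc_le_eq le_less)
    then show ?thesis using fin by (simp add: F_def)
  qed
qed

lemma F_eventually_0: "\<exists>N. \<forall>j\<ge>N. F u j = 0"
proof -
  obtain N where N: "\<forall>i\<in>{i. b (r i) u \<noteq> 0}. i < N"
    using finite_ray_nbrs finite_nat_set_iff_bounded by blast
  have "F u j = 0" if "j \<ge> N" for j
  proof -
    have "{i. j \<le> i \<and> b (r i) u \<noteq> 0} = {}" using N that by fastforce
    then show ?thesis by (simp only: F_def sum.empty)
  qed
  then show ?thesis by blast
qed

lemma sum_by_parts:
  fixes g f :: "nat \<Rightarrow> int"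
  shows "(\<Sum>i<K. (\<Sum>j<Suc i. g j) * (f i - f (Suc i))) = (\<Sum>j<K. g j * f j) - (\<Sum>j<K. g j) * f K"
  by (induction K) (simp_all add: algebra_simps)

text \<open>In coordinates, the combination of the vectors \<open>e_i - e_{i+1}\<close> with
  coefficients \<open>T (Suc i)\<close> telescopes to the sum of \<open>g j * e_j\<close> over
  \<open>j < K\<close>, minus \<open>T K * e_K\<close>. The right-hand side is the squared norm of
  this vector.\<close>

lemma ray_form:
  fixes g :: "nat \<Rightarrow> int"
  defines "T \<equiv> \<lambda>i. \<Sum>j<i. g j"
  shows "(\<Sum>i<K. \<Sum>j<K. T (Suc i) * T (Suc j) * b (r i) (r j)) = (\<Sum>j<K. (g j)\<^sup>2) + (T K)\<^sup>2"
proof (induction K)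
  case 0
  then show ?case by (simp add: T_def)
next
  case (Suc K)
  let ?s = "\<Sum>i<K. T (Suc i) * T (Suc K) * b (r i) (r K)"
  have s: "?s = - T K * T (Suc K)"
  proof (cases K)
    case 0
    then show ?thesis by (simp add: T_def)
  next
    case (Suc L)
    have "?s = (\<Sum>i<K. if i = L then - T (Suc i) * T (Suc K) else 0)"
      by (intro sum.cong) (auto simp: b_ray Suc)
    then show ?thesis by (simp add: Suc)
  qed
  have s': "(\<Sum>j<K. T (Suc K) * T (Suc j) * b (r K) (r j)) = ?s"
    by (intro sum.cong) (simp_all add: b_sym[of "r K"] mult.commute)
  have "(\<Sum>i<Suc K. \<Sum>j<Suc K. T (Suc i) * T (Suc j) * b (r i) (r j))
      = (\<Sum>i<K. \<Sum>j<K. T (Suc i) * T (Suc j) * b (r i) (r j)) + ?s + ?s + T (Suc K) * T (Suc K) * 2"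
    by (simp add: sum.distrib s' b_ray[of K K])
  also have "\<dots> = (\<Sum>j<K. (g j)\<^sup>2) + (T K)\<^sup>2 - 2 * (T K * T (Suc K)) + 2 * (T (Suc K))\<^sup>2"
    by (simp only: Suc.IH s) (simp add: power2_eq_square)
  also have "\<dots> = (\<Sum>j<Suc K. (g j)\<^sup>2) + (T (Suc K))\<^sup>2"
    by (simp add: T_def power2_eq_square algebra_simps)
  finally show ?case .
qed

lemma bessel:
  defines "f \<equiv> \<lambda>\<alpha> \<beta> u w j. \<alpha> * F u j + \<beta> * F w j"
  shows "(\<Sum>j<N. (f \<alpha> \<beta> u w j)\<^sup>2) \<le> \<alpha>\<^sup>2 * b u u + 2 * \<alpha> * \<beta> * b u w + \<beta>\<^sup>2 * b w w"
proof -
  obtain N1 N2 where N1: "\<forall>j\<ge>N1. F u j = 0" and N2: "\<forall>j\<ge>N2. F w j = 0"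
    using F_eventually_0 by metis
  define L where "L = max N (max N1 N2)"
  define h where "h = f \<alpha> \<beta> u w"
  define X where "X = \<alpha>\<^sup>2 * b u u + 2 * \<alpha> * \<beta> * b u w + \<beta>\<^sup>2 * b w w"
  \<comment> \<open>The test vector realises the coordinates up to \<open>L\<close> exactly and then decays linearly over
    \<open>M\<close> steps; everything is scaled by \<open>M\<close> to stay in the integers.\<close>
  define S where "S = (\<Sum>j<L. h j)"
  define M where "M = nat (S\<^sup>2 + 1)"
  define g where "g j = (if j < L then int M * h j else - S)" for j
  define T where "T i = (\<Sum>j<i. g j)" for i
  define K where "K = L + M"
  have split: "(\<Sum>j<K. q j) = (\<Sum>j<L. q j) + (\<Sum>j\<in>{L..<K}. q j)" for q :: "nat \<Rightarrow> int"
    unfolding K_def lessThan_atLeast0 by (simp add: sum.atLeastLessThan_concat)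
  have h0: "h j = 0" if "j \<ge> L" for j
    using that N1 N2 by (simp add: h_def f_def L_def)
  have step: "h j - h (Suc j) = \<alpha> * b (r j) u + \<beta> * b (r j) w" for j
    by (simp add: h_def f_def algebra_simps flip: F_step)
  have TK: "T K = 0"
    unfolding T_def split by (simp add: g_def K_def S_def flip: sum_distrib_left)
  have g2: "(\<Sum>j<K. (g j)\<^sup>2) = (int M)\<^sup>2 * (\<Sum>j<L. (h j)\<^sup>2) + int M * S\<^sup>2"
    unfolding split by (simp add: g_def K_def power_mult_distrib flip: sum_distrib_left)
  have gh: "(\<Sum>j<K. g j * h j) = int M * (\<Sum>j<L. (h j)\<^sup>2)"
    unfolding split by (simp add: g_def h0 sum_distrib_left power2_eq_square algebra_simps)
  \<comment> \<open>The family spells out \<open>M (\<alpha> u + \<beta> w)\<close> minus the ray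
    combination with coefficients \<open>T (Suc i)\<close>; its squared norm is expanded
    next.\<close>
  define I where "I = (UNIV :: bool set) <+> {..<K}"
  define p where "p = case_sum (\<lambda>x. if x then u else w) r"
  define c where "c = case_sum (\<lambda>x. if x then int M * \<alpha> else int M * \<beta>) (\<lambda>i. - T (Suc i))"
  have "0 \<le> (\<Sum>i\<in>I. \<Sum>j\<in>I. c i * c j * b (p i) (p j))"
    by (rule gram_psd[OF bound]) (auto simp: I_def)
  also have "\<dots> = (int M)\<^sup>2 * X - 2 * int M * (\<Sum>i<K. T (Suc i) * (h i - h (Suc i)))
      + (\<Sum>i<K. \<Sum>j<K. T (Suc i) * T (Suc j) * b (r i) (r j))"
    unfolding I_def
    by (simp add: sum.Plus UNIV_bool p_def c_def step X_def sum.distrib sum_subtractf sum_distrib_left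
        b_sym[of u "r _"] b_sym[of w "r _"] b_sym[of w u] power2_eq_square sum_negf algebra_simps)
  also have "(\<Sum>i<K. T (Suc i) * (h i - h (Suc i))) = int M * (\<Sum>j<L. (h j)\<^sup>2)"
    unfolding T_def sum_by_parts using TK gh by (simp add: T_def)
  also have "(\<Sum>i<K. \<Sum>j<K. T (Suc i) * T (Suc j) * b (r i) (r j)) = (int M)\<^sup>2 * (\<Sum>j<L. (h j)\<^sup>2) + int M * S\<^sup>2"
    using ray_form[of g K] TK g2 by (simp add: T_def)
  finally have "0 \<le> int M * (int M * (X - (\<Sum>j<L. (h j)\<^sup>2)) + S\<^sup>2)"
    by (simp add: power2_eq_square algebra_simps)
  moreover have M: "int M = S\<^sup>2 + 1" by (simp add: M_def)
  then have "0 < int M" by (smt (verit) zero_le_power2)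
  ultimately have le: "0 \<le> int M * (X - (\<Sum>j<L. (h j)\<^sup>2)) + S\<^sup>2"
    by (metis mult_le_cancel_left_pos mult_zero_right)
  \<comment> \<open>Relative to the scaling, the decaying tail costs \<open>S^2 / M\<close>, which
    is less than 1 for \<open>M = S^2 + 1\<close>. Both sides are integers, so the inequality cannot
    fail by less than 1.\<close>
  have "(\<Sum>j<L. (h j)\<^sup>2) \<le> X"
  proof (rule ccontr)
    assume "\<not> ?thesis"
    then have "X - (\<Sum>j<L. (h j)\<^sup>2) \<le> -1" by simp
    then have "int M * (X - (\<Sum>j<L. (h j)\<^sup>2)) \<le> int M * (-1)"
      by (intro mult_left_mono) auto
    then show False using le M by simp
  qed
  moreover have "(\<Sum>j<N. (h j)\<^sup>2) \<le> (\<Sum>j<L. (h j)\<^sup>2)"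
    by (intro sum_mono2) (auto simp: L_def)
  ultimately show ?thesis by (simp add: h_def X_def)
qed

lemma bessel1: "(\<Sum>j<N. (F u j)\<^sup>2) \<le> b u u"
  using bessel[where \<alpha> = 1 and \<beta> = 0 and u = u and w = u and N = N] by simp

text \<open>Equality in Bessel's inequality puts \<open>u\<close> in the span of the
  \<open>e_j\<close>, so its inner products can be read off from coordinates. Formally, the residual
  form of \<open>u\<close> and \<open>w\<close> has diagonal entries 0 and \<open>q\<close> and
  off-diagonal entry \<open>d\<close>, and positivity forces \<open>d = 0\<close>.\<close>

lemma full:
  assumes full: "(\<Sum>j<N. (F u j)\<^sup>2) = b u u"
  shows "b u w = (\<Sum>j<N. F u j * F w j)"
proof -
  define q where "q = b w w - (\<Sum>j<N. (F w j)\<^sup>2)"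
  define d where "d = b u w - (\<Sum>j<N. F u j * F w j)"
  have "0 \<le> 2 * \<alpha> * \<beta> * d + \<beta>\<^sup>2 * q" for \<alpha> \<beta>
  proof -
    have "(\<Sum>j<N. (\<alpha> * F u j + \<beta> * F w j)\<^sup>2)
      = \<alpha>\<^sup>2 * (\<Sum>j<N. (F u j)\<^sup>2) + 2 * \<alpha> * \<beta> * (\<Sum>j<N. F u j * F w j) + \<beta>\<^sup>2 * (\<Sum>j<N. (F w j)\<^sup>2)"
      by (simp add: power2_sum sum.distrib power_mult_distrib sum_distrib_left algebra_simps)
    then show ?thesis
      using bessel[of \<alpha> u \<beta> w N] full by (simp add: d_def q_def algebra_simps)
  qed
  \<comment> \<open>For these coefficients the residual form takes the value
    \<open>- d^2 (q + 2)\<close>.\<close>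
  from this[of "q + 1" "- d"] have "0 \<le> - (d\<^sup>2 * (q + 2))"
    by (simp add: power2_eq_square algebra_simps)
  moreover have "q \<ge> 0" using bessel1[where u = w and N = N] by (simp add: q_def)
  ultimately have "d\<^sup>2 \<le> 0"
    by (metis add_nonneg_pos mult_le_cancel_right_pos mult_zero_left neg_0_le_iff_le zero_less_numeral)
  then have "d = 0" by simp
  then show ?thesis by (simp add: d_def)
qed

end

section \<open>Shape of the vertices around a ray\<close>

text \<open>Here \<open>f\<close> and \<open>g\<close> stand for the coordinates of one vertex of
  charge \<open>c\<close> in the Gram spaces of \<open>2 - A\<close> and \<open>2 + A\<close>. Both
  end at the same index \<open>K\<close> with equal modulus, which must be 1 as the two bounds add
  up to 4. If \<open>K > 0\<close>, the two coordinates before it use up the remaining 2. This makes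
  \<open>f\<close> repeat its value and leaves no room for a charge or for further entries.\<close>

lemma coord_shape:
  fixes f g :: "nat \<Rightarrow> int"
  assumes step: "\<And>j. g j - g (Suc j) = (-1) ^ Suc j * (f j - f (Suc j))"
    and f0: "\<forall>j\<ge>N. f j = 0" and g0: "\<forall>j\<ge>N'. g j = 0"
    and f2: "\<And>n. (\<Sum>j<n. (f j)\<^sup>2) \<le> 2 - c" and g2: "\<And>n. (\<Sum>j<n. (g j)\<^sup>2) \<le> 2 + c"
  shows "(\<forall>j. f j = 0) \<or> (\<bar>f 0\<bar> = 1 \<and> (\<forall>j>0. f j = 0)) \<or>
    (c = 0 \<and> (\<exists>k. \<bar>f k\<bar> = 1 \<and> f (Suc k) = f k \<and> (\<forall>j. j \<noteq> k \<longrightarrow> j \<noteq> Suc k \<longrightarrow> f j = 0)))"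
proof (cases "\<forall>j. f j = 0")
  case False
  then obtain i where i: "f i \<noteq> 0" by blast
  define K where "K = (GREATEST j. f j \<noteq> 0)"
  have bd: "j \<le> N" if "f j \<noteq> 0" for j using f0 that by (meson nat_le_linear)
  have K: "f K \<noteq> 0" unfolding K_def by (rule GreatestI_nat[where b = N]) (use i bd in auto)
  have fK: "f j = 0" if "j > K" for j
    using Greatest_le_nat[of "\<lambda>j. f j \<noteq> 0" j N] bd that by (force simp: K_def)
  have gK: "g j = 0" if "j > K" for j
  proof -
    have "g j = g (j + n)" for n
    proof (induction n)
      case (Suc n)
      have "g (j + n) - g (Suc (j + n)) = 0"
        using that by (subst step) (simp add: fK)
      then show ?case using Suc by simp
    qed simp
    from this[of N'] show ?thesis using g0 by simp
  qed
  have sgn: "((-1) ^ j * x)\<^sup>2 = x\<^sup>2" for j and x :: int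
    by (cases "even j") auto
  have gK2: "(g K)\<^sup>2 = (f K)\<^sup>2"
    using step[of K] fK[of "Suc K"] gK[of "Suc K"] by (simp add: sgn)
  have le: "(\<Sum>j\<in>J. (f j)\<^sup>2) \<le> 2 - c" "(\<Sum>j\<in>J. (g j)\<^sup>2) \<le> 2 + c" if J: "finite J" for J
  proof -
    obtain n where "\<forall>j\<in>J. j < n" using J finite_nat_set_iff_bounded by blast
    then have "J \<subseteq> {..<n}" by auto
    then have "(\<Sum>j\<in>J. (f j)\<^sup>2) \<le> (\<Sum>j<n. (f j)\<^sup>2)" "(\<Sum>j\<in>J. (g j)\<^sup>2) \<le> (\<Sum>j<n. (g j)\<^sup>2)"
      by (auto intro!: sum_mono2)
    then show "(\<Sum>j\<in>J. (f j)\<^sup>2) \<le> 2 - c" "(\<Sum>j\<in>J. (g j)\<^sup>2) \<le> 2 + c"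
      using f2[of n] g2[of n] by linarith+
  qed
  have "(f K)\<^sup>2 \<le> 2" using le[of "{K}"] gK2 by simp
  moreover have "(f K)\<^sup>2 \<ge> 4" if "\<bar>f K\<bar> \<ge> 2"
    using power_mono[OF that, of 2] by simp
  ultimately have abs: "\<bar>f K\<bar> = 1" using K by linarith
  then have fK1: "(f K)\<^sup>2 = 1" by (metis power2_abs power_one)
  show ?thesis
  proof (cases K)
    case 0
    then show ?thesis using abs fK by auto
  next
    case (Suc k)
    define d where "d = f k - f K"
    have "g k = (-1) ^ K * d + g K" using step[of k] by (simp add: Suc d_def)
    also have "g K = - ((-1) ^ K * f K)" using step[of K] fK[of "Suc K"] gK[of "Suc K"] by simp
    finally have "g k = (-1) ^ K * (d - f K)" by (simp add: algebra_simps)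
    \<comment> \<open>A parallelogram identity: the alternating sign turns \<open>f k\<close> and
      \<open>g k\<close> into the sum and, up to sign, the difference of \<open>d\<close> and
      \<open>f K\<close>.\<close>
    then have "(f k)\<^sup>2 + (g k)\<^sup>2 = (f K + d)\<^sup>2 + (d - f K)\<^sup>2"
      by (simp only: sgn) (simp add: d_def)
    also have "\<dots> = 2 + 2 * d\<^sup>2"
      using fK1 by (simp add: power2_sum power2_diff)
    finally have e: "(f k)\<^sup>2 + (g k)\<^sup>2 = 2 + 2 * d\<^sup>2" .
    have "(f k)\<^sup>2 + 1 \<le> 2 - c" "(g k)\<^sup>2 + 1 \<le> 2 + c"
      using le[of "{k, K}"] fK1 gK2 by (simp_all add: Suc)
    then have "d\<^sup>2 \<le> 0" using e by linarith
    then have fk: "f k = f K" by (simp add: d_def)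
    then have gk: "(g k)\<^sup>2 = 1" using e fK1 by (simp add: d_def)
    have c: "c = 0"
      using le[of "{k, K}"] fK1 gK2 fk gk by (simp add: Suc)
    have "f j = 0" if "j \<noteq> k" "j \<noteq> K" for j
      using le(1)[of "{j, k, K}"] fK1 fk c that by (simp add: Suc)
    then show ?thesis using abs fk c Suc by metis
  qed
qed blast

text \<open>
  Negation combined with alternating signs along the ray: it keeps the ray edges at weight 1 and
  exchanges the Gram spaces of $2 - A$ and $2 + A$.
\<close>
definition dual :: "(nat \<Rightarrow> nat) \<Rightarrow> (nat \<Rightarrow> nat \<Rightarrow> int) \<Rightarrow> nat \<Rightarrow> nat \<Rightarrow> int" where
  "dual r a u v = - ((if u \<in> r ` {k. odd k} then - 1 else 1) * (if v \<in> r ` {k. odd k} then - 1 else 1) * a u v)"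

lemma ray_graph_dual:
  assumes "ray_graph a r"
  shows "ray_graph (dual r a) r"
proof -
  interpret ray_graph a r by fact
  have mem: "r i \<in> r ` {k. odd k} \<longleftrightarrow> odd i" for i
    using inj by (auto simp: inj_def)
  let ?s = "\<lambda>u. if u \<in> r ` {k. odd k} then - 1 else (1::int)"
  show ?thesis
  proof
    show "dual r a u v = dual r a v u" for u v
      by (simp add: dual_def sym[of u v])
    show "sq_bound V (dual r a)" if "finite V" for V
      unfolding dual_def[abs_def] using sq_bound_switch[OF bound[OF that], of ?s]
      by (subst sq_bound_uminus) simp
  qed (use small inj uncharged edge no_edge in \<open>auto simp: dual_def mem\<close>)
qed

text \<open>
  The vertices of the ray together with their twins, i.e. those with coordinates
  $\pm(e_k \pm e_{k+1})$; those in \<open>ray_tip\<close> have coordinates $\pm e_0$.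
\<close>
definition ray_nbhd :: "(nat \<Rightarrow> nat \<Rightarrow> int) \<Rightarrow> (nat \<Rightarrow> nat) \<Rightarrow> nat set" where
  "ray_nbhd a r = range r \<union> {x. \<exists>i>0. a x (r i) \<noteq> 0}"

definition ray_tip :: "(nat \<Rightarrow> nat \<Rightarrow> int) \<Rightarrow> (nat \<Rightarrow> nat) \<Rightarrow> nat set" where
  "ray_tip a r = {x. a x (r 0) \<noteq> 0} - ray_nbhd a r"

lemma ray_nbhd_dual: "ray_nbhd (dual r a) r = ray_nbhd a r"
  and ray_tip_dual: "ray_tip (dual r a) r = ray_tip a r"
  by (simp_all add: ray_nbhd_def ray_tip_def dual_def)

text \<open>
  The vertex $(k, \pm)$ stands for $e_{k-1} \pm e_k$, where $e_{-1}$ and $e_m$ are dropped: the two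
  vertices at either end are equal up to sign.
\<close>
definition tess_vec :: "nat \<times> bool \<Rightarrow> nat \<Rightarrow> int" where
  "tess_vec p j = (if Suc j = fst p then 1 else 0) + (if j = fst p then if snd p then 1 else - 1 else 0)"

text \<open>The matrix \<open>2I - CC^T\<close>, where \<open>C\<close> has the rows
  \<open>tess_vec p\<close> cut off at \<open>m\<close>. For \<open>m > 0\<close> it describes a
  cylinder of \<open>m + 1\<close> columns with two vertices each; the vectors in the end columns
  have norm 1, hence these vertices have charge 1.\<close>

definition tess :: "nat \<Rightarrow> nat \<times> bool \<Rightarrow> nat \<times> bool \<Rightarrow> int" where
  "tess m p q = (if p = q then 2 else 0) - (\<Sum>j<m. tess_vec p j * tess_vec q j)"

context ray_graph
begin

lemma F_unique:
  assumes "\<And>j. b (r j) u = f j - f (Suc j)" and "\<forall>j\<ge>N. f j = 0"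
  shows "F u j = f j"
proof -
  obtain N' where N': "\<forall>j\<ge>N'. F u j = 0" using F_eventually_0 by blast
  have "F u j - f j = F u (j + n) - f (j + n)" for n
  proof (induction n)
    case (Suc n)
    then show ?case using F_step[of u "j + n"] assms(1)[of "j + n"] by simp
  qed simp
  from this[of "N + N'"] show ?thesis using N' assms(2) by simp
qed

lemma F_ray: "F (r k) j = (if j = k then 1 else if j = Suc k then -1 else 0)"
  by (rule F_unique[where N = "k + 2"]) (auto simp: b_ray)

lemma b_off_ray: "u \<notin> range r \<Longrightarrow> b (r j) u = - a u (r j)"
  by (auto simp: gram_def sym)

lemma F_shape:
  assumes "u \<notin> range r"
  shows "(\<forall>j. F u j = 0) \<or> (\<bar>F u 0\<bar> = 1 \<and> (\<forall>j>0. F u j = 0)) \<or>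
    (a u u = 0 \<and> (\<exists>k. \<bar>F u k\<bar> = 1 \<and> F u (Suc k) = F u k \<and> (\<forall>j. j \<noteq> k \<longrightarrow> j \<noteq> Suc k \<longrightarrow> F u j = 0)))"
proof -
  interpret D: ray_graph "dual r a" r by (rule ray_graph_dual) unfold_locales
  obtain N where N: "\<forall>j\<ge>N. F u j = 0" using F_eventually_0[of u] by blast
  obtain N' where N': "\<forall>j\<ge>N'. D.F u j = 0" using D.F_eventually_0[of u] by blast
  have step: "D.F u j - D.F u (Suc j) = (- 1) ^ Suc j * (F u j - F u (Suc j))" for j
  proof -
    have "r j \<in> r ` {k. odd k} \<longleftrightarrow> odd j"
      using inj_image_mem_iff[OF inj] by simp
    moreover have "u \<notin> r ` {k. odd k}" using assms by blast
    ultimately have "dual r a u (r j) = - ((- 1) ^ j * a u (r j))"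
      by (simp add: dual_def)
    then show ?thesis
      unfolding F_step D.F_step b_off_ray[OF assms] D.b_off_ray[OF assms] by simp
  qed
  have F2: "(\<Sum>j<n. (F u j)\<^sup>2) \<le> 2 - a u u" for n
    using bessel1[where u = u and N = n] by (simp add: gram_def)
  have "dual r a u u = - a u u" by (simp add: dual_def)
  then have G2: "(\<Sum>j<n. (D.F u j)\<^sup>2) \<le> 2 + a u u" for n
    using D.bessel1[where u = u and N = n] by (simp add: gram_def)
  show ?thesis
    by (rule coord_shape[of "D.F u" "F u" N N' "a u u", OF step N N' F2 G2])
qed

text \<open>A neighbour of \<open>r i\<close> off the ray has different coordinates at
  \<open>i\<close> and \<open>Suc i\<close>. For \<open>i > 0\<close> this excludes the shapes 0 and
  \<open>e_0\<close> up to sign, and leaves the twin of a ray vertex.\<close>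

lemma nbhd_shape:
  assumes "x \<in> ray_nbhd a r"
  shows "a x x = 0 \<and> (\<exists>k. \<bar>F x k\<bar> = 1 \<and> \<bar>F x (Suc k)\<bar> = 1 \<and> (\<forall>j. j \<noteq> k \<longrightarrow> j \<noteq> Suc k \<longrightarrow> F x j = 0))"
proof (cases "x \<in> range r")
  case True
  then obtain k where "x = r k" by blast
  then show ?thesis using uncharged by (auto simp: F_ray intro!: exI[of _ k])
next
  case False
  then obtain i where i: "i > 0" "a x (r i) \<noteq> 0" using assms by (auto simp: ray_nbhd_def)
  then have "F x i - F x (Suc i) \<noteq> 0" unfolding F_step b_off_ray[OF False] by simp
  then show ?thesis using F_shape[OF False] i by (smt (verit) zero_less_Suc)
qed

lemma tip_shape:
  assumes "x \<in> ray_tip a r"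
  shows "\<bar>F x 0\<bar> = 1" "j > 0 \<Longrightarrow> F x j = 0"
proof -
  have x: "x \<notin> range r" "a x (r 0) \<noteq> 0" "\<forall>i. i = 0 \<or> a x (r i) = 0"
    using assms by (auto simp: ray_tip_def ray_nbhd_def)
  have "b (r i) x = 0" if "i > 0" for i
    using x(3)[rule_format, of i] that b_off_ray[OF x(1), of i] by simp
  then have F: "F x j = (if j = 0 then - a x (r 0) else 0)" for j
    by (intro F_unique[where N = 1]) (auto simp: b_off_ray[OF x(1)])
  show "\<bar>F x 0\<bar> = 1" using F[of 0] x(2) small[of x "r 0"] by auto
  show "j > 0 \<Longrightarrow> F x j = 0" using F[of j] by simp
qed

lemma other_shape:
  assumes "x \<notin> ray_nbhd a r" "x \<notin> ray_tip a r"
  shows "F x j = 0"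
proof -
  have x: "x \<notin> range r" and "\<forall>i. i = 0 \<or> a x (r i) = 0" "a x (r 0) = 0"
    using assms by (auto simp: ray_tip_def ray_nbhd_def)
  then have nbr: "a x (r i) = 0" for i by metis
  show ?thesis
    by (rule F_unique[where N = 0]) (use b_off_ray[OF x] nbr in auto)
qed

text \<open>Two coordinates of modulus 1 exhaust the squared norm 2 of an uncharged vertex.\<close>

lemma nbhd_full:
  assumes "x \<in> ray_nbhd a r" and k: "\<And>j. j \<ge> n \<Longrightarrow> F x j = 0"
  shows "(\<Sum>j<n. (F x j)\<^sup>2) = b x x"
proof -
  obtain k where k: "\<bar>F x k\<bar> = 1" "\<bar>F x (Suc k)\<bar> = 1" "\<forall>j. j \<noteq> k \<longrightarrow> j \<noteq> Suc k \<longrightarrow> F x j = 0" and "a x x = 0"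
    using nbhd_shape[OF assms(1)] by blast
  have "k < n" "Suc k < n" using assms(2)[of k] assms(2)[of "Suc k"] k(1,2) by (auto intro: ccontr)
  then have "(\<Sum>j<n. (F x j)\<^sup>2) = (\<Sum>j\<in>{k, Suc k}. (F x j)\<^sup>2)"
    using k(3) by (intro sum.mono_neutral_right) auto
  also have "\<dots> = \<bar>F x k\<bar>\<^sup>2 + \<bar>F x (Suc k)\<bar>\<^sup>2" by simp
  also have "\<dots> = 2" by (simp only: k) simp
  finally show ?thesis using \<open>a x x = 0\<close> by (simp add: gram_def)
qed

text \<open>With charge 1 the squared norm is only 1, so the single coordinate exhausts it. For
  charge -1 the same happens in the dual graph.\<close>

lemma tip_full:
  assumes "x \<in> ray_tip a r" "a x x = 1" "n > 0"
  shows "(\<Sum>j<n. (F x j)\<^sup>2) = b x x"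
proof -
  have "(\<Sum>j<n. (F x j)\<^sup>2) = (\<Sum>j\<in>{0}. (F x j)\<^sup>2)"
    using tip_shape(2)[OF assms(1)] assms(3) by (intro sum.mono_neutral_right) auto
  also have "\<dots> = \<bar>F x 0\<bar>\<^sup>2" by simp
  finally show ?thesis using assms(2) tip_shape(1)[OF assms(1)] by (simp add: gram_def)
qed

text \<open>All other vertices have zero coordinates, hence are orthogonal to a vertex in the span
  of the \<open>e_j\<close>.\<close>

lemma full_nbr:
  assumes "(\<Sum>j<n. (F x j)\<^sup>2) = b x x" "x \<in> ray_nbhd a r \<union> ray_tip a r" "a x y \<noteq> 0"
  shows "y \<in> ray_nbhd a r \<union> ray_tip a r"
proof (rule ccontr)
  assume y: "y \<notin> ray_nbhd a r \<union> ray_tip a r"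
  then have "x \<noteq> y" using assms(2) by blast
  moreover have "b x y = 0" unfolding full[OF assms(1)] using other_shape[of y] y by simp
  ultimately show False using assms(3) by (simp add: gram_def)
qed

lemma nbhd_nbr:
  assumes "x \<in> ray_nbhd a r" "a x y \<noteq> 0"
  shows "y \<in> ray_nbhd a r \<union> ray_tip a r"
proof -
  obtain n where "\<forall>j\<ge>n. F x j = 0" using F_eventually_0 by blast
  then show ?thesis using full_nbr[OF nbhd_full, of x n y] assms by blast
qed

lemma tip_nbr:
  assumes "x \<in> ray_tip a r" "a x x = 1" "a x y \<noteq> 0"
  shows "y \<in> ray_nbhd a r \<union> ray_tip a r"
  using full_nbr[OF tip_full[OF assms(1,2), of 1], of y] assms by simp

lemma tip_F0: "x \<in> ray_tip a r \<Longrightarrow> F x 0 = - a x (r 0)"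
  using tip_shape(2)[of x "Suc 0"] F_step[of x 0] b_off_ray[of x 0]
  by (auto simp: ray_tip_def ray_nbhd_def)

text \<open>In the Gram space of \<open>2 - A\<close> the vertex \<open>x\<close> lies in the span
  of the \<open>e_j\<close>, in that of \<open>2 + A\<close> the vertex \<open>y\<close> does, so
  \<open>a x y\<close> can be computed in both. The two results are opposite to each other, yet of
  modulus 1.\<close>

lemma tip_signs:
  assumes x: "x \<in> ray_tip a r" "a x x = 1" and y: "y \<in> ray_tip a r" "a y y = - 1"
  shows False
proof -
  interpret D: ray_graph "dual r a" r by (rule ray_graph_dual) unfold_locales
  have nr: "x \<notin> range r" "y \<notin> range r" using x y by (auto simp: ray_tip_def ray_nbhd_def)
  then have ns: "x \<notin> r ` {k. odd k}" "y \<notin> r ` {k. odd k}" by blast+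
  have r0: "r 0 \<notin> r ` {k. odd k}" using inj by (auto simp: inj_def)
  have xy: "x \<noteq> y" using x y by auto
  have dy: "y \<in> ray_tip (dual r a) r" "x \<in> ray_tip (dual r a) r" "dual r a y y = 1"
    using x y ns by (simp_all add: ray_tip_dual dual_def)
  have "b x y = F x 0 * F y 0"
    using full[OF tip_full[OF x, of 1], of y] by simp
  moreover have "gram (dual r a) y x = D.F y 0 * D.F x 0"
    using D.full[OF D.tip_full[OF dy(1) dy(3), of 1], of x] by simp
  moreover have "D.F x 0 = - F x 0" "D.F y 0 = - F y 0"
    using D.tip_F0[OF dy(1)] D.tip_F0[OF dy(2)] tip_F0[OF x(1)] tip_F0[OF y(1)] ns r0
    by (simp_all add: dual_def)
  ultimately have "- a x y = F x 0 * F y 0" "a y x = F x 0 * F y 0"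
    using xy ns by (simp_all add: gram_def dual_def)
  then have "F x 0 * F y 0 = 0" using sym[of x y] by simp
  then show False using tip_shape(1)[OF x(1)] tip_shape(1)[OF y(1)] by auto
qed

text \<open>In the Gram space of \<open>2 + A\<close>, the combination of \<open>x\<close>,
  \<open>y\<close>, \<open>z\<close> with coefficients \<open>F x 0\<close>, \<open>F y 0\<close>,
  \<open>F z 0\<close>, plus \<open>r 0\<close>, would have squared norm
  \<open>3 * 3 + 2 - 3 * 2 - 3 * 2 = -1\<close>. So at most two such vertices fit at the tip, as
  many as an end column of a tessellation holds.\<close>

lemma tip_card:
  assumes x: "x \<in> ray_tip a r" "a x x = 1" and y: "y \<in> ray_tip a r" "a y y = 1"
    and z: "z \<in> ray_tip a r" "a z z = 1" and ne: "x \<noteq> y" "x \<noteq> z" "y \<noteq> z"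
  shows False
proof -
  have inner: "a u v = - (F u 0 * F v 0)"
    if "u \<in> ray_tip a r" "a u u = 1" "u \<noteq> v" for u v
    using full[OF tip_full[OF that(1,2), of 1], of v] that(3) by (simp add: gram_def)
  have sq: "F u 0 * F u 0 = 1" if "u \<in> ray_tip a r" for u
    using tip_shape(1)[OF that] by (metis abs_mult_self_eq mult_1)
  have nr: "u \<noteq> r 0" if "u \<in> ray_tip a r" for u using that by (auto simp: ray_tip_def ray_nbhd_def)
  let ?b = "gram (\<lambda>u v. - a u v)"
  let ?f = "F x 0" and ?g = "F y 0" and ?h = "F z 0"
  define p where "p i = [x, y, z, r 0] ! i" for i
  define c where "c i = [?f, ?g, ?h, 1] ! i" for i
  have diag: "?b x x = 3" "?b y y = 3" "?b z z = 3" "?b (r 0) (r 0) = 2"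
    using x y z uncharged by (simp_all add: gram_def)
  have tip: "?b u (r 0) = - F u 0" "?b (r 0) u = - F u 0" if "u \<in> ray_tip a r" for u
    using nr[OF that] tip_F0[OF that] sym[of u "r 0"] by (simp_all add: gram_def)
  have off: "?b u v = - (F u 0 * F v 0)" if "u \<in> ray_tip a r" "a u u = 1" "u \<noteq> v" for u v
    using inner[OF that] that(3) by (simp add: gram_def)
  have "0 \<le> (\<Sum>i<4. \<Sum>j<4. c i * c j * ?b (p i) (p j))"
    by (rule gram_psd) (use bound in \<open>auto simp: sq_bound_uminus\<close>)
  also have "\<dots> = 3 * (?f * ?f) + 3 * (?g * ?g) + 3 * (?h * ?h)
      - 2 * (?f * ?f) * (?g * ?g) - 2 * (?f * ?f) * (?h * ?h) - 2 * (?g * ?g) * (?h * ?h)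
      - 2 * (?f * ?f) - 2 * (?g * ?g) - 2 * (?h * ?h) + 2"
    unfolding p_def c_def
    by (simp add: eval_nat_numeral diag tip[OF x(1)] tip[OF y(1)] tip[OF z(1)]
        off[OF x ne(1)] off[OF y ne(1)[symmetric]] off[OF x ne(2)] off[OF z ne(2)[symmetric]]
        off[OF y ne(3)] off[OF z ne(3)[symmetric]] algebra_simps)
  also have "\<dots> = - 1" by (simp add: sq[OF x(1)] sq[OF y(1)] sq[OF z(1)])
  finally show False by simp
qed

end

text \<open>All vertices of \<open>W\<close> lie in the span of the \<open>e_j\<close>, so their
  coordinates determine the entries between them, and up to a sign, moved into \<open>s\<close>,
  these coordinates form tessellation vectors.\<close>

lemma (in ray_graph) tess_embedding:
  assumes W: "finite W" "W \<subseteq> ray_nbhd a r \<union> {x \<in> ray_tip a r. a x x = 1}"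
  shows "\<exists>m \<phi> s. m > 0 \<and> inj_on \<phi> W \<and> \<phi> ` W \<subseteq> {..m} \<times> UNIV \<and> (\<forall>x. \<bar>s x\<bar> = 1) \<and>
    (\<forall>x\<in>W. \<forall>y\<in>W. a x y = s x * s y * tess m (\<phi> x) (\<phi> y))"
proof -
  have "\<exists>k. \<bar>F x k\<bar> = 1 \<and> \<bar>F x (Suc k)\<bar> = 1 \<and> (\<forall>j. j \<noteq> k \<longrightarrow> j \<noteq> Suc k \<longrightarrow> F x j = 0)"
    if "x \<in> ray_nbhd a r" for x using nbhd_shape[OF that] by blast
  then obtain k where k: "\<And>x. x \<in> ray_nbhd a r \<Longrightarrow> \<bar>F x (k x)\<bar> = 1 \<and> \<bar>F x (Suc (k x))\<bar> = 1 \<and>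
      (\<forall>j. j \<noteq> k x \<longrightarrow> j \<noteq> Suc (k x) \<longrightarrow> F x j = 0)" by metis
  \<comment> \<open>Tip vertices have coordinates \<open>e_0\<close> up to sign. Singling out one of
    them distributes the at most two in \<open>W\<close> over the two places of column 0.\<close>
  define x0 where "x0 = (SOME x. x \<in> W \<and> x \<in> ray_tip a r)"
  define \<phi> where "\<phi> x = (if x \<in> ray_nbhd a r then (Suc (k x), F x (k x) = F x (Suc (k x))) else (0, x = x0))" for x
  define s where "s x = (if x \<in> ray_nbhd a r then F x (k x)
    else if x \<in> ray_tip a r then F x 0 * (if x = x0 then 1 else - 1) else 1)" for x
  \<comment> \<open>So large that no vector of \<open>W\<close> reaches the far end, where
    \<open>e_m\<close> is cut off.\<close>
  define m where "m = Suc (Suc (Max (insert 0 (k ` W))))"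
  have mk: "Suc (k x) < m" if "x \<in> W" for x
    unfolding m_def using W that by (simp add: less_Suc_eq_le)
  have s1: "\<bar>s x\<bar> = 1" for x
    using k[of x] tip_shape(1)[of x] by (simp add: s_def abs_mult)
  have sF: "F x j = s x * tess_vec (\<phi> x) j" if x: "x \<in> W" for x j
  proof (cases "x \<in> ray_nbhd a r")
    case True
    have "F x (Suc (k x)) = F x (k x) * (if F x (k x) = F x (Suc (k x)) then 1 else - 1)"
      using k[OF True] by auto
    then show ?thesis
      using k[OF True] True by (cases "j = k x"; cases "j = Suc (k x)") (auto simp: s_def \<phi>_def tess_vec_def)
  next
    case False
    then have "x \<in> ray_tip a r" using W x by blast
    then show ?thesis
      using tip_shape(2)[of x j] False by (auto simp: s_def \<phi>_def tess_vec_def)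
  qed
  have bF: "b x y = (\<Sum>j<m. F x j * F y j)" if x: "x \<in> W" for x y
  proof (cases "x \<in> ray_nbhd a r")
    case True
    then show ?thesis using mk[OF x] k[OF True] by (intro full nbhd_full) auto
  next
    case False
    then show ?thesis using W x by (intro full tip_full) (auto simp: m_def)
  qed
  \<comment> \<open>Equal places mean equal vectors up to sign. At squared norm 2 this would produce
    an off-diagonal entry of modulus 2.\<close>
  have two: "b x y = s x * s y * b x x" if "x \<in> W" "y \<in> W" "\<phi> x = \<phi> y" for x y
  proof -
    have ss: "s y * s y = 1" for y using s1[of y] by (metis abs_mult_self_eq mult_1)
    have "F y j = s x * s y * F x j" for j
    proof -
      have "s x * s y * F x j = (s x * s x) * (s y * tess_vec (\<phi> y) j)"
        by (simp only: sF[OF that(1), of j] that(3) ac_simps)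
      then show ?thesis by (simp only: sF[OF that(2), of j] ss[of x] mult_1)
    qed
    then show ?thesis unfolding bF[OF that(1)] by (simp add: sum_distrib_left algebra_simps)
  qed
  have inj\<phi>: "inj_on \<phi> W"
  proof (rule inj_onI, rule ccontr)
    fix x y assume x: "x \<in> W" and y: "y \<in> W" and e: "\<phi> x = \<phi> y" and ne: "x \<noteq> y"
    show False
    proof (cases "x \<in> ray_nbhd a r")
      case True
      then have "b x x = 2" using nbhd_shape by (simp add: gram_def)
      then have "\<bar>b x y\<bar> = 2" using two[OF x y e] s1[of x] s1[of y] by (simp add: abs_mult)
      then show False using ne small[of x y] by (simp add: gram_def)
    next
      case False
      then have y': "y \<notin> ray_nbhd a r" using e by (auto simp: \<phi>_def split: if_splits)
      have xy: "x \<in> ray_tip a r" "a x x = 1" "y \<in> ray_tip a r" "a y y = 1"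
        using W x y False y' by auto
      have "x0 \<in> W \<and> x0 \<in> ray_tip a r"
        unfolding x0_def by (rule someI[of _ x]) (use x xy in simp)
      moreover then have "x0 \<notin> ray_nbhd a r" by (simp add: ray_tip_def)
      ultimately have "x0 \<in> ray_tip a r" "a x0 x0 = 1" using W by auto
      moreover have "x \<noteq> x0" "y \<noteq> x0" using e ne False y' by (auto simp: \<phi>_def)
      ultimately show False using tip_card[of x y x0] xy ne by blast
    qed
  qed
  have "a x y = s x * s y * tess m (\<phi> x) (\<phi> y)" if x: "x \<in> W" and y: "y \<in> W" for x y
  proof -
    have "b x y = s x * s y * (\<Sum>j<m. tess_vec (\<phi> x) j * tess_vec (\<phi> y) j)"
      unfolding bF[OF x] by (simp add: sF x y sum_distrib_left algebra_simps)
    moreover have "x = y \<longleftrightarrow> \<phi> x = \<phi> y" using inj\<phi> x y by (auto simp: inj_on_def)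
    moreover have "s x * s x = 1" using s1[of x] by (metis abs_mult_self_eq mult_1)
    then have "s x * s x * 2 = 2" by (simp only: mult_1)
    ultimately show ?thesis
      by (cases "x = y") (simp_all only: gram_def tess_def right_diff_distrib if_True if_False, simp_all)
  qed
  moreover have "\<phi> ` W \<subseteq> {..m} \<times> UNIV"
    using mk by (auto simp: \<phi>_def less_imp_le)
  moreover have "m > 0" by (simp add: m_def)
  ultimately show ?thesis using inj\<phi> s1 by blast
qed

section \<open>Uncharged rays in an arbitrary graph of norm at most 2\<close>

definition cyc_graph :: "(nat \<Rightarrow> nat \<Rightarrow> int) \<Rightarrow> bool" where
  "cyc_graph a \<longleftrightarrow> (\<forall>u v. a u v = a v u) \<and> (\<forall>V. finite V \<longrightarrow> sq_bound V a) \<and> (\<forall>u v. \<bar>a u v\<bar> \<le> 1)"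

definition ray :: "(nat \<Rightarrow> nat \<Rightarrow> int) \<Rightarrow> (nat \<Rightarrow> nat) \<Rightarrow> bool" where
  "ray a r \<longleftrightarrow> inj r \<and> (\<forall>i. a (r i) (r i) = 0) \<and> (\<forall>i. a (r i) (r (Suc i)) \<noteq> 0) \<and>
    (\<forall>i j. i < j \<longrightarrow> j \<noteq> Suc i \<longrightarrow> a (r i) (r j) = 0)"

lemma ray_graph_switch:
  assumes "cyc_graph a" "ray a r"
  shows "\<exists>s. (\<forall>u. \<bar>s u\<bar> = 1) \<and> ray_graph (\<lambda>u v. s u * s v * a u v) r"
proof -
  \<comment> \<open>Running products of the edge weights: consecutive signs multiply to the weight
    of the edge between them.\<close>
  define t where "t = rec_nat 1 (\<lambda>i x. x * a (r i) (r (Suc i)))"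
  have t0: "t 0 = 1" and tS: "t (Suc i) = t i * a (r i) (r (Suc i))" for i
    by (simp_all add: t_def)
  have e: "\<bar>a (r i) (r (Suc i))\<bar> = 1" for i
  proof -
    have "a (r i) (r (Suc i)) \<noteq> 0" "\<bar>a (r i) (r (Suc i))\<bar> \<le> 1"
      using assms by (simp_all add: cyc_graph_def ray_def)
    then show ?thesis by linarith
  qed
  have t: "\<bar>t i\<bar> = 1" for i by (induction i) (simp_all add: t0 tS abs_mult e)
  define s where "s u = (if u \<in> range r then t (inv_into UNIV r u) else 1)" for u
  have s: "\<bar>s u\<bar> = 1" for u by (simp add: s_def t)
  have "inj r" using assms by (simp add: ray_def)
  then have sr: "s (r i) = t i" for i by (simp add: s_def)
  have "ray_graph (\<lambda>u v. s u * s v * a u v) r"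
  proof
    show "s u * s v * a u v = s v * s u * a v u" for u v
      using assms by (simp add: cyc_graph_def)
    show "finite V \<Longrightarrow> sq_bound V (\<lambda>u v. s u * s v * a u v)" for V
      using assms s by (intro sq_bound_switch) (auto simp: cyc_graph_def)
    show "\<bar>s u * s v * a u v\<bar> \<le> 1" for u v
      using assms s by (simp add: cyc_graph_def abs_mult)
    show "s (r i) * s (r (Suc i)) * a (r i) (r (Suc i)) = 1" for i
    proof -
      have "s (r i) * s (r (Suc i)) * a (r i) (r (Suc i))
          = (t i * t i) * (a (r i) (r (Suc i)) * a (r i) (r (Suc i)))"
        by (simp add: sr tS algebra_simps)
      also have "\<dots> = 1" using t[of i] e[of i] by (metis abs_mult_self_eq mult_1)
      finally show ?thesis .
    qed
  qed (use assms in \<open>auto simp: ray_def\<close>)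
  then show ?thesis using s by blast
qed

lemma abs_one_nz: "\<bar>x\<bar> = 1 \<Longrightarrow> x \<noteq> (0::int)" by auto

lemma switch_invariants:
  assumes "\<And>u. \<bar>s u\<bar> = (1::int)"
  shows "ray_nbhd (\<lambda>u v. s u * s v * a u v) r = ray_nbhd a r"
    "ray_tip (\<lambda>u v. s u * s v * a u v) r = ray_tip a r"
    "s u * s u * c = c"
proof -
  have "s u \<noteq> 0" for u using assms[of u] by auto
  then show "ray_nbhd (\<lambda>u v. s u * s v * a u v) r = ray_nbhd a r"
    "ray_tip (\<lambda>u v. s u * s v * a u v) r = ray_tip a r"
    by (simp_all add: ray_nbhd_def ray_tip_def)
  show "s u * s u * c = c" using assms[of u] by (metis abs_mult_self_eq mult_1)
qed

lemma dual_diag: "dual r a u u = - a u u" by (simp add: dual_def)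

lemma ray_nbhd_nbr:
  assumes "cyc_graph a" "ray a r" "x \<in> ray_nbhd a r" "a x y \<noteq> 0"
  shows "y \<in> ray_nbhd a r \<union> ray_tip a r"
proof -
  obtain s where s: "\<And>u. \<bar>s u\<bar> = 1" and "ray_graph (\<lambda>u v. s u * s v * a u v) r"
    using ray_graph_switch[OF assms(1,2)] by blast
  from ray_graph.nbhd_nbr[OF this(2), unfolded switch_invariants[OF s], OF assms(3), of y]
  show ?thesis using assms(4) abs_one_nz[OF s] by simp
qed

text \<open>A charge of either sign lets the vertex exhaust its norm in one of the two Gram spaces.
  An uncharged tip vertex may have neighbours further out; it will serve to prolong the ray.\<close>

lemma ray_tip_nbr:
  assumes "cyc_graph a" "ray a r" "x \<in> ray_tip a r" "a x x \<noteq> 0" "a x y \<noteq> 0"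
  shows "y \<in> ray_nbhd a r \<union> ray_tip a r"
proof -
  obtain s where s: "\<And>u. \<bar>s u\<bar> = 1" and rg: "ray_graph (\<lambda>u v. s u * s v * a u v) r" (is "ray_graph ?a r")
    using ray_graph_switch[OF assms(1,2)] by blast
  have "\<bar>a x x\<bar> \<le> 1" using assms(1) by (simp add: cyc_graph_def)
  then have "a x x = 1 \<or> a x x = - 1" using assms(4) by linarith
  moreover have "?a x x = a x x" "dual r ?a x x = - a x x"
    using switch_invariants(3)[OF s] by (simp_all add: dual_diag)
  ultimately consider "?a x x = 1" | "dual r ?a x x = 1" by fastforce
  then show ?thesis
  proof cases
    case 1
    show ?thesis
      using ray_graph.tip_nbr[OF rg _ 1, of y] assms(3,5) abs_one_nz[OF s] by (simp add: switch_invariants[OF s])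
  next
    case 2
    show ?thesis
      using ray_graph.tip_nbr[OF ray_graph_dual[OF rg] _ 2, of y] assms(3,5) abs_one_nz[OF s]
      by (simp add: ray_nbhd_dual ray_tip_dual switch_invariants[OF s]) (simp add: dual_def)
  qed
qed

lemma ray_tip_signs:
  assumes "cyc_graph a" "ray a r" "x \<in> ray_tip a r" "y \<in> ray_tip a r" "a x x \<noteq> 0" "a y y \<noteq> 0"
  shows "a x x = a y y"
proof -
  obtain s where s: "\<And>u. \<bar>s u\<bar> = 1" and rg: "ray_graph (\<lambda>u v. s u * s v * a u v) r"
    using ray_graph_switch[OF assms(1,2)] by blast
  have diag: "s u * s u * a u u = a u u" for u by (rule switch_invariants(3)[OF s])
  have "\<bar>a x x\<bar> \<le> 1" "\<bar>a y y\<bar> \<le> 1" using assms(1) by (simp_all add: cyc_graph_def)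
  then have "a x x = a y y \<or> (a x x = 1 \<and> a y y = - 1) \<or> (a y y = 1 \<and> a x x = - 1)"
    using assms(5,6) by linarith
  then show ?thesis
    using ray_graph.tip_signs[OF rg, of x y] ray_graph.tip_signs[OF rg, of y x] assms(3,4)
    unfolding switch_invariants(2)[OF s] diag by blast
qed

lemma ray_embedding:
  assumes "cyc_graph a" "ray a r" "finite W" "\<bar>\<epsilon>\<bar> = 1"
    "W \<subseteq> ray_nbhd a r \<union> {x \<in> ray_tip a r. a x x = \<epsilon>}"
  shows "\<exists>m \<phi> s. m > 0 \<and> inj_on \<phi> W \<and> \<phi> ` W \<subseteq> {..m} \<times> UNIV \<and> (\<forall>x. \<bar>s x\<bar> = 1) \<and>
    (\<forall>x\<in>W. \<forall>y\<in>W. a x y = \<epsilon> * s x * s y * tess m (\<phi> x) (\<phi> y))"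
proof -
  obtain s where s: "\<And>u. \<bar>s u\<bar> = 1" and rg: "ray_graph (\<lambda>u v. s u * s v * a u v) r" (is "ray_graph ?a r")
    using ray_graph_switch[OF assms(1,2)] by blast
  \<comment> \<open>For \<open>\<epsilon> = -1\<close> the dual graph is taken, in which these tip
    charges become 1; \<open>t\<close> collects the signs relating \<open>d\<close> to
    \<open>a\<close>.\<close>
  obtain d t where d: "ray_graph d r" "ray_nbhd d r = ray_nbhd a r" "ray_tip d r = ray_tip a r"
    and dd: "\<And>x y. d x y = \<epsilon> * t x * t y * a x y" and t: "\<And>x. \<bar>t x\<bar> = (1::int)"
  proof (cases "\<epsilon> = 1")
    case True
    show ?thesis by (rule that[OF rg, of s]) (simp_all add: switch_invariants[OF s] s True)
  next
    case False
    then have \<epsilon>: "\<epsilon> = -1" using assms(4) by auto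
    show ?thesis
      by (rule that[of "dual r ?a" "\<lambda>x. (if x \<in> r ` {k. odd k} then - 1 else 1) * s x"])
        (simp_all add: ray_graph_dual rg ray_nbhd_dual ray_tip_dual switch_invariants[OF s] s abs_mult
          dual_def \<epsilon>)
  qed
  have tt: "t x * t x = 1" for x using t[of x] by (metis abs_mult_self_eq mult_1)
  have ee: "\<epsilon> * \<epsilon> = 1" using assms(4) by (metis abs_mult_self_eq mult_1)
  have "d x x = \<epsilon> * a x x" for x using tt[of x] by (simp add: dd)
  then have "{x \<in> ray_tip a r. a x x = \<epsilon>} \<subseteq> {x \<in> ray_tip a r. d x x = 1}" using ee by auto
  then have "W \<subseteq> ray_nbhd d r \<union> {x \<in> ray_tip d r. d x x = 1}" using assms(5) d by auto
  from ray_graph.tess_embedding[OF d(1) assms(3) this] obtain m \<phi> q where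
    m: "m > 0" "inj_on \<phi> W" "\<phi> ` W \<subseteq> {..m} \<times> UNIV" "\<forall>x. \<bar>q x\<bar> = 1"
    and dq: "\<forall>x\<in>W. \<forall>y\<in>W. d x y = q x * q y * tess m (\<phi> x) (\<phi> y)" by blast
  have "a x y = \<epsilon> * (t x * q x) * (t y * q y) * tess m (\<phi> x) (\<phi> y)" if "x \<in> W" "y \<in> W" for x y
  proof -
    have "a x y = (\<epsilon> * \<epsilon>) * (t x * t x) * (t y * t y) * a x y" by (simp add: ee tt)
    also have "\<dots> = \<epsilon> * t x * t y * d x y" by (simp add: dd algebra_simps)
    also have "\<dots> = \<epsilon> * (t x * q x) * (t y * q y) * tess m (\<phi> x) (\<phi> y)"
      using dq that by (simp add: algebra_simps)
    finally show ?thesis .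
  qed
  moreover have "\<forall>x. \<bar>t x * q x\<bar> = 1" using t m(4) by (simp add: abs_mult)
  ultimately show ?thesis using m(1-3)
    by (intro exI[of _ m] exI[of _ \<phi>] exI[of _ "\<lambda>x. t x * q x"]) blast
qed

text \<open>Prepending \<open>u\<close> moves the old \<open>r 0\<close> to position 1. Its
  neighbours, and with them the whole old tip, thereby enter the neighbourhood of the new
  ray.\<close>

lemma ray_extend:
  assumes "cyc_graph a" "ray a r" "u \<in> ray_tip a r" "a u u = 0"
  shows "ray a (case_nat u r)"
    "ray_nbhd a r \<union> ray_tip a r \<subseteq> ray_nbhd a (case_nat u r)"
proof -
  have sym: "a x y = a y x" for x y using assms(1) by (simp add: cyc_graph_def)
  have u: "u \<notin> range r" "a u (r 0) \<noteq> 0" and "\<forall>i. i = 0 \<or> a u (r i) = 0"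
    using assms(3) by (auto simp: ray_tip_def ray_nbhd_def)
  then have ui: "a u (r i) = 0" if "i > 0" for i using that by (metis less_irrefl)
  have ne: "u \<noteq> r i" "r i \<noteq> u" for i using u(1) by auto
  have r: "inj r" "\<And>i. a (r i) (r i) = 0" "\<And>i. a (r i) (r (Suc i)) \<noteq> 0"
    "\<And>i j. i < j \<Longrightarrow> j \<noteq> Suc i \<Longrightarrow> a (r i) (r j) = 0"
    using assms(2) unfolding ray_def by blast+
  show "ray a (case_nat u r)"
    unfolding ray_def
  proof (intro conjI allI impI)
    show "inj (case_nat u r)"
    proof (rule injI)
      fix i j assume "(case i of 0 \<Rightarrow> u | Suc i \<Rightarrow> r i) = (case j of 0 \<Rightarrow> u | Suc i \<Rightarrow> r i)"
      then show "i = j" using ne inj_eq[OF r(1)] by (cases i; cases j) simp_all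
    qed
    show "a (case i of 0 \<Rightarrow> u | Suc i \<Rightarrow> r i) (case i of 0 \<Rightarrow> u | Suc i \<Rightarrow> r i) = 0" for i
      by (cases i) (simp_all add: r assms(4))
    show "a (case i of 0 \<Rightarrow> u | Suc i \<Rightarrow> r i) (case Suc i of 0 \<Rightarrow> u | Suc i \<Rightarrow> r i) \<noteq> 0" for i
      by (cases i) (simp_all add: r u)
    show "a (case i of 0 \<Rightarrow> u | Suc i \<Rightarrow> r i) (case j of 0 \<Rightarrow> u | Suc i \<Rightarrow> r i) = 0"
      if "i < j" "j \<noteq> Suc i" for i j
      using that by (cases i; cases j) (simp_all add: r ui)
  qed
  have S: "r i = case_nat u r (Suc i)" for i by simp
  show "ray_nbhd a r \<union> ray_tip a r \<subseteq> ray_nbhd a (case_nat u r)"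
    unfolding ray_nbhd_def ray_tip_def by (auto simp: S simp del: nat.case)
qed

text \<open>Either some ray has only charged tip vertices; then its neighbourhood and tip are closed
  under adjacency and make up the whole graph. Or every ray can be prolonged backwards; then the
  increasing neighbourhoods exhaust the graph, and one of them contains \<open>W\<close>.\<close>

lemma finite_piece_embedding:
  assumes a: "cyc_graph a" "ray a r" and W: "finite W"
    and conn: "\<And>X. X \<noteq> {} \<Longrightarrow> (\<And>x y. x \<in> X \<Longrightarrow> a x y \<noteq> 0 \<Longrightarrow> y \<in> X) \<Longrightarrow> X = UNIV"
  shows "\<exists>m \<phi> s \<epsilon>. m > 0 \<and> inj_on \<phi> W \<and> \<phi> ` W \<subseteq> {..m} \<times> UNIV \<and> (\<forall>x. \<bar>s x\<bar> = 1) \<and> \<bar>\<epsilon>\<bar> = 1 \<and>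
    (\<forall>x\<in>W. \<forall>y\<in>W. a x y = \<epsilon> * s x * s y * tess m (\<phi> x) (\<phi> y))"
proof -
  have "\<exists>r \<epsilon>. ray a r \<and> \<bar>\<epsilon>\<bar> = 1 \<and> W \<subseteq> ray_nbhd a r \<union> {x \<in> ray_tip a r. a x x = \<epsilon>}"
  proof (cases "\<exists>r. ray a r \<and> (\<forall>x\<in>ray_tip a r. a x x \<noteq> 0)")
    case True
    then obtain r where r: "ray a r" and ch: "\<And>x. x \<in> ray_tip a r \<Longrightarrow> a x x \<noteq> 0" by blast
    have "ray_nbhd a r \<union> ray_tip a r = UNIV"
    proof (rule conn)
      show "ray_nbhd a r \<union> ray_tip a r \<noteq> {}" by (auto simp: ray_nbhd_def)
    qed (use ray_nbhd_nbr[OF a(1) r] ray_tip_nbr[OF a(1) r] ch in blast)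
    moreover obtain \<epsilon> where "\<bar>\<epsilon>\<bar> = 1" "\<And>x. x \<in> ray_tip a r \<Longrightarrow> a x x = \<epsilon>"
    proof (cases "ray_tip a r = {}")
      case True
      then show ?thesis using that[of 1] by simp
    next
      case False
      then obtain x where x: "x \<in> ray_tip a r" by blast
      have "\<bar>a x x\<bar> \<le> 1" using a(1) by (simp add: cyc_graph_def)
      then have "\<bar>a x x\<bar> = 1" using ch[OF x] by linarith
      then show ?thesis using that[of "a x x"] ray_tip_signs[OF a(1) r _ x] ch x by metis
    qed
    ultimately show ?thesis using r by blast
  next
    case False
    have "\<exists>r'. ray a r' \<and> ray_nbhd a r \<union> ray_tip a r \<subseteq> ray_nbhd a r'" if r: "ray a r" for r
    proof -
      obtain u where "u \<in> ray_tip a r" "a u u = 0" using False r by auto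
      then show ?thesis using ray_extend[OF a(1) r, of u] by blast
    qed
    then obtain nx where nx: "\<And>r. ray a r \<Longrightarrow> ray a (nx r)"
      "\<And>r. ray a r \<Longrightarrow> ray_nbhd a r \<union> ray_tip a r \<subseteq> ray_nbhd a (nx r)" by metis
    define q where "q n = (nx ^^ n) r" for n
    have q: "ray a (q n)" for n by (induction n) (use a(2) nx(1) in \<open>auto simp: q_def\<close>)
    have qS: "ray_nbhd a (q n) \<union> ray_tip a (q n) \<subseteq> ray_nbhd a (q (Suc n))" for n
      using nx(2)[OF q[of n]] by (simp add: q_def)
    have U: "(\<Union>n. ray_nbhd a (q n)) = UNIV"
    proof (rule conn)
      show "(\<Union>n. ray_nbhd a (q n)) \<noteq> {}" by (auto simp: ray_nbhd_def)
      show "y \<in> (\<Union>n. ray_nbhd a (q n))" if "x \<in> (\<Union>n. ray_nbhd a (q n))" "a x y \<noteq> 0" for x y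
        using that ray_nbhd_nbr[OF a(1) q] qS by blast
    qed
    have inc: "incseq (\<lambda>n. ray_nbhd a (q n))" using qS by (intro incseq_SucI) blast
    have "\<exists>n. W \<subseteq> ray_nbhd a (q n)"
      using W
    proof (induction W rule: finite_induct)
      case (insert x W)
      then obtain n n' where "W \<subseteq> ray_nbhd a (q n)" "x \<in> ray_nbhd a (q n')" using U by blast
      then have "insert x W \<subseteq> ray_nbhd a (q (max n n'))"
        using incseqD[OF inc, of n "max n n'"] incseqD[OF inc, of n' "max n n'"] by auto
      then show ?case by blast
    qed simp
    then obtain n where "W \<subseteq> ray_nbhd a (q n)" by blast
    \<comment> \<open>No tip vertex is involved here, so \<open>\<epsilon>\<close> may be chosen
      arbitrarily.\<close>
    then show ?thesis using q[of n] by (intro exI[of _ "q n"] exI[of _ 1]) auto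
  qed
  then obtain r' \<epsilon> where r': "ray a r'" and \<epsilon>: "\<bar>\<epsilon>\<bar> = 1"
    and "W \<subseteq> ray_nbhd a r' \<union> {x \<in> ray_tip a r'. a x x = \<epsilon>}" by blast
  from ray_embedding[OF a(1) r' W this(2,3)] \<epsilon> show ?thesis by blast
qed

section \<open>Existence of a ray\<close>

lemma path_center_uncharged:
  fixes d :: "nat \<Rightarrow> int"
  assumes "sq_bound {..<17} (\<lambda>i j. if i = j then d i else if j = Suc i \<or> i = Suc j then 1 else 0)"
    (is "sq_bound _ ?M")
  shows "d 8 = 0"
proof -
  \<comment> \<open>On a tent function of height 8 and on its alternating twist the two estimates add up to a
    bound on the charges: the central one contributes 64 times its square, but only 58 is available.\<close>
  define T where "T k = int (min k (16 - k))" for k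
  define q where "q u = (if u = 0 then 0 else T (u - 1)) + T (Suc u)" for u
  have row: "(\<Sum>j<17. ?M u j * z j)
      = (if u = 0 then 0 else z (u - 1)) + (if u < 16 then z (Suc u) else 0) + d u * z u"
    if u: "u < 17" for u z
  proof -
    have "(\<Sum>j<17. ?M u j * z j) = (\<Sum>j<17. (if j = u - 1 then if u = 0 then 0 else z (u - 1) else 0)
        + (if j = Suc u then z (Suc u) else 0) + (if j = u then d u * z u else 0))"
      by (intro sum.cong) auto
    then show ?thesis using u by (simp add: sum.distrib)
  qed
  have T17: "T 17 = 0" by (simp add: T_def)
  have r1: "(\<Sum>j<17. ?M u j * T j) = q u + d u * T u" if "u < 17" for u
    unfolding row[OF that] using that T17 by (cases "u = 16") (auto simp: q_def)
  have r2: "(\<Sum>j<17. ?M u j * ((-1) ^ j * T j)) = (-1) ^ u * (d u * T u - q u)" if "u < 17" for u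
    unfolding row[OF that] using that T17 by (cases u; cases "u = 16") (auto simp: q_def algebra_simps)
  have sgn: "((-1) ^ j * x)\<^sup>2 = x\<^sup>2" for j and x :: int
    by (cases "even j") auto
  have "(\<Sum>u<17. (q u + d u * T u)\<^sup>2) \<le> 4 * (\<Sum>u<17. (T u)\<^sup>2)"
    using assms[unfolded sq_bound_def, rule_format, of T] r1 by simp
  moreover have "(\<Sum>u<17. (d u * T u - q u)\<^sup>2) \<le> 4 * (\<Sum>u<17. (T u)\<^sup>2)"
    using assms[unfolded sq_bound_def, rule_format, of "\<lambda>j. (-1) ^ j * T j"] r2 by (simp add: sgn)
  moreover have "(\<Sum>u<17. (q u + d u * T u)\<^sup>2) + (\<Sum>u<17. (d u * T u - q u)\<^sup>2)
      = (\<Sum>u<17. 2 * (q u)\<^sup>2 + 2 * (d u * T u)\<^sup>2)"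
    unfolding sum.distrib[symmetric]
    by (intro sum.cong refl) (simp add: power2_eq_square algebra_simps)
  ultimately have "2 * (\<Sum>u<17. (q u)\<^sup>2) + 2 * (\<Sum>u<17. (d u * T u)\<^sup>2) \<le> 8 * (\<Sum>u<17. (T u)\<^sup>2)"
    by (simp add: sum.distrib flip: sum_distrib_left)
  moreover have "(\<Sum>u<17. (T u)\<^sup>2) = 344"
    by (simp add: T_def eval_nat_numeral)
  moreover have "(\<Sum>u<17. (q u)\<^sup>2) = 1318"
    by (simp add: q_def T_def eval_nat_numeral)
  moreover have "(\<Sum>u\<in>{8}. (d u * T u)\<^sup>2) \<le> (\<Sum>u<17. (d u * T u)\<^sup>2)"
    by (intro sum_mono2) auto
  \<comment> \<open>A tent of height \<open>h\<close> leaves \<open>8h - 6\<close> for the charges,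
    and 8 is the least height with \<open>h^2 > 8h - 6\<close>; hence \<open>2 * 8 + 1 = 17\<close>
    vertices.\<close>
  ultimately have "(d 8 * 8)\<^sup>2 \<le> 58" by (simp add: T_def)
  then have "(d 8)\<^sup>2 * 64 \<le> 58" by (simp add: power_mult_distrib)
  then have "(d 8)\<^sup>2 \<le> 0" by linarith
  then show ?thesis by simp
qed

text \<open>From the ninth vertex on, each vertex is the centre of an induced path of 17 vertices.
  Once the edge weights are switched to 1, its charge must vanish.\<close>

lemma induced_path_ray:
  assumes a: "cyc_graph a" and r: "inj r" "\<And>i. a (r i) (r (Suc i)) \<noteq> 0"
    "\<And>i j. i < j \<Longrightarrow> j \<noteq> Suc i \<Longrightarrow> a (r i) (r j) = 0"
  shows "ray a (\<lambda>i. r (i + 8))"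
proof -
  have sym: "a x y = a y x" for x y using a by (simp add: cyc_graph_def)
  define e where "e i = a (r i) (r (Suc i))" for i
  have e: "e i * e i = 1" for i
  proof -
    have "e i \<noteq> 0" "\<bar>e i\<bar> \<le> 1" using a r(2)[of i] by (simp_all add: e_def cyc_graph_def)
    then have "\<bar>e i\<bar> = 1" by linarith
    then show ?thesis by (metis abs_mult_self_eq mult_1)
  qed
  define t where "t = rec_nat 1 (\<lambda>i x. x * e i)"
  have t0: "t 0 = 1" and tS: "t (Suc i) = t i * e i" for i by (simp_all add: t_def)
  have t: "t i * t i = 1" for i
  proof (induction i)
    case (Suc i)
    have "t (Suc i) * t (Suc i) = (t i * t i) * (e i * e i)" by (simp add: tS algebra_simps)
    then show ?case by (simp add: Suc e)
  qed (simp add: t0)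
  have t1: "\<bar>t i\<bar> = 1" for i using t[of i] by (auto simp: zmult_eq_1_iff)
  have "a (r (n + 8)) (r (n + 8)) = 0" for n
  proof -
    let ?f = "\<lambda>i. r (n + i)"
    have "sq_bound (?f ` {..<17}) a" using a by (simp add: cyc_graph_def)
    moreover have "inj_on ?f {..<17}" by (auto intro!: inj_onI dest!: injD[OF r(1)])
    ultimately have "sq_bound {..<17} (\<lambda>i j. a (?f i) (?f j))" by (rule sq_bound_reindex)
    then have "sq_bound {..<17} (\<lambda>i j. t (n + i) * t (n + j) * a (?f i) (?f j))"
      using t1 by (rule sq_bound_switch[where s = "\<lambda>i. t (n + i)"])
    also have "(\<lambda>i j. t (n + i) * t (n + j) * a (?f i) (?f j)) = (\<lambda>i j. if i = j then a (?f i) (?f i)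
        else if j = Suc i \<or> i = Suc j then 1 else 0)" (is "?L = ?R")
    proof (intro ext)
      have up: "t i * t (Suc i) * a (r i) (r (Suc i)) = 1" for i
      proof -
        have "t i * t (Suc i) * a (r i) (r (Suc i)) = (t i * t i) * (e i * e i)"
          by (simp add: tS e_def algebra_simps)
        then show ?thesis by (simp add: t e)
      qed
      have lt: "?L i j = ?R i j" if "i < j" for i j
        using that up[of "n + i"] r(3)[of "n + i" "n + j"] by auto
      fix i j :: nat
      consider "i < j" | "i = j" | "j < i" by linarith
      then show "?L i j = ?R i j"
      proof cases
        case 2
        then show ?thesis by (simp add: t)
      next
        case 3
        have "?L i j = ?L j i" by (simp add: sym[of "?f i"] mult.commute)
        then show ?thesis using lt[OF 3] 3 by auto
      qed (rule lt)
    qed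
    finally show ?thesis using path_center_uncharged[of "\<lambda>i. a (?f i) (?f i)"] by simp
  qed
  moreover have "inj (\<lambda>i. r (i + 8))" by (auto intro!: injI dest!: injD[OF r(1)])
  moreover have "a (r (i + 8)) (r (Suc i + 8)) \<noteq> 0" for i
    using r(2)[of "i + 8"] by (simp only: add_Suc not_False_eq_True)
  moreover have "a (r (i + 8)) (r (j + 8)) = 0" if "i < j" "j \<noteq> Suc i" for i j
    using r(3)[of "i + 8" "j + 8"] that by simp
  ultimately show ?thesis unfolding ray_def by blast
qed

text \<open>Koenig's lemma for the forest in which \<open>n\<close> hangs below \<open>p n\<close>:
  the finite support of each column makes it locally finite, and its roots are the finitely many
  vertices below \<open>n0\<close>.\<close>

lemma exists_ray:
  assumes a: "cyc_graph a" and nbr: "\<And>n. n \<ge> n0 \<Longrightarrow> \<exists>m<n. a n m \<noteq> 0"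
  shows "\<exists>r. ray a r"
proof -
  have sym: "a x y = a y x" for x y using a by (simp add: cyc_graph_def)
  have fin: "finite {v. a v u \<noteq> 0}" for u
    using a by (intro finite_support) (simp add: cyc_graph_def)
  \<comment> \<open>Taking the least neighbour as parent makes every branch of the tree an induced path.\<close>
  define p where "p n = (LEAST m. a n m \<noteq> 0)" for n
  have p: "a n (p n) \<noteq> 0" "p n < n" if n: "n \<ge> n0" for n
  proof -
    obtain m where m: "m < n" "a n m \<noteq> 0" using nbr[OF n] by blast
    show "a n (p n) \<noteq> 0" unfolding p_def by (rule LeastI) (rule m(2))
    show "p n < n" using Least_le[of "\<lambda>m. a n m \<noteq> 0", OF m(2)] m(1) by (simp add: p_def)
  qed
  \<comment> \<open>Roots become fixed points, so that iterating \<open>p'\<close> from any vertex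
    ends at a root; \<open>D v\<close> is the set of descendants of \<open>v\<close>, including
    \<open>v\<close>.\<close>
  define p' where "p' n = (if n < n0 then n else p n)" for n
  define D where "D v = {n. \<exists>k. (p' ^^ k) n = v}" for v
  have "\<exists>v<n0. n \<in> D v" for n
  proof (induction n rule: less_induct)
    case (less n)
    show ?case
    proof (cases "n < n0")
      case True
      then show ?thesis unfolding D_def by (intro exI[of _ n]) (auto intro: exI[of _ 0])
    next
      case False
      then obtain v k where "v < n0" "(p' ^^ k) (p' n) = v" using less[of "p n"] p by (auto simp: D_def p'_def)
      then show ?thesis unfolding D_def by (intro exI[of _ v]) (auto intro!: exI[of _ "Suc k"] simp: funpow_swap1)
    qed
  qed
  then have "(\<Union>v<n0. D v) = UNIV" by blast
  then have start: "\<exists>v. infinite (D v)"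
    by (metis finite_UN_I finite_lessThan infinite_UNIV_nat)
  have step: "\<exists>w\<ge>n0. p w = v \<and> infinite (D w)" if v: "infinite (D v)" for v
  proof (rule ccontr)
    assume no: "\<not> ?thesis"
    let ?C = "{w. w \<ge> n0 \<and> p w = v}"
    have "?C \<subseteq> {w. a w v \<noteq> 0}" using p by auto
    then have "finite (\<Union>w\<in>?C. D w)" using no fin[of v] by (intro finite_UN_I) (auto intro: finite_subset)
    moreover have "n \<in> insert v (\<Union>w\<in>?C. D w)" if "(p' ^^ k) n = v" for n k
      using that
    proof (induction k)
      case (Suc k)
      let ?w = "(p' ^^ k) n"
      show ?case
      proof (cases "?w < n0")
        case True
        then have "(p' ^^ Suc k) n = ?w" by (simp add: p'_def)
        then show ?thesis using Suc by simp
      next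
        case False
        then have "(p' ^^ Suc k) n = p ?w" by (simp add: p'_def)
        then have "?w \<in> ?C" using Suc.prems False by simp
        then show ?thesis unfolding D_def by blast
      qed
    qed simp
    then have "D v \<subseteq> insert v (\<Union>w\<in>?C. D w)" unfolding D_def[of v] by blast
    ultimately show False using v finite_subset by blast
  qed
  obtain r where inf: "\<And>n. infinite (D (r n))" and r: "\<And>n. r (Suc n) \<ge> n0 \<and> p (r (Suc n)) = r n"
    using dependent_nat_choice[of "\<lambda>_ v. infinite (D v)" "\<lambda>_ v w. w \<ge> n0 \<and> p w = v"] start step by metis
  have "r n < r (Suc n)" for n using p(2)[of "r (Suc n)"] r[of n] by simp
  then have mono: "strict_mono r" by (simp add: strict_mono_Suc_iff)
  show ?thesis
  proof (rule exI, rule induced_path_ray[OF a])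
    show "inj r" using mono by (rule strict_mono_imp_inj_on)
    show "a (r i) (r (Suc i)) \<noteq> 0" for i using p(1)[of "r (Suc i)"] r[of i] sym by metis
    show "a (r i) (r j) = 0" if ij: "i < j" "j \<noteq> Suc i" for i j
    proof (rule ccontr)
      assume ne: "a (r i) (r j) \<noteq> 0"
      obtain k where k: "j = Suc k" using ij by (cases j) auto
      have "p (r j) \<le> r i" unfolding p_def using ne sym by (intro Least_le) metis
      then have "r k \<le> r i" using r[of k] k by simp
      then show False using ij k mono by (simp add: strict_mono_less_eq)
    qed
  qed
qed

section \<open>Spectra of symmetric matrices\<close>

text \<open>For symmetric \<open>A\<close> the squared norms \<open>q k\<close> of
  \<open>A^k z\<close> are log-convex by Cauchy-Schwarz. A first step that increases the norm would
  repeat its growth factor forever, against the boundedness of the powers.\<close>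

lemma power_bounded_contraction:
  fixes z :: "nat \<Rightarrow> real"
  assumes A: "A \<in> carrier_mat n n" "transpose_mat A = A"
    and bd: "\<And>k i j. i < n \<Longrightarrow> j < n \<Longrightarrow> \<bar>(A ^\<^sub>m k) $$ (i, j)\<bar> \<le> C"
  shows "(\<Sum>i<n. (\<Sum>j<n. A $$ (i, j) * z j)\<^sup>2) \<le> (\<Sum>i<n. (z i)\<^sup>2)"
proof -
  define L where "L x i = (\<Sum>j<n. A $$ (i, j) * x j)" for x :: "nat \<Rightarrow> real" and i
  define w where "w k = (L ^^ k) z" for k
  define q where "q k = (\<Sum>i<n. (w k i)\<^sup>2)" for k
  have sym: "A $$ (i, j) = A $$ (j, i)" if "i < n" "j < n" for i j
    using A that by (metis carrier_matD index_transpose_mat(1))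
  have wS: "w (Suc k) = L (w k)" for k by (simp add: w_def)
  have self_adj: "(\<Sum>i<n. L x i * y i) = (\<Sum>i<n. x i * L y i)" for x y
  proof -
    have "(\<Sum>i<n. L x i * y i) = (\<Sum>i<n. \<Sum>j<n. A $$ (i, j) * x j * y i)"
      by (simp add: L_def sum_distrib_right)
    also have "\<dots> = (\<Sum>j<n. \<Sum>i<n. A $$ (i, j) * x j * y i)" by (rule sum.swap)
    also have "\<dots> = (\<Sum>j<n. x j * L y j)"
      unfolding L_def sum_distrib_left by (intro sum.cong refl) (simp add: sym)
    finally show ?thesis .
  qed
  have convex: "(q (Suc k))\<^sup>2 \<le> q k * q (Suc (Suc k))" for k
  proof -
    have "q (Suc k) = (\<Sum>i<n. w k i * w (Suc (Suc k)) i)"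
      using self_adj[of "w k" "w (Suc k)"] by (simp add: q_def wS power2_eq_square)
    then show ?thesis
      using Cauchy_Schwarz_ineq_sum[of "w k" "w (Suc (Suc k))" "{..<n}"] by (simp add: q_def)
  qed
  have pow: "(L ^^ k) x i = (\<Sum>j<n. (A ^\<^sub>m k) $$ (i, j) * x j)" if "i < n" for k x i
    using that
  proof (induction k arbitrary: x)
    case 0
    have "(\<Sum>j<n. (A ^\<^sub>m 0) $$ (i, j) * x j) = (\<Sum>j<n. if j = i then x j else 0)"
      using A(1) 0 by (intro sum.cong) auto
    then show ?case using 0 by simp
  next
    case (Suc k)
    have Ak: "A ^\<^sub>m k \<in> carrier_mat n n" using A(1) by simp
    have "(L ^^ Suc k) x i = (\<Sum>l<n. (A ^\<^sub>m k) $$ (i, l) * L x l)"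
      using Suc by (simp add: funpow_swap1)
    also have "\<dots> = (\<Sum>l<n. \<Sum>j<n. (A ^\<^sub>m k) $$ (i, l) * A $$ (l, j) * x j)"
      by (simp add: L_def sum_distrib_left mult.assoc)
    also have "\<dots> = (\<Sum>j<n. \<Sum>l<n. (A ^\<^sub>m k) $$ (i, l) * A $$ (l, j) * x j)" by (rule sum.swap)
    also have "\<dots> = (\<Sum>j<n. (A ^\<^sub>m Suc k) $$ (i, j) * x j)"
      using A(1) Ak Suc.prems
      by (intro sum.cong) (auto simp: scalar_prod_def sum_distrib_right lessThan_atLeast0)
    finally show ?case .
  qed
  define D where "D = (\<Sum>i<n. (\<Sum>j<n. C * \<bar>z j\<bar>)\<^sup>2)"
  have qD: "q k \<le> D" for k
    unfolding q_def D_def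
  proof (intro sum_mono)
    fix i assume i: "i \<in> {..<n}"
    have "\<bar>w k i\<bar> \<le> (\<Sum>j<n. \<bar>(A ^\<^sub>m k) $$ (i, j) * z j\<bar>)"
      using i by (simp add: w_def pow sum_abs)
    also have "\<dots> \<le> (\<Sum>j<n. C * \<bar>z j\<bar>)"
      using i bd[of i _ k] by (intro sum_mono) (auto simp: abs_mult intro!: mult_right_mono)
    finally show "(w k i)\<^sup>2 \<le> (\<Sum>j<n. C * \<bar>z j\<bar>)\<^sup>2"
      by (metis abs_ge_zero power2_abs power_mono)
  qed
  have "q 1 \<le> q 0"
  proof (rule ccontr)
    assume "\<not> ?thesis"
    then have gt: "q 1 > q 0" by simp
    have nn: "q k \<ge> 0" for k by (simp add: q_def sum_nonneg)
    have q0: "q 0 > 0"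
    proof (rule ccontr)
      assume "\<not> ?thesis"
      then have "q 0 = 0" using nn[of 0] by simp
      then show False using convex[of 0] gt by simp
    qed
    define \<rho> where "\<rho> = q 1 / q 0"
    have \<rho>: "\<rho> > 1" using gt q0 by (simp add: \<rho>_def)
    have grow: "q k > 0 \<and> q (Suc k) \<ge> \<rho> * q k" for k
    proof (induction k)
      case 0
      then show ?case using q0 by (simp add: \<rho>_def)
    next
      case (Suc k)
      then have pos: "q (Suc k) > 0"
        using \<rho> by (smt (verit) mult_pos_pos)
      have "\<rho> * q (Suc k) * q k \<le> (q (Suc k))\<^sup>2"
        using Suc pos by (simp add: power2_eq_square mult.assoc mult.left_commute[of _ "q (Suc k)"])
      also have "\<dots> \<le> q k * q (Suc (Suc k))" by (rule convex)
      finally have "q k * (\<rho> * q (Suc k)) \<le> q k * q (Suc (Suc k))" by (simp add: mult_ac)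
      then show ?case using pos Suc by simp
    qed
    have "q k \<ge> \<rho> ^ k * q 0" for k
    proof (induction k)
      case (Suc k)
      have "\<rho> ^ Suc k * q 0 \<le> \<rho> * q k" using Suc \<rho> by (simp add: mult.assoc)
      then show ?case using grow[of k] by linarith
    qed simp
    moreover obtain k where "D / q 0 < \<rho> ^ k" using real_arch_pow[OF \<rho>] by blast
    ultimately show False using qD[of k] q0 by (smt (verit) pos_divide_less_eq)
  qed
  then show ?thesis by (simp add: q_def wS w_def L_def)
qed

text \<open>For \<open>x > 2\<close> the matrix \<open>A / x\<close> has spectral radius below 1, so
  its powers are bounded by the Jordan normal form, and symmetry makes it a contraction. Then
  \<open>x\<close> tends to 2 from above.\<close>

lemma cyclotomic_sq_bound:
  assumes cyc: "cyclotomic A" and A: "A \<in> carrier_mat n n"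
  shows "sq_bound {..<n} (\<lambda>i j. A $$ (i, j))"
proof (cases "n = 0")
  case False
  have sym: "transpose_mat A = A"
    and ev: "\<And>z. eigenvalue (map_mat complex_of_real A) z \<Longrightarrow> z \<in> \<real> \<and> - 2 \<le> Re z \<and> Re z \<le> 2"
    using cyc by (auto simp: cyclotomic_def)
  have key: "(\<Sum>i<n. (\<Sum>j<n. A $$ (i, j) * z j)\<^sup>2) \<le> x\<^sup>2 * (\<Sum>i<n. (z i)\<^sup>2)" if x: "x > 2" for z x
  proof -
    let ?B = "(1 / x) \<cdot>\<^sub>m A"
    let ?Bc = "map_mat complex_of_real ?B" and ?Ac = "map_mat complex_of_real A"
    have B: "?B \<in> carrier_mat n n" and Bc: "?Bc \<in> carrier_mat n n" and Ac: "?Ac \<in> carrier_mat n n"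
      using A by auto
    have "norm b < 1" if evb: "eigenvalue ?Bc b" for b
    proof -
      obtain v where v: "v \<in> carrier_vec n" "v \<noteq> 0\<^sub>v n" "?Bc *\<^sub>v v = b \<cdot>\<^sub>v v"
        using evb A by (auto simp: eigenvalue_def eigenvector_def)
      have "?Ac *\<^sub>v v = complex_of_real x \<cdot>\<^sub>v (?Bc *\<^sub>v v)"
        using v(1) A x
        by (intro eq_vecI) (auto simp: scalar_prod_def sum_distrib_left)
      also have "\<dots> = (complex_of_real x * b) \<cdot>\<^sub>v v"
        unfolding v(3) by (simp add: smult_smult_assoc)
      finally have "eigenvalue ?Ac (complex_of_real x * b)"
        using v A by (auto simp: eigenvalue_def eigenvector_def)
      from ev[OF this] have "norm (complex_of_real x * b) \<le> 2"
        using in_Reals_norm[of "complex_of_real x * b"] by linarith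
      then show ?thesis using x by (simp add: norm_mult) (smt (verit) mult_le_cancel_left1 norm_ge_zero)
    qed
    then have "spectral_radius ?Bc < 1"
      using spectral_radius_mem_max(1)[OF Bc] False by (auto simp: spectrum_def)
    from spectral_radius_jnf_norm_bound_less_1_upper_triangular[OF Bc this]
    obtain C where C: "\<And>k. norm_bound (?Bc ^\<^sub>m k) C" by blast
    have "\<bar>(?B ^\<^sub>m k) $$ (i, j)\<bar> \<le> C" if "i < n" "j < n" for k i j
    proof -
      define P where "P = ?B ^\<^sub>m k"
      have "?Bc ^\<^sub>m k = map_mat complex_of_real P"
        unfolding P_def by (rule of_real_hom.mat_hom_pow[OF B, symmetric])
      moreover have "P \<in> carrier_mat n n" unfolding P_def using B by simp
      ultimately have "\<bar>P $$ (i, j)\<bar> \<le> C" using C[of k] that by (auto simp: norm_bound_def)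
      then show ?thesis by (simp only: P_def)
    qed
    moreover have "transpose_mat ?B = ?B"
      using sym A by (intro eq_matI) (auto, metis carrier_matD index_transpose_mat(1))
    ultimately have "(\<Sum>i<n. (\<Sum>j<n. ?B $$ (i, j) * z j)\<^sup>2) \<le> (\<Sum>i<n. (z i)\<^sup>2)"
      using power_bounded_contraction[OF B] by blast
    moreover have "(\<Sum>j<n. ?B $$ (i, j) * z j) = (\<Sum>j<n. A $$ (i, j) * z j) / x" if "i < n" for i
      using A that by (simp add: sum_divide_distrib)
    ultimately have "(\<Sum>i<n. (\<Sum>j<n. A $$ (i, j) * z j)\<^sup>2) / x\<^sup>2 \<le> (\<Sum>i<n. (z i)\<^sup>2)"
      by (simp add: power_divide flip: sum_divide_distrib)
    then show ?thesis using x by (simp add: field_simps)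
  qed
  show ?thesis
    unfolding sq_bound_def
  proof
    fix z :: "nat \<Rightarrow> real"
    have "((\<lambda>x. x\<^sup>2 * (\<Sum>i<n. (z i)\<^sup>2)) \<longlongrightarrow> 2\<^sup>2 * (\<Sum>i<n. (z i)\<^sup>2)) (at_right 2)"
      by (intro tendsto_intros)
    moreover have "eventually (\<lambda>x. (\<Sum>i<n. (\<Sum>j<n. A $$ (i, j) * z j)\<^sup>2) \<le> x\<^sup>2 * (\<Sum>i<n. (z i)\<^sup>2)) (at_right 2)"
      using key by (auto simp: eventually_at_right_field intro!: exI[of _ 3])
    ultimately have "(\<Sum>i<n. (\<Sum>j<n. A $$ (i, j) * z j)\<^sup>2) \<le> 2\<^sup>2 * (\<Sum>i<n. (z i)\<^sup>2)"
      by (intro tendsto_lowerbound) auto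
    then show "(\<Sum>i<n. (\<Sum>j<n. A $$ (i, j) * z j)\<^sup>2) \<le> 4 * (\<Sum>i<n. (z i)\<^sup>2)" by simp
  qed
qed (simp add: sq_bound_def)

lemma eigenvalue_sums:
  assumes A: "A \<in> carrier_mat n n" and ev: "eigenvalue (map_mat complex_of_real A) z"
  obtains v where "\<And>i. i < n \<Longrightarrow> (\<Sum>j<n. complex_of_real (A $$ (i, j)) * v j) = z * v i"
    and "(\<Sum>i<n. (norm (v i))\<^sup>2) > 0"
proof -
  obtain v where v: "v \<in> carrier_vec n" "v \<noteq> 0\<^sub>v n" "map_mat complex_of_real A *\<^sub>v v = z \<cdot>\<^sub>v v"
    using ev A by (auto simp: eigenvalue_def eigenvector_def)
  have "(\<Sum>j<n. complex_of_real (A $$ (i, j)) * v $ j) = z * v $ i" if i: "i < n" for i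
  proof -
    have "(map_mat complex_of_real A *\<^sub>v v) $ i = (z \<cdot>\<^sub>v v) $ i" by (simp only: v(3))
    then show ?thesis using v(1) A i by (simp add: scalar_prod_def lessThan_atLeast0)
  qed
  moreover have "(\<Sum>i<n. (norm (v $ i))\<^sup>2) > 0"
  proof -
    obtain i where i: "i < n" "v $ i \<noteq> 0" using v(1,2) by (metis carrier_vecD eq_vecI index_zero_vec)
    then have "0 < (norm (v $ i))\<^sup>2" by simp
    also have "\<dots> \<le> (\<Sum>i<n. (norm (v $ i))\<^sup>2)" using i by (intro member_le_sum) auto
    finally show ?thesis .
  qed
  ultimately show ?thesis using that[of "\<lambda>i. v $ i"] by blast
qed

text \<open>The norm bound applies to the real and the imaginary part of an eigenvector separately,
  which bounds \<open>norm z\<close>. The Hermitian form of the eigenvector is real, which makes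
  \<open>z\<close> real.\<close>

lemma sq_bound_eigenvalue:
  assumes A: "A \<in> carrier_mat n n" "transpose_mat A = A" "sq_bound {..<n} (\<lambda>i j. A $$ (i, j))"
    and ev: "eigenvalue (map_mat complex_of_real A) z"
  shows "z \<in> \<real> \<and> -2 \<le> Re z \<and> Re z \<le> 2"
proof -
  obtain v where v: "\<And>i. i < n \<Longrightarrow> (\<Sum>j<n. complex_of_real (A $$ (i, j)) * v j) = z * v i"
    and pos: "(\<Sum>i<n. (norm (v i))\<^sup>2) > 0" using eigenvalue_sums[OF A(1) ev] by blast
  have sym: "A $$ (i, j) = A $$ (j, i)" if "i < n" "j < n" for i j
    using A that by (metis carrier_matD index_transpose_mat(1))
  let ?N = "\<Sum>i<n. (norm (v i))\<^sup>2"
  have "(norm z)\<^sup>2 * ?N = (\<Sum>i<n. (norm (z * v i))\<^sup>2)"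
    by (simp add: sum_distrib_left norm_mult power_mult_distrib)
  also have "\<dots> = (\<Sum>i<n. (norm (\<Sum>j<n. complex_of_real (A $$ (i, j)) * v j))\<^sup>2)"
    using v by simp
  also have "\<dots> = (\<Sum>i<n. (\<Sum>j<n. A $$ (i, j) * Re (v j))\<^sup>2) + (\<Sum>i<n. (\<Sum>j<n. A $$ (i, j) * Im (v j))\<^sup>2)"
    by (simp add: cmod_power2 sum.distrib)
  also have "\<dots> \<le> 4 * (\<Sum>i<n. (Re (v i))\<^sup>2) + 4 * (\<Sum>i<n. (Im (v i))\<^sup>2)"
    using A(3)[unfolded sq_bound_def, rule_format, of "\<lambda>i. Re (v i)"]
      A(3)[unfolded sq_bound_def, rule_format, of "\<lambda>i. Im (v i)"] by linarith
  also have "\<dots> = 4 * ?N" by (simp add: cmod_power2 sum.distrib)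
  finally have "(norm z)\<^sup>2 \<le> 2\<^sup>2" using pos by simp
  then have n2: "norm z \<le> 2" by (rule power2_le_imp_le) simp
  let ?S = "\<Sum>i<n. \<Sum>j<n. cnj (v i) * complex_of_real (A $$ (i, j)) * v j"
  have "cnj ?S = (\<Sum>i<n. \<Sum>j<n. v i * complex_of_real (A $$ (i, j)) * cnj (v j))" by simp
  also have "\<dots> = (\<Sum>j<n. \<Sum>i<n. v i * complex_of_real (A $$ (i, j)) * cnj (v j))" by (rule sum.swap)
  also have "\<dots> = ?S" by (intro sum.cong refl) (simp add: sym)
  finally have "?S \<in> \<real>" by (simp add: Reals_cnj_iff)
  moreover have "?S = z * complex_of_real ?N"
  proof -
    have "?S = (\<Sum>i<n. cnj (v i) * (z * v i))"
      using v by (simp add: mult.assoc flip: sum_distrib_left)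
    also have "\<dots> = z * complex_of_real ?N"
      by (simp add: sum_distrib_left complex_norm_square mult_ac del: of_real_power)
    finally show ?thesis .
  qed
  ultimately have "z * complex_of_real ?N \<in> \<real>" by simp
  then have "z * complex_of_real ?N / complex_of_real ?N \<in> \<real>" by (rule Reals_divide) simp
  moreover have "complex_of_real ?N \<noteq> 0" using pos by (metis less_irrefl of_real_eq_0_iff)
  ultimately have "z \<in> \<real>" by (metis nonzero_mult_div_cancel_right)
  moreover have "\<bar>Re z\<bar> \<le> 2" using n2 abs_Re_le_cmod[of z] by linarith
  ultimately show ?thesis by linarith
qed

lemma char_poly_int:
  assumes A: "A \<in> carrier_mat n n" and ints: "\<And>i j. i < n \<Longrightarrow> j < n \<Longrightarrow> A $$ (i, j) \<in> (\<int> :: real set)"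
  shows "poly.coeff (char_poly A) i \<in> \<int>"
proof -
  define M where "M = map_mat floor A"
  have M: "M \<in> carrier_mat n n" using A by (simp add: M_def)
  have "A = map_mat real_of_int M"
    using A ints by (intro eq_matI) (auto simp: M_def)
  then have "char_poly A = map_poly real_of_int (char_poly M)"
    using of_int_hom.char_poly_hom[OF M] by simp
  then show ?thesis by simp
qed

lemma int_matrix_cyclotomic:
  assumes "A \<in> carrier_mat n n" "transpose_mat A = A" "over_ring \<int> A" "sq_bound {..<n} (\<lambda>i j. A $$ (i, j))"
  shows "cyclotomic A"
  using assms sq_bound_eigenvalue[OF assms(1,2,4)] char_poly_int[OF assms(1)]
  unfolding cyclotomic_def over_ring_def by auto

section \<open>Closed vertex sets, and matrices with square \<open>4I\<close>\<close>

lemma indecomposable_closed: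
  assumes A: "indecomposable A" "dim_row A = n" and X: "X \<noteq> {}" "X \<subseteq> {..<n}"
    and cl: "\<And>i j. i \<in> X \<Longrightarrow> j < n \<Longrightarrow> A $$ (i, j) \<noteq> 0 \<Longrightarrow> j \<in> X"
  shows "X = {..<n}"
proof
  show "{..<n} \<subseteq> X"
  proof
    fix v assume v: "v \<in> {..<n}"
    obtain u where u: "u \<in> X" using X by blast
    then have "(u, v) \<in> (adj_rel A)\<^sup>*" using A v X unfolding indecomposable_def by auto
    then show "v \<in> X"
    proof (induction rule: rtrancl_induct)
      case (step y z)
      then show ?case using cl[of y z] A(2) by (auto simp: adj_rel_def)
    qed (rule u)
  qed
qed (rule X(2))

lemma indecomposableI:
  assumes A: "A \<in> carrier_mat n n" "n \<ge> 1"
    and conn: "\<And>X. X \<noteq> {} \<Longrightarrow> X \<subseteq> {..<n} \<Longrightarrow>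
      (\<And>i j. i \<in> X \<Longrightarrow> j < n \<Longrightarrow> A $$ (i, j) \<noteq> 0 \<Longrightarrow> j \<in> X) \<Longrightarrow> X = {..<n}"
  shows "indecomposable A"
proof -
  have "(u, v) \<in> (adj_rel A)\<^sup>*" if "u < n" "v < n" for u v
  proof -
    let ?X = "{x. x < n \<and> (u, x) \<in> (adj_rel A)\<^sup>*}"
    have "?X = {..<n}"
    proof (rule conn)
      show "?X \<noteq> {}" using that by auto
      show "j \<in> ?X" if "i \<in> ?X" "j < n" "A $$ (i, j) \<noteq> 0" for i j
      proof (cases "i = j")
        case False
        then have "(i, j) \<in> adj_rel A" using that A by (auto simp: adj_rel_def)
        then show ?thesis using that by (auto intro: rtrancl_into_rtrancl)
      qed (use that in simp)
    qed auto
    then show ?thesis using that by auto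
  qed
  then show ?thesis using A by (auto simp: indecomposable_def)
qed

text \<open>Entries may be irrational here, so the integrality of the characteristic polynomial is
  obtained from its roots, each of which is 2 or -2.\<close>

lemma scaled_involution_cyclotomic:
  assumes B: "B \<in> carrier_mat n n" "transpose_mat B = B"
    and sq: "\<And>i k. i < n \<Longrightarrow> k < n \<Longrightarrow> (\<Sum>j<n. B $$ (i, j) * B $$ (j, k)) = (if i = k then 4 else 0)"
  shows "cyclotomic B"
proof -
  have sym: "B $$ (i, j) = B $$ (j, i)" if "i < n" "j < n" for i j
    using B that by (metis carrier_matD index_transpose_mat(1))
  have sqb: "sq_bound {..<n} (\<lambda>i j. B $$ (i, j))"
    unfolding sq_bound_def
  proof
    fix z :: "nat \<Rightarrow> real"
    have "(\<Sum>i<n. (\<Sum>j<n. B $$ (i, j) * z j)\<^sup>2)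
        = (\<Sum>i<n. \<Sum>j<n. \<Sum>k<n. B $$ (i, j) * z j * (B $$ (i, k) * z k))"
      by (simp add: power2_eq_square sum_product)
    also have "\<dots> = (\<Sum>j<n. \<Sum>i<n. \<Sum>k<n. B $$ (i, j) * z j * (B $$ (i, k) * z k))"
      by (rule sum.swap)
    also have "\<dots> = (\<Sum>j<n. \<Sum>k<n. \<Sum>i<n. B $$ (i, j) * z j * (B $$ (i, k) * z k))"
      by (intro sum.cong refl sum.swap)
    also have "\<dots> = (\<Sum>j<n. \<Sum>k<n. z j * z k * (\<Sum>i<n. B $$ (j, i) * B $$ (i, k)))"
      by (intro sum.cong refl) (simp add: sum_distrib_left sym mult_ac)
    also have "\<dots> = (\<Sum>j<n. \<Sum>k<n. if j = k then 4 * (z j)\<^sup>2 else 0)"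
      by (intro sum.cong refl) (auto simp: sq power2_eq_square)
    also have "\<dots> = 4 * (\<Sum>j<n. (z j)\<^sup>2)" by (simp add: sum_distrib_left)
    finally show "(\<Sum>i<n. (\<Sum>j<n. B $$ (i, j) * z j)\<^sup>2) \<le> 4 * (\<Sum>j<n. (z j)\<^sup>2)" by simp
  qed
  have ev: "z = 2 \<or> z = -2" if ez: "eigenvalue (map_mat complex_of_real B) z" for z
  proof -
    obtain v where v: "\<And>i. i < n \<Longrightarrow> (\<Sum>j<n. complex_of_real (B $$ (i, j)) * v j) = z * v i"
      and pos: "(\<Sum>i<n. (norm (v i))\<^sup>2) > 0" using eigenvalue_sums[OF B(1) ez] by blast
    have "\<exists>i<n. v i \<noteq> 0"
    proof (rule ccontr)
      assume "\<not> ?thesis"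
      then have "(\<Sum>i<n. (norm (v i))\<^sup>2) = 0" by simp
      then show False using pos by simp
    qed
    then obtain i where i: "i < n" "v i \<noteq> 0" by blast
    have "z\<^sup>2 * v i = z * (\<Sum>j<n. complex_of_real (B $$ (i, j)) * v j)"
      by (simp add: v[OF i(1)] power2_eq_square mult.assoc)
    also have "\<dots> = (\<Sum>j<n. complex_of_real (B $$ (i, j)) * (z * v j))"
      by (simp add: sum_distrib_left mult.left_commute)
    also have "\<dots> = (\<Sum>j<n. \<Sum>k<n. complex_of_real (B $$ (i, j)) * (complex_of_real (B $$ (j, k)) * v k))"
      by (intro sum.cong refl) (simp add: v flip: sum_distrib_left)
    also have "\<dots> = (\<Sum>k<n. \<Sum>j<n. complex_of_real (B $$ (i, j)) * (complex_of_real (B $$ (j, k)) * v k))"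
      by (rule sum.swap)
    also have "\<dots> = (\<Sum>k<n. complex_of_real (\<Sum>j<n. B $$ (i, j) * B $$ (j, k)) * v k)"
      by (simp add: sum_distrib_right mult.assoc)
    also have "\<dots> = (\<Sum>k<n. if k = i then 4 * v i else 0)"
      using i by (intro sum.cong) (auto simp: sq)
    also have "\<dots> = 4 * v i" using i by simp
    finally have "z\<^sup>2 = 2\<^sup>2" using i by simp
    then show ?thesis by (simp only: power2_eq_iff)
  qed
  have Bc: "map_mat complex_of_real B \<in> carrier_mat n n" using B by simp
  obtain as where as: "char_poly (map_mat complex_of_real B) = (\<Prod>a\<leftarrow>as. [:- a, 1:])"
    using char_poly_factorized[OF Bc] by blast
  have "set as \<subseteq> \<int>"
  proof
    fix a assume "a \<in> set as"
    then have "poly (char_poly (map_mat complex_of_real B)) a = 0"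
      using linear_poly_root[of a as] as by simp
    then have "eigenvalue (map_mat complex_of_real B) a"
      using eigenvalue_root_char_poly[OF Bc] by simp
    then show "a \<in> \<int>" using ev by force
  qed
  then have "poly.coeff (\<Prod>a\<leftarrow>as. [:- a, 1:]) i \<in> \<int>" for i
  proof (induction as arbitrary: i)
    case Nil
    then show ?case by (simp add: Polynomial.coeff_1)
  next
    case (Cons a as)
    have "poly.coeff (pCons 0 (\<Prod>a\<leftarrow>as. [:- a, 1:])) i \<in> \<int>" using Cons by (cases i) auto
    then show ?case using Cons by (auto simp: mult_pCons_left)
  qed
  moreover have "char_poly (map_mat complex_of_real B) = map_poly complex_of_real (char_poly B)"
    by (rule of_real_hom.char_poly_hom[OF B(1)])
  ultimately have c: "complex_of_real (poly.coeff (char_poly B) i) \<in> \<int>" for i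
    by (metis as coeff_map_poly of_real_0)
  have "poly.coeff (char_poly B) i \<in> \<int>" for i
  proof -
    obtain k where "complex_of_real (poly.coeff (char_poly B) i) = of_int k" using c[of i] by (auto elim: Ints_cases)
    then have "poly.coeff (char_poly B) i = of_int k" using of_real_eq_iff[where ?'a = complex] by (metis of_real_of_int_eq)
    then show ?thesis by simp
  qed
  moreover have "square_mat B" using B(1) by auto
  ultimately show ?thesis
    using sq_bound_eigenvalue[OF B sqb] B(2) unfolding cyclotomic_def by blast
qed

lemma scaled_involution_maximal:
  assumes B: "B \<in> carrier_mat n n" "transpose_mat B = B" "over_ring T B" "indecomposable B"
    and sq: "\<And>i k. i < n \<Longrightarrow> k < n \<Longrightarrow> (\<Sum>j<n. B $$ (i, j) * B $$ (j, k)) = (if i = k then 4 else 0)"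
  shows "maximal_indec_cyclotomic T B"
proof -
  have False if C: "indecomposable C" "cyclotomic C" "proper_principal_submatrix B C" for C
  proof -
    define m where "m = dim_row C"
    obtain f where f: "strict_mono_on {..<n} f" "\<And>i. i < n \<Longrightarrow> f i < m"
      "\<And>i j. i < n \<Longrightarrow> j < n \<Longrightarrow> B $$ (i, j) = C $$ (f i, f j)" and nm: "n < m"
      using C(3) B(1) by (auto simp: proper_principal_submatrix_def principal_submatrix_def m_def)
    have Cm: "C \<in> carrier_mat m m" using C(1) by (auto simp: indecomposable_def m_def)
    have sym: "C $$ (i, j) = C $$ (j, i)" if "i < m" "j < m" for i j
      using C(2) Cm that unfolding cyclotomic_def by (metis carrier_matD index_transpose_mat(1))
    have injf: "inj_on f {..<n}" using f(1) by (rule strict_mono_on_imp_inj_on)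
    have "n \<ge> 1" using B(1,4) by (simp add: indecomposable_def)
    have "f ` {..<n} \<noteq> {..<m}"
      using nm card_image[OF injf] by (metis card_lessThan less_irrefl)
    moreover have "f ` {..<n} = {..<m}" if "\<And>i j. i \<in> f ` {..<n} \<Longrightarrow> j < m \<Longrightarrow> C $$ (i, j) \<noteq> 0 \<Longrightarrow> j \<in> f ` {..<n}"
      by (rule indecomposable_closed[OF C(1)]) (use f(2) \<open>n \<ge> 1\<close> that in \<open>auto simp: m_def lessThan_empty_iff bot_nat_def\<close>)
    \<comment> \<open>Connectedness of \<open>C\<close> joins some new vertex \<open>w\<close> to an
      old one, whose row already has squared length 4.\<close>
    ultimately obtain i w where i: "i < n" and w: "w < m" "C $$ (f i, w) \<noteq> 0" "w \<notin> f ` {..<n}"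
      by blast
    have "4 + (C $$ (w, f i))\<^sup>2 = (\<Sum>j<n. (C $$ (f j, f i))\<^sup>2) + (C $$ (w, f i))\<^sup>2"
    proof -
      have "(\<Sum>j<n. (C $$ (f j, f i))\<^sup>2) = (\<Sum>j<n. B $$ (i, j) * B $$ (j, i))"
        using f i by (intro sum.cong) (auto simp: power2_eq_square sym)
      then show ?thesis using sq[OF i i] by simp
    qed
    also have "\<dots> = (\<Sum>v\<in>insert w (f ` {..<n}). (C $$ (v, f i))\<^sup>2)"
      using w injf by (simp add: sum.reindex)
    also have "\<dots> \<le> (\<Sum>v<m. (C $$ (v, f i))\<^sup>2)"
      using w f(2) by (intro sum_mono2) auto
    also have "\<dots> \<le> 4"
      using sq_bound_row[OF cyclotomic_sq_bound[OF C(2) Cm], of "f i"] f(2)[OF i] by simp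
    finally have "C $$ (w, f i) = 0" by simp
    then show False using w sym[of w "f i"] f(2)[OF i] by simp
  qed
  then show ?thesis
    using B scaled_involution_cyclotomic[OF B(1,2) sq] unfolding maximal_indec_cyclotomic_def by blast
qed

lemma Zsqrt3_uminus:
  assumes "x \<in> Zsqrt3"
  shows "- x \<in> Zsqrt3"
proof -
  obtain a b where "x = of_int a + of_int b * sqrt 3" using assms by (auto simp: Zsqrt3_def)
  then have "- x = of_int (- a) + of_int (- b) * sqrt 3" by simp
  then show ?thesis unfolding Zsqrt3_def by blast
qed

text \<open>\<open>principal_submatrix\<close> asks for an increasing index map, while
  \<open>\<phi>\<close> is arbitrary. The vertices are therefore renumbered with the image of
  \<open>\<phi>\<close> first, in the order of \<open>A\<close>, which makes \<open>A\<close> the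
  leading corner; conjugation absorbs the signs.\<close>

lemma embed_in_maximal:
  fixes t :: "'v \<Rightarrow> 'v \<Rightarrow> real"
  assumes V: "finite V" "V \<noteq> {}"
    and sym: "\<And>p q. p \<in> V \<Longrightarrow> q \<in> V \<Longrightarrow> t p q = t q p"
    and ring: "\<And>p q. p \<in> V \<Longrightarrow> q \<in> V \<Longrightarrow> t p q \<in> Zsqrt3"
    and sq: "\<And>p q. p \<in> V \<Longrightarrow> q \<in> V \<Longrightarrow> (\<Sum>x\<in>V. t p x * t x q) = (if p = q then 4 else 0)"
    and conn: "\<And>X. X \<noteq> {} \<Longrightarrow> X \<subseteq> V \<Longrightarrow>
      (\<And>p q. p \<in> X \<Longrightarrow> q \<in> V \<Longrightarrow> t p q \<noteq> 0 \<Longrightarrow> q \<in> X) \<Longrightarrow> X = V"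
    and A: "A \<in> carrier_mat n n" and \<phi>: "inj_on \<phi> {..<n}" "\<phi> ` {..<n} \<subseteq> V"
    and s: "\<And>i. \<bar>s i\<bar> = 1"
    and At: "\<And>i j. i < n \<Longrightarrow> j < n \<Longrightarrow> A $$ (i, j) = s i * s j * t (\<phi> i) (\<phi> j)"
  shows "\<exists>B. maximal_indec_cyclotomic Zsqrt3 B \<and> principal_submatrix A B \<and> dim_row B = card V"
proof -
  define N where "N = card V"
  have n: "n \<le> N" using card_inj_on_le[OF \<phi> V(1)] by (simp add: N_def)
  have "card {n..<N} = card (V - \<phi> ` {..<n})"
    using V(1) \<phi> card_image[OF \<phi>(1)] by (simp add: card_Diff_subset N_def)
  then obtain h where h: "bij_betw h {n..<N} (V - \<phi> ` {..<n})"
    using finite_same_card_bij[of "{n..<N}" "V - \<phi> ` {..<n}"] V(1) by auto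
  define \<pi> where "\<pi> i = (if i < n then \<phi> i else h i)" for i
  define s' where "s' i = (if i < n then s i else 1)" for i
  have s': "\<bar>s' i\<bar> = 1" for i using s by (simp add: s'_def)
  have ss: "s' i * s' i = 1" for i using s'[of i] by (metis abs_mult_self_eq mult_1)
  have \<pi>: "bij_betw \<pi> {..<N} V"
  proof -
    have "bij_betw \<pi> {..<n} (\<phi> ` {..<n})"
      using \<phi>(1) by (auto simp: \<pi>_def bij_betw_def inj_on_def)
    moreover have "bij_betw \<pi> {n..<N} (V - \<phi> ` {..<n})"
      using h by (rule bij_betw_cong[THEN iffD1, rotated]) (simp add: \<pi>_def)
    ultimately have "bij_betw \<pi> ({..<n} \<union> {n..<N}) (\<phi> ` {..<n} \<union> (V - \<phi> ` {..<n}))"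
      by (rule bij_betw_combine) blast
    moreover have "{..<n} \<union> {n..<N} = {..<N}" using n by auto
    moreover have "\<phi> ` {..<n} \<union> (V - \<phi> ` {..<n}) = V" using \<phi>(2) by blast
    ultimately show ?thesis by simp
  qed
  have \<pi>V: "\<pi> i \<in> V" if "i < N" for i using \<pi> that by (auto simp: bij_betw_def)
  have \<pi>eq: "\<pi> i = \<pi> k \<longleftrightarrow> i = k" if "i < N" "k < N" for i k
    using \<pi> that by (auto simp: bij_betw_def inj_on_def)
  define B where "B = mat N N (\<lambda>(i, j). s' i * s' j * t (\<pi> i) (\<pi> j))"
  have B: "B \<in> carrier_mat N N" by (simp add: B_def)
  have Bij: "B $$ (i, j) = s' i * s' j * t (\<pi> i) (\<pi> j)" if "i < N" "j < N" for i j
    using that by (simp add: B_def)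
  have N1: "N \<ge> 1" using V by (simp add: N_def Suc_le_eq card_gt_0_iff)
  have "maximal_indec_cyclotomic Zsqrt3 B"
  proof (rule scaled_involution_maximal[OF B])
    show "transpose_mat B = B"
      using B by (intro eq_matI) (auto simp: Bij sym \<pi>V mult.commute)
    have "s' i * s' j * t (\<pi> i) (\<pi> j) \<in> Zsqrt3" if "i < N" "j < N" for i j
    proof -
      have "s' i * s' j = 1 \<or> s' i * s' j = -1"
        using s'[of i] s'[of j] by (auto simp: abs_if split: if_splits)
      then show ?thesis using ring[OF \<pi>V \<pi>V, OF that] Zsqrt3_uminus by auto
    qed
    then show "over_ring Zsqrt3 B" using B by (auto simp: over_ring_def Bij)
    show "indecomposable B"
    proof (rule indecomposableI[OF B N1])
      fix X assume X: "X \<noteq> {}" "X \<subseteq> {..<N}"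
        "\<And>i j. i \<in> X \<Longrightarrow> j < N \<Longrightarrow> B $$ (i, j) \<noteq> 0 \<Longrightarrow> j \<in> X"
      have "\<pi> ` X = V"
      proof (rule conn)
        show "\<pi> ` X \<noteq> {}" "\<pi> ` X \<subseteq> V" using X \<pi>V by auto
        fix p q assume "p \<in> \<pi> ` X" "q \<in> V" "t p q \<noteq> 0"
        then obtain i j where "i \<in> X" "p = \<pi> i" "j < N" "q = \<pi> j" using \<pi> by (auto simp: bij_betw_def)
        then show "q \<in> \<pi> ` X"
          using X(2) X(3)[of i j] Bij[of i j] \<open>t p q \<noteq> 0\<close> ss[of i] ss[of j] by (force dest: subsetD)
      qed
      then show "X = {..<N}" using \<pi> X(2) by (metis bij_betw_def inj_on_image_eq_iff order_refl)
    qed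
    fix i k assume ik: "i < N" "k < N"
    have "(\<Sum>j<N. B $$ (i, j) * B $$ (j, k)) = (\<Sum>j<N. s' i * s' k * (t (\<pi> i) (\<pi> j) * t (\<pi> j) (\<pi> k)))"
    proof (intro sum.cong refl)
      fix j assume "j \<in> {..<N}"
      then have "B $$ (i, j) * B $$ (j, k) = (s' j * s' j) * (s' i * s' k * (t (\<pi> i) (\<pi> j) * t (\<pi> j) (\<pi> k)))"
        using ik by (simp add: Bij mult_ac)
      then show "B $$ (i, j) * B $$ (j, k) = s' i * s' k * (t (\<pi> i) (\<pi> j) * t (\<pi> j) (\<pi> k))"
        by (simp only: ss mult_1)
    qed
    also have "\<dots> = s' i * s' k * (\<Sum>x\<in>V. t (\<pi> i) x * t x (\<pi> k))"
      using sum.reindex_bij_betw[OF \<pi>, of "\<lambda>x. t (\<pi> i) x * t x (\<pi> k)"] by (simp flip: sum_distrib_left)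
    also have "\<dots> = (if i = k then 4 else 0)"
      using ss[of i] ik by (auto simp: sq \<pi>V \<pi>eq)
    finally show "(\<Sum>j<N. B $$ (i, j) * B $$ (j, k)) = (if i = k then 4 else 0)" .
  qed
  moreover have "principal_submatrix A B"
    unfolding principal_submatrix_def
  proof (intro conjI exI[of _ "\<lambda>i. i"] allI impI)
    show "square_mat B" "square_mat A" using A B by auto
    show "strict_mono_on {..<dim_row A} (\<lambda>i. i)" by (simp add: strict_mono_on_def)
    show "i < dim_row B" if "i < dim_row A" for i using that A B n by simp
    show "A $$ (i, j) = B $$ (i, j)" if "i < dim_row A" "j < dim_row A" for i j
      using that A n by (simp add: Bij At s'_def \<pi>_def)
  qed
  moreover have "dim_row B = card V" using B by (simp add: N_def)
  ultimately show ?thesis by blast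
qed

section \<open>Entries over the ring of integers of the quadratic field\<close>

text \<open>Irrationality of \<open>sqrt 3\<close>: the exponent of 3 is even in \<open>m^2\<close>
  and odd in \<open>3 b^2\<close>.\<close>

lemma int_sqrt3: 
  assumes "real_of_int a + of_int b * sqrt 3 \<in> \<int>"
  shows "b = 0"
proof (rule ccontr)
  assume b: "b \<noteq> 0"
  obtain k where k: "real_of_int a + of_int b * sqrt 3 = of_int k" using assms unfolding Ints_def by blast
  define m where "m = k - a"
  have "real_of_int m = of_int b * sqrt 3" using k by (simp add: m_def)
  then have "(real_of_int m)\<^sup>2 = 3 * (of_int b)\<^sup>2" by (simp add: power_mult_distrib)
  then have "real_of_int (m\<^sup>2) = of_int (3 * b\<^sup>2)" by simp
  then have eq: "m\<^sup>2 = 3 * b\<^sup>2" by linarith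
  have p: "prime_elem (3::int)" by (intro prime_imp_prime_elem) simp
  have m: "m \<noteq> 0" using eq b by auto
  have "multiplicity 3 (m\<^sup>2) = 2 * multiplicity 3 m"
    using p m by (simp add: prime_elem_multiplicity_power_distrib)
  moreover have "multiplicity 3 (3 * b\<^sup>2) = 1 + 2 * multiplicity 3 b"
    using p b by (simp add: prime_elem_multiplicity_mult_distrib prime_elem_multiplicity_power_distrib multiplicity_self)
  ultimately have "2 * multiplicity 3 m = 1 + 2 * multiplicity 3 b" unfolding eq by (rule trans[OF sym])
  then show False by presburger
qed

lemma sqrt3_eval:
  "\<exists>x y. poly (map_poly real_of_int p) (sqrt 3) = of_int x + of_int y * sqrt 3 \<and>
    poly (map_poly real_of_int p) (- sqrt 3) = of_int x - of_int y * sqrt 3"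
proof (induction p)
  case 0
  show ?case by (intro exI[of _ 0]) simp
next
  case (pCons a p)
  then obtain x y where xy: "poly (map_poly real_of_int p) (sqrt 3) = of_int x + of_int y * sqrt 3"
    "poly (map_poly real_of_int p) (- sqrt 3) = of_int x - of_int y * sqrt 3" by blast
  then show ?case
    by (rule_tac exI[of _ "a + 3 * y"], rule_tac exI[of _ x]) (simp add: of_int_hom.map_poly_pCons_hom xy algebra_simps)
qed

text \<open>Both matrices come from one matrix of integer polynomials \<open>a + cX\<close>,
  evaluated at \<open>sqrt 3\<close> and at \<open>- sqrt 3\<close>. So the coefficients of the
  characteristic polynomials are conjugate, and conjugation fixes the integers.\<close>

lemma char_poly_conj:
  assumes A: "A \<in> carrier_mat n n" "B \<in> carrier_mat n n"
    and Aij: "\<And>i j. i < n \<Longrightarrow> j < n \<Longrightarrow> A $$ (i, j) = real_of_int (a i j) + of_int (c i j) * sqrt 3"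
    and Bij: "\<And>i j. i < n \<Longrightarrow> j < n \<Longrightarrow> B $$ (i, j) = real_of_int (a i j) - of_int (c i j) * sqrt 3"
    and ints: "\<And>i. poly.coeff (char_poly A) i \<in> \<int>"
  shows "char_poly B = char_poly A"
proof -
  define ev where "ev x p = poly (map_poly real_of_int p) x" for x p
  have hom: "comm_ring_hom (ev x)" for x
    by unfold_locales (simp_all add: ev_def of_int_poly_hom.hom_add of_int_poly_hom.hom_mult)
  define P where "P = mat n n (\<lambda>(i, j). [:a i j, c i j:])"
  have P: "P \<in> carrier_mat n n" by (simp add: P_def)
  have "A = map_mat (ev (sqrt 3)) P" "B = map_mat (ev (- sqrt 3)) P"
    using A by (auto intro!: eq_matI simp: P_def ev_def Aij Bij of_int_hom.map_poly_pCons_hom)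
  then have cp: "char_poly A = map_poly (ev (sqrt 3)) (char_poly P)"
    "char_poly B = map_poly (ev (- sqrt 3)) (char_poly P)"
    using comm_ring_hom.char_poly_hom[OF hom P] by simp_all
  have ev0: "ev x 0 = 0" for x by (simp add: ev_def)
  show ?thesis
  proof (rule poly_eqI)
    fix i
    let ?p = "poly.coeff (char_poly P) i"
    obtain x y where xy: "ev (sqrt 3) ?p = of_int x + of_int y * sqrt 3"
      "ev (- sqrt 3) ?p = of_int x - of_int y * sqrt 3" using sqrt3_eval[of ?p] by (auto simp: ev_def)
    have "ev (sqrt 3) ?p \<in> \<int>" using ints[of i] unfolding cp by (simp add: coeff_map_poly ev0)
    then have "y = 0" unfolding xy by (rule int_sqrt3)
    then show "poly.coeff (char_poly B) i = poly.coeff (char_poly A) i"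
      using xy unfolding cp by (simp add: coeff_map_poly ev0)
  qed
qed

text \<open>The conjugate matrix satisfies the same norm bound, so \<open>p + q sqrt 3\<close> and
  \<open>p - q sqrt 3\<close> both have squares at most 4. Adding them gives
  \<open>p^2 + 3 q^2 \<le> 4\<close>. The case of \<open>p\<close> and \<open>q\<close> both of
  modulus 1 fails, as the larger square is \<open>4 + 2 sqrt 3\<close>.\<close>

lemma cyclotomic_entry:
  assumes A: "A \<in> carrier_mat n n" "over_ring Zsqrt3 A" "cyclotomic A" and i: "i < n" "j < n"
  shows "A $$ (i, j) \<in> \<int> \<or> \<bar>A $$ (i, j)\<bar> = sqrt 3"
proof -
  have "\<forall>x. \<exists>p q. x \<in> Zsqrt3 \<longrightarrow> x = real_of_int p + of_int q * sqrt 3" by (auto simp: Zsqrt3_def)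
  then obtain \<alpha> \<beta> where ab: "\<And>x. x \<in> Zsqrt3 \<Longrightarrow> x = real_of_int (\<alpha> x) + of_int (\<beta> x) * sqrt 3" by metis
  have Aij: "A $$ (i, j) = real_of_int (\<alpha> (A $$ (i, j))) + of_int (\<beta> (A $$ (i, j))) * sqrt 3"
    if "i < n" "j < n" for i j
    using A that by (intro ab) (auto simp: over_ring_def)
  have sym: "A $$ (i, j) = A $$ (j, i)" if "i < n" "j < n" for i j
    using A that unfolding cyclotomic_def by (metis carrier_matD index_transpose_mat(1))
  define B where "B = mat n n (\<lambda>(i, j). real_of_int (\<alpha> (A $$ (i, j))) - of_int (\<beta> (A $$ (i, j))) * sqrt 3)"
  have B: "B \<in> carrier_mat n n" by (simp add: B_def)
  have ints: "poly.coeff (char_poly A) i \<in> \<int>" for i using A(3) by (simp add: cyclotomic_def)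
  have cp: "char_poly B = char_poly A"
    by (rule char_poly_conj[OF A(1) B Aij _ ints]) (simp_all add: B_def)
  have Bc: "map_mat complex_of_real B \<in> carrier_mat n n" "map_mat complex_of_real A \<in> carrier_mat n n"
    using A B by auto
  have "char_poly (map_mat complex_of_real B) = char_poly (map_mat complex_of_real A)"
    unfolding of_real_hom.char_poly_hom[OF B] of_real_hom.char_poly_hom[OF A(1)] cp ..
  then have "eigenvalue (map_mat complex_of_real B) z \<longleftrightarrow> eigenvalue (map_mat complex_of_real A) z" for z
    unfolding eigenvalue_root_char_poly[OF Bc(1)] eigenvalue_root_char_poly[OF Bc(2)] by simp
  moreover have "transpose_mat B = B" by (intro eq_matI) (auto simp: B_def sym)
  ultimately have "cyclotomic B"
    using A(3) B cp unfolding cyclotomic_def by auto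
  note bd = sq_bound_row[OF cyclotomic_sq_bound[OF A(3,1)], of j] sq_bound_row[OF cyclotomic_sq_bound[OF this B], of j]
  have mem: "(C $$ (i, j))\<^sup>2 \<le> (\<Sum>v<n. (C $$ (v, j))\<^sup>2)" for C :: "real mat"
    using i by (intro member_le_sum[where f = "\<lambda>v. (C $$ (v, j))\<^sup>2"]) auto
  define p q where "p = \<alpha> (A $$ (i, j))" and "q = \<beta> (A $$ (i, j))"
  have Apq: "A $$ (i, j) = real_of_int p + of_int q * sqrt 3" using Aij[OF i] by (simp add: p_def q_def)
  have Bpq: "B $$ (i, j) = real_of_int p - of_int q * sqrt 3" using i by (simp add: B_def p_def q_def)
  have le: "(real_of_int p + of_int q * sqrt 3)\<^sup>2 \<le> 4" "(real_of_int p - of_int q * sqrt 3)\<^sup>2 \<le> 4"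
    using bd mem[of A] mem[of B] i by (simp_all add: Apq Bpq)
  then have "real_of_int (p\<^sup>2 + 3 * q\<^sup>2) \<le> of_int 4"
    by (simp add: power2_sum power2_diff power_mult_distrib)
  then have pq: "p\<^sup>2 + 3 * q\<^sup>2 \<le> 4" by linarith
  show ?thesis
  proof (cases "q = 0")
    case True
    then show ?thesis by (simp add: Apq)
  next
    case False
    then have "q\<^sup>2 > 0" by simp
    moreover have "p\<^sup>2 \<ge> 0" by simp
    ultimately have "q\<^sup>2 = 1" "p\<^sup>2 \<le> 1" using pq by linarith+
    then have q1: "\<bar>q\<bar> = 1" by (simp add: power2_eq_1_iff) linarith
    have "p = 0"
    proof (rule ccontr)
      assume "p \<noteq> 0"
      then have "p\<^sup>2 > 0" by simp
      then have p1: "p\<^sup>2 = 1" using \<open>p\<^sup>2 \<le> 1\<close> by linarith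
      have "\<bar>real_of_int (p * q) * sqrt 3\<bar> = \<bar>real_of_int (p * q)\<bar> * sqrt 3" by (simp add: abs_mult)
      also have "\<dots> = sqrt 3" using p1 q1 by (auto simp: power2_eq_1_iff abs_mult)
      finally have "\<bar>real_of_int (p * q) * sqrt 3\<bar> > 0" by simp
      moreover have "(real_of_int p)\<^sup>2 = 1" "(real_of_int q)\<^sup>2 = 1"
        using p1 \<open>q\<^sup>2 = 1\<close> by (metis of_int_1 of_int_power)+
      ultimately show False using le \<open>p \<noteq> 0\<close> False by (simp add: power2_sum power2_diff power_mult_distrib abs_if split: if_splits)
    qed
    then have "\<bar>A $$ (i, j)\<bar> = \<bar>real_of_int q\<bar> * sqrt 3" by (simp add: Apq abs_mult)
    moreover have "\<bar>real_of_int q\<bar> = 1" using q1 by linarith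
    ultimately show ?thesis by simp
  qed
qed

text \<open>The bound is attained at the unit vector of \<open>u\<close>. Moving from there towards
  another unit vector changes the left-hand side to first order by the inner product of the two
  columns, the right-hand side only to second order; so the inner product vanishes.\<close>

lemma sq_bound_saturated:
  fixes a :: "'a \<Rightarrow> 'a \<Rightarrow> real"
  assumes bd: "sq_bound V a" and V: "finite V" and sym: "\<And>u v. u \<in> V \<Longrightarrow> v \<in> V \<Longrightarrow> a u v = a v u"
    and J: "J \<subseteq> V" and u: "u \<in> V" and sat: "(\<Sum>v\<in>J. (a u v)\<^sup>2) = 4"
  shows "\<And>v. v \<in> V \<Longrightarrow> v \<notin> J \<Longrightarrow> a u v = 0"
    and "\<And>w. w \<in> V \<Longrightarrow> w \<noteq> u \<Longrightarrow> (\<Sum>v\<in>J. a u v * a v w) = 0"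
proof -
  have fJ: "finite J" using J V finite_subset by blast
  show 0: "a u v = 0" if v: "v \<in> V" "v \<notin> J" for v
  proof -
    have "(a v u)\<^sup>2 + (\<Sum>v\<in>J. (a v u)\<^sup>2) = (\<Sum>v\<in>insert v J. (a v u)\<^sup>2)" using v fJ by simp
    also have "\<dots> \<le> (\<Sum>v\<in>V. (a v u)\<^sup>2)" using v J V by (intro sum_mono2) auto
    also have "\<dots> \<le> 4" using sq_bound_row[OF bd V u] .
    also have "4 = (\<Sum>v\<in>J. (a v u)\<^sup>2)" unfolding sat[symmetric] using J u by (intro sum.cong) (auto simp: sym)
    finally show ?thesis using sym[OF u v(1)] by simp
  qed
  fix w assume w: "w \<in> V" "w \<noteq> u"
  define c where "c = (\<Sum>v\<in>V. a v u * a v w)"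
  define d where "d = (\<Sum>v\<in>V. (a v w)\<^sup>2)"
  have d4: "d \<le> 4" unfolding d_def by (rule sq_bound_row[OF bd V w(1)])
  have row: "(\<Sum>v\<in>V. (a v u)\<^sup>2) = 4"
  proof -
    have "(\<Sum>v\<in>V. (a v u)\<^sup>2) = (\<Sum>v\<in>J. (a u v)\<^sup>2)"
      using J V u 0 by (intro sum.mono_neutral_cong_right) (auto simp: sym)
    then show ?thesis using sat by simp
  qed
  have "2 * t * c \<le> t\<^sup>2 * (4 - d)" for t
  proof -
    let ?z = "\<lambda>x. (if x = u then 1 else 0) + (if x = w then t else 0)"
    have r: "(\<Sum>x\<in>V. a v x * ?z x) = a v u + t * a v w" for v
      using V u w by (simp add: distrib_left sum.distrib if_distrib[of "(*) _"] cong: if_cong)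
    have "(\<Sum>x\<in>V. (?z x)\<^sup>2) = (\<Sum>x\<in>V. (if x = u then 1 else 0) + (if x = w then t\<^sup>2 else 0))"
      using w by (intro sum.cong) auto
    then have z: "(\<Sum>x\<in>V. (?z x)\<^sup>2) = 1 + t\<^sup>2" using V u w by (simp add: sum.distrib)
    have "(\<Sum>v\<in>V. (a v u + t * a v w)\<^sup>2) \<le> 4 * (1 + t\<^sup>2)"
      using bd[unfolded sq_bound_def, rule_format, of ?z] unfolding r z .
    moreover have "(\<Sum>v\<in>V. (a v u + t * a v w)\<^sup>2) = 4 + 2 * t * c + t\<^sup>2 * d"
      unfolding row[symmetric] c_def d_def
      by (simp add: power2_sum sum.distrib sum_distrib_left power_mult_distrib mult_ac)
    ultimately show ?thesis by (simp add: algebra_simps)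
  qed
  \<comment> \<open>Since \<open>d\<close> may equal 4, the step length divides by
    \<open>5 - d\<close>; it is still short enough to force \<open>c = 0\<close>.\<close>
  from this[of "c / (5 - d)"] have "2 * (c / (5 - d)) * c \<le> (c / (5 - d))\<^sup>2 * (4 - d)" .
  then have "2 * (c / (5 - d)) * c * (5 - d)\<^sup>2 \<le> (c / (5 - d))\<^sup>2 * (4 - d) * (5 - d)\<^sup>2"
    by (rule mult_right_mono) simp
  then have "2 * c\<^sup>2 * (5 - d) \<le> c\<^sup>2 * (4 - d)"
    using d4 by (simp add: power2_eq_square)
  then have "c\<^sup>2 * (6 - d) \<le> 0" by (simp add: algebra_simps)
  then have "c\<^sup>2 \<le> 0" using d4 by (simp add: mult_le_0_iff)
  then have "c = 0" by simp
  moreover have "c = (\<Sum>v\<in>J. a u v * a v w)"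
    unfolding c_def using J V u 0 by (intro sum.mono_neutral_cong_right) (auto simp: sym)
  ultimately show "(\<Sum>v\<in>J. a u v * a v w) = 0" by simp
qed

section \<open>Matrices with an irrational entry\<close>

lemma S2'_entries:
  "dim_row S2' = 2" "S2' $$ (0, 0) = sqrt 3" "S2' $$ (0, Suc 0) = 1" "S2' $$ (Suc 0, 0) = 1"
  "S2' $$ (Suc 0, Suc 0) = - sqrt 3"
  by (simp_all add: S2'_def mat_of_rows_list_def)

lemma S2dag_entries:
  "dim_row S2dag = 2" "S2dag $$ (0, 0) = 1" "S2dag $$ (0, Suc 0) = sqrt 3" "S2dag $$ (Suc 0, 0) = sqrt 3"
  "S2dag $$ (Suc 0, Suc 0) = - 1"
  by (simp_all add: S2dag_def mat_of_rows_list_def)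

lemma S4sqrt3_entries:
  "dim_row S4sqrt3 = 4"
  "S4sqrt3 $$ (0, 0) = 0" "S4sqrt3 $$ (0, Suc 0) = sqrt 3" "S4sqrt3 $$ (0, 2) = -1" "S4sqrt3 $$ (0, 3) = 0"
  "S4sqrt3 $$ (Suc 0, 0) = sqrt 3" "S4sqrt3 $$ (Suc 0, Suc 0) = 0" "S4sqrt3 $$ (Suc 0, 2) = 0" "S4sqrt3 $$ (Suc 0, 3) = 1"
  "S4sqrt3 $$ (2, 0) = -1" "S4sqrt3 $$ (2, Suc 0) = 0" "S4sqrt3 $$ (2, 2) = 0" "S4sqrt3 $$ (2, 3) = sqrt 3"
  "S4sqrt3 $$ (3, 0) = 0" "S4sqrt3 $$ (3, Suc 0) = 1" "S4sqrt3 $$ (3, 2) = sqrt 3" "S4sqrt3 $$ (3, 3) = 0"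
  by (simp_all add: S4sqrt3_def mat_of_rows_list_def)

text \<open>Reordering and signs are allowed, and \<open>A\<close> may be smaller than
  \<open>S\<close>. At equal size this gives equivalence; at smaller size \<open>A\<close> lies in a
  signed, reordered copy of \<open>S\<close>.\<close>

definition embeds :: "real mat \<Rightarrow> real mat \<Rightarrow> bool" where
  "embeds A S \<longleftrightarrow> (\<exists>\<phi> s. inj_on \<phi> {..<dim_row A} \<and> \<phi> ` {..<dim_row A} \<subseteq> {..<dim_row S} \<and>
    (\<forall>i. \<bar>s i\<bar> = (1::real)) \<and> (\<forall>i<dim_row A. \<forall>j<dim_row A. A $$ (i, j) = s i * s j * S $$ (\<phi> i, \<phi> j)))"

locale cyc_matrix =
  fixes A :: "real mat" and n :: nat
  assumes A: "A \<in> carrier_mat n n" and ring: "over_ring Zsqrt3 A"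
    and indec: "indecomposable A" and cyc: "cyclotomic A"
begin

abbreviation a :: "nat \<Rightarrow> nat \<Rightarrow> real" where "a i j \<equiv> A $$ (i, j)"

lemma sym: "i < n \<Longrightarrow> j < n \<Longrightarrow> a i j = a j i"
  using A cyc unfolding cyclotomic_def by (metis carrier_matD index_transpose_mat(1))

lemma bound: "sq_bound {..<n} a"
  using cyclotomic_sq_bound[OF cyc A] .

lemma entry: "i < n \<Longrightarrow> j < n \<Longrightarrow> a i j \<in> \<int> \<or> \<bar>a i j\<bar> = sqrt 3"
  using cyclotomic_entry[OF A ring cyc] .

lemma small_entry:
  assumes "i < n" "j < n" "a i j \<noteq> 0" "(a i j)\<^sup>2 \<le> 1"
  shows "\<bar>a i j\<bar> = 1" "(a i j)\<^sup>2 = 1"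
proof -
  have "\<bar>a i j\<bar> \<noteq> sqrt 3"
  proof
    assume "\<bar>a i j\<bar> = sqrt 3"
    then have "\<bar>a i j\<bar>\<^sup>2 = 3" by simp
    then show False using assms(4) by simp
  qed
  then obtain k where k: "a i j = of_int k" using entry[OF assms(1,2)] unfolding Ints_def by blast
  have "k \<noteq> 0" "\<bar>real_of_int k\<bar> \<le> 1" using assms(3,4) k by (auto simp: abs_square_le_1)
  then have "\<bar>k\<bar> = 1" by linarith
  then show "\<bar>a i j\<bar> = 1" using k by linarith
  then show "(a i j)\<^sup>2 = 1" by (metis power2_abs power_one)
qed

lemma row_le:
  assumes "J \<subseteq> {..<n}" "i < n"
  shows "(\<Sum>j\<in>J. (a i j)\<^sup>2) \<le> 4"
proof -
  have "(\<Sum>j\<in>J. (a i j)\<^sup>2) \<le> (\<Sum>j<n. (a i j)\<^sup>2)" using assms by (intro sum_mono2) auto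
  also have "\<dots> = (\<Sum>j<n. (a j i)\<^sup>2)" using assms by (intro sum.cong) (auto simp: sym)
  also have "\<dots> \<le> 4" using sq_bound_row[OF bound, of i] assms by simp
  finally show ?thesis .
qed

lemma saturated:
  assumes "J \<subseteq> {..<n}" "u < n" "(\<Sum>v\<in>J. (a u v)\<^sup>2) = 4"
  shows "v < n \<Longrightarrow> v \<notin> J \<Longrightarrow> a u v = 0" "w < n \<Longrightarrow> w \<noteq> u \<Longrightarrow> (\<Sum>v\<in>J. a u v * a v w) = 0"
  using sq_bound_saturated[OF bound finite_lessThan _ assms(1) _ assms(3), unfolded lessThan_iff, OF sym assms(2)]
  by blast+

lemma closed:
  assumes "X \<noteq> {}" "X \<subseteq> {..<n}" "\<And>i j. i \<in> X \<Longrightarrow> j < n \<Longrightarrow> j \<notin> X \<Longrightarrow> a i j = 0"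
  shows "X = {..<n}"
  by (rule indecomposable_closed[OF indec]) (use A assms in auto)

lemma embedsI:
  assumes "inj_on \<phi> {..<n}" "\<phi> ` {..<n} \<subseteq> {..<dim_row S}" "\<And>i. \<bar>s i\<bar> = 1"
    "\<And>i j. i \<in> {..<n} \<Longrightarrow> j \<in> {..<n} \<Longrightarrow> a i j = s i * s j * S $$ (\<phi> i, \<phi> j)"
  shows "embeds A S"
  using assms A unfolding embeds_def by auto

text \<open>A neighbour \<open>w\<close> completes row \<open>u\<close> to squared length
  \<open>3 + 1\<close>. Orthogonality of the rows gives \<open>w\<close> the opposite charge, so row
  \<open>w\<close> is full as well and no third vertex can be attached.\<close>

lemma sqrt3_charge:
  assumes u: "u < n" "\<bar>a u u\<bar> = sqrt 3"
  shows "embeds A S2'"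
proof -
  have uu: "(a u u)\<^sup>2 = 3" using u(2) by (metis abs_ge_zero power2_abs real_sqrt_pow2 real_sqrt_ge_0_iff)
  have "\<exists>w<n. w \<noteq> u \<and> a u w \<noteq> 0"
  proof (rule ccontr)
    assume "\<not> ?thesis"
    then have "{u} = {..<n}" using u by (intro closed) auto
    then have "card {u} = card {..<n}" by simp
    then have n1: "n = 1" "u = 0" using u by auto
    \<comment> \<open>A single vertex has the characteristic polynomial \<open>x - a 0 0\<close>,
      which is not integral for a charge of modulus \<open>sqrt 3\<close>.\<close>
    have "upper_triangular A" using A n1 by auto
    then have "char_poly A = (\<Prod>a\<leftarrow>diag_mat A. [:- a, 1:])"
      using char_poly_upper_triangular[OF A] by simp
    then have "char_poly A = [:- a 0 0, 1:]" using A n1 by (simp add: diag_mat_def)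
    then have "poly.coeff (char_poly A) 0 = - a 0 0" by simp
    then have "a 0 0 \<in> \<int>" using cyc unfolding cyclotomic_def by (metis Ints_minus minus_minus)
    then obtain k where "a 0 0 = of_int k" by (auto elim: Ints_cases)
    then have "(real_of_int k)\<^sup>2 = 3" using uu n1 by simp
    then have "real_of_int (k\<^sup>2) = of_int 3" by simp
    then have k: "k\<^sup>2 = 3" by linarith
    have "\<bar>k\<bar> \<le> 1 \<or> \<bar>k\<bar> \<ge> 2" by linarith
    then show False using k power_mono[of "\<bar>k\<bar>" 1 2] power_mono[of 2 "\<bar>k\<bar>" 2] by auto
  qed
  then obtain w where w: "w < n" "w \<noteq> u" "a u w \<noteq> 0" by blast
  have "(\<Sum>j\<in>{u, w}. (a u j)\<^sup>2) \<le> 4" using u w by (intro row_le) auto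
  then have "(a u w)\<^sup>2 \<le> 1" using w uu by simp
  note uw = small_entry[OF u(1) w(1,3) this]
  have satu: "(\<Sum>j\<in>{u, w}. (a u j)\<^sup>2) = 4" using w uu uw by simp
  have su: "a u v = 0" if "v < n" "v \<notin> {u, w}" for v
    by (rule saturated(1)[OF _ _ satu]) (use that u w in auto)
  have "(\<Sum>v\<in>{u, w}. a u v * a v w) = 0" by (rule saturated(2)[OF _ _ satu]) (use u w in auto)
  then have "a u w * (a u u + a w w) = 0" using w by (simp add: algebra_simps)
  then have ww: "a w w = - a u u" using w by simp
  have satw: "(\<Sum>j\<in>{u, w}. (a w j)\<^sup>2) = 4" using w uu uw ww sym[OF w(1) u(1)] by simp
  have sw: "a w v = 0" if "v < n" "v \<notin> {u, w}" for v
    by (rule saturated(1)[OF _ _ satw]) (use that u w in auto)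
  have n: "{u, w} = {..<n}" using u w su sw by (intro closed) auto
  have e: "a u u = sqrt 3 \<or> a u u = - sqrt 3" using u(2) by linarith
  \<comment> \<open>The vertex of charge \<open>sqrt 3\<close>, be it \<open>u\<close> or
    \<open>w\<close>, takes index 0; the sign at \<open>w\<close> normalises the edge to weight
    1.\<close>
  show ?thesis
    by (rule embedsI[of "\<lambda>i. if (i = u) = (a u u = sqrt 3) then 0 else 1" _ "\<lambda>i. if i = w then a u w else 1"],
      unfold n[symmetric])
      (use w e uw ww sym[OF w(1) u(1)] in \<open>auto simp: inj_on_def S2'_entries power2_eq_square\<close>)
qed

text \<open>The argument for a charge of modulus \<open>sqrt 3\<close>, with the roles of charge and
  edge exchanged.\<close>

lemma sqrt3_edge_charged:
  assumes u: "u < n" and v: "v < n" "v \<noteq> u" and uv: "\<bar>a u v\<bar> = sqrt 3" and c: "a u u \<noteq> 0"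
  shows "embeds A S2dag"
proof -
  have uv2: "(a u v)\<^sup>2 = 3" using uv by (metis abs_ge_zero power2_abs real_sqrt_pow2 real_sqrt_ge_0_iff)
  have "(\<Sum>j\<in>{u, v}. (a u j)\<^sup>2) \<le> 4" using u v by (intro row_le) auto
  then have "(a u u)\<^sup>2 \<le> 1" using v uv2 by simp
  note uu = small_entry[OF u u c this]
  have satu: "(\<Sum>j\<in>{u, v}. (a u j)\<^sup>2) = 4" using v uu uv2 by simp
  have su: "a u x = 0" if "x < n" "x \<notin> {u, v}" for x
    by (rule saturated(1)[OF _ _ satu]) (use that u v in auto)
  have "(\<Sum>x\<in>{u, v}. a u x * a x v) = 0" by (rule saturated(2)[OF _ _ satu]) (use u v in auto)
  then have "a u v * (a u u + a v v) = 0" using v by (simp add: algebra_simps)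
  then have vv: "a v v = - a u u" using uv2 by auto
  have satv: "(\<Sum>j\<in>{u, v}. (a v j)\<^sup>2) = 4" using v uu uv2 vv sym[OF v(1) u(1)] by simp
  have sv: "a v x = 0" if "x < n" "x \<notin> {u, v}" for x
    by (rule saturated(1)[OF _ _ satv]) (use that u v in auto)
  have n: "{u, v} = {..<n}" using u v su sv by (intro closed) auto
  have e: "a u u = 1 \<or> a u u = - 1" using uu by linarith
  have f: "a u v = sqrt 3 \<or> a u v = - sqrt 3" using uv by linarith
  show ?thesis
    by (rule embedsI[of "\<lambda>i. if (i = u) = (a u u = 1) then 0 else 1" _ "\<lambda>i. if i = v then a u v / sqrt 3 else 1"],
      unfold n[symmetric])
      (use v e f vv sym[OF v(1) u(1)] in \<open>auto simp: inj_on_def S2dag_entries\<close>)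
qed

text \<open>Row \<open>u\<close> is full with its entries at \<open>v\<close> and \<open>w\<close>.
  Orthogonality to the other columns makes row \<open>w\<close>, away from \<open>u\<close>, a
  multiple of row \<open>v\<close> by a factor of modulus \<open>sqrt 3\<close>. Either
  \<open>v\<close> has a further neighbour \<open>x\<close>, which closes a 4-cycle, or
  \<open>w\<close> has none either and three vertices of that cycle remain.\<close>

lemma sqrt3_edge_path:
  assumes u: "u < n" and v: "v < n" "v \<noteq> u" and uv: "\<bar>a u v\<bar> = sqrt 3"
    and c: "a u u = 0" "a v v = 0" and w: "w < n" "w \<noteq> u" "w \<noteq> v" "a u w \<noteq> 0"
  shows "embeds A S4sqrt3"
proof -
  have uv2: "(a u v)\<^sup>2 = 3" using uv by (metis abs_ge_zero power2_abs real_sqrt_pow2 real_sqrt_ge_0_iff)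
  have f: "a u v = sqrt 3 \<or> a u v = - sqrt 3" using uv by linarith
  have vu: "a v u = a u v" and wu: "a w u = a u w" and wv: "a w v = a v w"
    using u v w sym by simp_all
  have "(\<Sum>j\<in>{v, w}. (a u j)\<^sup>2) \<le> 4" using u v w by (intro row_le) auto
  then have "(a u w)\<^sup>2 \<le> 1" using w uv2 by simp
  note uw = small_entry[OF u w(1,4) this]
  have e: "a u w = 1 \<or> a u w = - 1" using uw by linarith
  have satu: "(\<Sum>j\<in>{v, w}. (a u j)\<^sup>2) = 4" using w uw uv2 by simp
  have su: "a u x = 0" if "x < n" "x \<notin> {v, w}" for x
    by (rule saturated(1)[OF _ _ satu]) (use that u v w in auto)
  have orth: "a u v * a v x + a u w * a w x = 0" if "x < n" "x \<noteq> u" for x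
    using saturated(2)[OF _ u satu that] v w by simp
  have wv0: "a v w = 0" using orth[OF v] c w(4) wv by simp
  have ww: "a w w = 0" using orth[OF w(1,2)] wv0 w(4) by simp
  have wx: "a w x = - a u v * a u w * a v x" if "x < n" "x \<noteq> u" for x
    using orth[OF that] e by auto
  define \<phi> where "\<phi> i = (if i = u then 0 else if i = v then 1 else if i = w then 2 else (3::nat))" for i
  show ?thesis
  proof (cases "\<exists>x<n. x \<noteq> u \<and> x \<noteq> v \<and> x \<noteq> w \<and> a v x \<noteq> 0")
    case True
    then obtain x where x: "x < n" "x \<noteq> u" "x \<noteq> v" "x \<noteq> w" "a v x \<noteq> 0" by blast
    have xs: "a x u = a u x" "a x v = a v x" "a x w = a w x" using u v w x sym by simp_all
    have "(\<Sum>j\<in>{u, x}. (a v j)\<^sup>2) \<le> 4" using u v x by (intro row_le) auto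
    then have "(a v x)\<^sup>2 \<le> 1" using x uv2 vu by simp
    note vx = small_entry[OF v(1) x(1,5) this]
    have g: "a v x = 1 \<or> a v x = - 1" using vx by linarith
    have wx3: "(a w x)\<^sup>2 = 3" using wx[OF x(1,2)] vx uw uv2 by (simp add: power_mult_distrib)
    have satv: "(\<Sum>j\<in>{u, x}. (a v j)\<^sup>2) = 4" using x vx uv2 vu by simp
    have satw: "(\<Sum>j\<in>{u, x}. (a w j)\<^sup>2) = 4" using x wx3 uw wu by simp
    have satx: "(\<Sum>j\<in>{v, w}. (a x j)\<^sup>2) = 4" using w x wx3 vx xs by simp
    have s: "a v y = 0" "a w y = 0" if "y < n" "y \<notin> {u, x}" for y
      by (rule saturated(1)[OF _ _ satv] saturated(1)[OF _ _ satw]; use that u v w x in auto)+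
    have sx: "a x y = 0" if "y < n" "y \<notin> {v, w}" for y
      by (rule saturated(1)[OF _ _ satx]) (use that v w x in auto)
    have n: "{u, v, w, x} = {..<n}" using u v w x su s sx by (intro closed) auto
    have z: "a u x = 0" "a x x = 0" using su sx x v w by auto
    \<comment> \<open>The minus sign at \<open>w\<close> accounts for the edge of weight -1 in
      \<open>S4sqrt3\<close>.\<close>
    define s where "s i = (if i = u then 1 else if i = v then a u v / sqrt 3 else if i = w then - a u w
      else a u v / sqrt 3 * a v x)" for i
    have s1: "\<bar>s i\<bar> = 1" for i using uv uw vx by (simp add: s_def abs_mult)
    show ?thesis
    proof (rule embedsI[of \<phi> _ s, OF _ _ s1])
      show "inj_on \<phi> {..<n}" "\<phi> ` {..<n} \<subseteq> {..<dim_row S4sqrt3}"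
        unfolding n[symmetric] using v w x by (auto simp: \<phi>_def inj_on_def S4sqrt3_entries)
      have p: "\<phi> u = 0" "\<phi> v = Suc 0" "\<phi> w = 2" "\<phi> x = 3" using v w x by (auto simp: \<phi>_def)
      have q: "s u = 1" "s v = a u v / sqrt 3" "s w = - a u w" "s x = a u v / sqrt 3 * a v x"
        using v w x by (auto simp: s_def)
      show "a i j = s i * s j * S4sqrt3 $$ (\<phi> i, \<phi> j)" if "i \<in> {..<n}" "j \<in> {..<n}" for i j
        using that unfolding n[symmetric]
        by (elim insertE emptyE; simp only: p q S4sqrt3_entries c vu wu wv wv0 ww z xs wx[OF x(1,2)])
          (use e f g in auto)
    qed
  next
    case False
    have n: "{u, v, w} = {..<n}" using u v w su False wx by (intro closed) auto
    define s where "s i = (if i = v then a u v / sqrt 3 else if i = w then - a u w else 1)" for i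
    have s1: "\<bar>s i\<bar> = 1" for i using uv uw by (simp add: s_def abs_mult)
    show ?thesis
    proof (rule embedsI[of \<phi> _ s, OF _ _ s1])
      show "inj_on \<phi> {..<n}" "\<phi> ` {..<n} \<subseteq> {..<dim_row S4sqrt3}"
        unfolding n[symmetric] using v w by (auto simp: \<phi>_def inj_on_def S4sqrt3_entries)
      have p: "\<phi> u = 0" "\<phi> v = Suc 0" "\<phi> w = 2" using v w by (auto simp: \<phi>_def)
      have q: "s u = 1" "s v = a u v / sqrt 3" "s w = - a u w"
        using v w by (auto simp: s_def)
      show "a i j = s i * s j * S4sqrt3 $$ (\<phi> i, \<phi> j)" if "i \<in> {..<n}" "j \<in> {..<n}" for i j
        using that unfolding n[symmetric]
        by (elim insertE emptyE; simp only: p q S4sqrt3_entries c vu wu wv wv0 ww)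
          (use e f in auto)
    qed
  qed
qed

lemma noninteger_embeds:
  assumes "\<not> over_ring \<int> A"
  shows "embeds A S2' \<or> embeds A S2dag \<or> embeds A S4sqrt3"
proof -
  obtain u v where u: "u < n" and v: "v < n" and "a u v \<notin> \<int>"
    using assms A by (auto simp: over_ring_def)
  then have uv: "\<bar>a u v\<bar> = sqrt 3" using entry by blast
  then have vu: "\<bar>a v u\<bar> = sqrt 3" using sym u v by simp
  consider "u = v" | "u \<noteq> v" "a u u \<noteq> 0" | "u \<noteq> v" "a v v \<noteq> 0"
    | w where "u \<noteq> v" "a u u = 0" "a v v = 0" "w < n" "w \<noteq> u" "w \<noteq> v" "a u w \<noteq> 0"
    | w where "u \<noteq> v" "a u u = 0" "a v v = 0" "w < n" "w \<noteq> u" "w \<noteq> v" "a v w \<noteq> 0"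
    | "u \<noteq> v" "a u u = 0" "a v v = 0" "\<forall>w<n. w \<noteq> u \<longrightarrow> w \<noteq> v \<longrightarrow> a u w = 0 \<and> a v w = 0"
    by blast
  then show ?thesis
  proof cases
    case 1
    then show ?thesis using sqrt3_charge u uv by blast
  next
    case 2
    then show ?thesis using sqrt3_edge_charged[OF u v _ uv] by blast
  next
    case 3
    then show ?thesis using sqrt3_edge_charged[OF v u _ vu] by blast
  next
    case (4 w)
    then show ?thesis using sqrt3_edge_path[OF u v _ uv] by blast
  next
    case (5 w)
    then show ?thesis using sqrt3_edge_path[OF v u _ vu] by blast
  next
    case 6
    have n: "{u, v} = {..<n}" using u v 6 by (intro closed) auto
    have f: "a u v = sqrt 3 \<or> a u v = - sqrt 3" using uv by linarith
    have "embeds A S4sqrt3"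
      by (rule embedsI[of "\<lambda>i. if i = u then 0 else 1" _ "\<lambda>i. if i = v then a u v / sqrt 3 else 1"],
        unfold n[symmetric])
        (use f 6 sym[OF v u] in \<open>auto simp: inj_on_def S4sqrt3_entries\<close>)
    then show ?thesis by blast
  qed
qed

end

section \<open>Tessellations are maximal\<close>

lemma Zsqrt3_consts: "0 \<in> Zsqrt3" "1 \<in> Zsqrt3" "sqrt 3 \<in> Zsqrt3" "real_of_int k \<in> Zsqrt3"
proof -
  have *: "real_of_int k + of_int l * sqrt 3 \<in> Zsqrt3" for k l unfolding Zsqrt3_def by blast
  show "0 \<in> Zsqrt3" "1 \<in> Zsqrt3" "sqrt 3 \<in> Zsqrt3" "real_of_int k \<in> Zsqrt3"
    using *[of 0 0] *[of 1 0] *[of 0 1] *[of k 0] by simp_all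
qed

lemma less_4_iff: "i < (4::nat) \<longleftrightarrow> i = 0 \<or> i = Suc 0 \<or> i = 2 \<or> i = 3" by auto

lemma lessThan_2: "{..<2::nat} = {0, Suc 0}" by auto

lemma lessThan_4: "{..<4::nat} = {0, Suc 0, 2, 3}" by auto

lemma embeds_maximal:
  assumes A: "A \<in> carrier_mat n n" and e: "embeds A S" and S: "S \<in> {S2', S2dag, S4sqrt3}"
  shows "\<exists>B. maximal_indec_cyclotomic Zsqrt3 B \<and> principal_submatrix A B \<and> dim_row B = dim_row S"
proof -
  let ?V = "{..<dim_row S}"
  obtain \<phi> s where \<phi>: "inj_on \<phi> {..<n}" "\<phi> ` {..<n} \<subseteq> ?V" and s: "\<And>i. \<bar>s i\<bar> = (1::real)"
    and As: "\<And>i j. i < n \<Longrightarrow> j < n \<Longrightarrow> A $$ (i, j) = s i * s j * S $$ (\<phi> i, \<phi> j)"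
    using e unfolding embeds_def carrier_matD(1)[OF A] by blast
  note entries = S2'_entries S2dag_entries S4sqrt3_entries
  have "\<exists>B. maximal_indec_cyclotomic Zsqrt3 B \<and> principal_submatrix A B \<and> dim_row B = card ?V"
  proof (rule embed_in_maximal[where t = "\<lambda>p q. S $$ (p, q)", OF _ _ _ _ _ _ A \<phi> s As])
    show "?V \<noteq> {}" using S by (auto simp: entries lessThan_empty_iff bot_nat_def)
    show "S $$ (p, q) = S $$ (q, p)" "S $$ (p, q) \<in> Zsqrt3" if "p \<in> ?V" "q \<in> ?V" for p q
      using S that by (auto simp: entries less_2_cases_iff less_4_iff Zsqrt3_consts Zsqrt3_uminus)
    show "(\<Sum>x\<in>?V. S $$ (p, x) * S $$ (x, q)) = (if p = q then 4 else 0)" if "p \<in> ?V" "q \<in> ?V" for p q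
      using S that by (auto simp: entries less_2_cases_iff less_4_iff lessThan_4 lessThan_2)
    show "X = ?V" if X: "X \<noteq> {}" "X \<subseteq> ?V"
      and cl: "\<And>p q. p \<in> X \<Longrightarrow> q \<in> ?V \<Longrightarrow> S $$ (p, q) \<noteq> 0 \<Longrightarrow> q \<in> X" for X
    proof -
      obtain p where p: "p \<in> X" "p \<in> ?V" using X by blast
      show ?thesis
      proof (cases "S = S4sqrt3")
        case True
        have "Suc 0 \<in> X" if "0 \<in> X" using cl[OF that, of "Suc 0"] True by (simp add: entries)
        moreover have "3 \<in> X" if "Suc 0 \<in> X" using cl[OF that, of 3] True by (simp add: entries)
        moreover have "2 \<in> X" if "3 \<in> X" using cl[OF that, of 2] True by (simp add: entries)
        moreover have "0 \<in> X" if "2 \<in> X" using cl[OF that, of 0] True by (simp add: entries)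
        ultimately have "{0, Suc 0, 2, 3} \<subseteq> X" using p True by (auto simp: entries less_4_iff)
        then show ?thesis using X(2) unfolding True S4sqrt3_entries(1) lessThan_4 by blast
      next
        case False
        then have S2: "S = S2' \<or> S = S2dag" using S by blast
        have "Suc 0 \<in> X" if "0 \<in> X" using cl[OF that, of "Suc 0"] S2 by (auto simp: entries)
        moreover have "0 \<in> X" if "Suc 0 \<in> X" using cl[OF that, of 0] S2 by (auto simp: entries)
        moreover have V: "?V = {0, Suc 0}" using S2 by (auto simp: entries less_2_cases_iff)
        ultimately show ?thesis using p X by auto
      qed
    qed
  qed simp
  then show ?thesis by simp
qed

lemma embeds_equivalent:
  assumes A: "A \<in> carrier_mat n n" and S: "S \<in> carrier_mat n n" and e: "embeds A S"
  shows "equivalent A S"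
proof -
  obtain \<phi> s where \<phi>: "inj_on \<phi> {..<n}" "\<phi> ` {..<n} \<subseteq> {..<n}" and s: "\<And>i. \<bar>s i\<bar> = (1::real)"
    and As: "\<And>i j. i < n \<Longrightarrow> j < n \<Longrightarrow> A $$ (i, j) = s i * s j * S $$ (\<phi> i, \<phi> j)"
    using e unfolding embeds_def carrier_matD(1)[OF A] carrier_matD(1)[OF S] by blast
  have s1: "s i = 1 \<or> s i = -1" for i using s[of i] by linarith
  have \<phi>n: "\<phi> i < n" if "i < n" for i using \<phi>(2) that by auto
  define Q where "Q = mat n n (\<lambda>(i, k). if k = \<phi> i then s i else 0)"
  have Q: "Q \<in> carrier_mat n n" by (simp add: Q_def)
  have Qij: "Q $$ (i, k) = (if k = \<phi> i then s i else 0)" if "i < n" "k < n" for i k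
    using that by (simp add: Q_def)
  have pick: "(\<Sum>k = 0..<n. (if k = \<phi> i then s i else 0) * g k) = s i * g (\<phi> i)" if "i < n" for i and g :: "nat \<Rightarrow> real"
    using \<phi>n[OF that] by (simp add: if_distrib[of "\<lambda>x. x * _"] cong: if_cong)
  have Qint: "Q $$ (i, j) \<in> \<int>" if "i < n" "j < n" for i j
    using that s1[of i] by (auto simp: Q_def)
  have QQ: "Q * transpose_mat Q = 1\<^sub>m n"
  proof (rule eq_matI)
    fix i j assume "i < dim_row (1\<^sub>m n)" "j < dim_col (1\<^sub>m n)"
    then have ij: "i < n" "j < n" by simp_all
    then have "(Q * transpose_mat Q) $$ (i, j)
        = (\<Sum>k = 0..<n. (if k = \<phi> i then s i else 0) * (if k = \<phi> j then s j else 0))"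
      by (simp add: Q_def scalar_prod_def)
    also have "\<dots> = s i * (if \<phi> i = \<phi> j then s j else 0)" using pick[OF ij(1)] .
    also have "\<dots> = 1\<^sub>m n $$ (i, j)"
      using ij s1[of i] inj_on_eq_iff[OF \<phi>(1), of i j] by auto
    finally show "(Q * transpose_mat Q) $$ (i, j) = 1\<^sub>m n $$ (i, j)" .
  qed (simp_all add: Q_def)
  have "A = map_mat id (Q * S * transpose_mat Q)"
  proof (rule eq_matI)
    have QS: "(Q * S) $$ (i, l) = s i * S $$ (\<phi> i, l)" if "i < n" "l < n" for i l
    proof -
      have "(Q * S) $$ (i, l) = (\<Sum>k = 0..<n. (if k = \<phi> i then s i else 0) * S $$ (k, l))"
        using that S by (simp add: Q_def scalar_prod_def)
      then show ?thesis using pick[OF that(1)] by simp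
    qed
    fix i j assume "i < dim_row (map_mat id (Q * S * transpose_mat Q))"
      "j < dim_col (map_mat id (Q * S * transpose_mat Q))"
    then have ij: "i < n" "j < n" using Q by simp_all
    have "(Q * S * transpose_mat Q) $$ (i, j) = (\<Sum>l = 0..<n. (Q * S) $$ (i, l) * Q $$ (j, l))"
    proof -
      define P where "P = Q * S"
      have "P \<in> carrier_mat n n" using Q S by (simp add: P_def)
      then show ?thesis using ij Q unfolding P_def[symmetric] by (simp add: scalar_prod_def)
    qed
    also have "\<dots> = (\<Sum>l = 0..<n. (if l = \<phi> j then s j else 0) * (s i * S $$ (\<phi> i, l)))"
      using ij by (intro sum.cong) (auto simp: QS Qij)
    also have "\<dots> = A $$ (i, j)" using pick[OF ij(2)] As[OF ij] by simp
    finally show "A $$ (i, j) = map_mat id (Q * S * transpose_mat Q) $$ (i, j)"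
      using ij Q S by simp
  qed (use A Q S in simp_all)
  then have "\<exists>\<sigma>\<in>{id, sqrt3_conj}. A = map_mat \<sigma> (Q * S * transpose_mat Q)"
    by (rule bexI[where x = id]) simp
  then have "strongly_equiv A S"
    unfolding strongly_equiv_def using Qint
    by (intro exI[of _ n] conjI A S bexI[OF _ Q] QQ allI impI)
  then show ?thesis by (simp add: equivalent_def)
qed

text \<open>The identity \<open>C^T C = 4I\<close>: \<open>e_i\<close> occurs in the four vertices
  of columns \<open>i\<close> and \<open>Suc i\<close>, and for \<open>i \<noteq> j\<close> the
  contributions of the two signs cancel.\<close>

lemma tess_columns:
  assumes "i < m" "j < m"
  shows "(\<Sum>x\<in>{..m} \<times> UNIV. tess_vec x i * tess_vec x j) = (if i = j then 4 else 0)"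
proof -
  have "(\<Sum>x\<in>{..m} \<times> UNIV. tess_vec x i * tess_vec x j)
      = (\<Sum>k\<le>m. \<Sum>\<beta>\<in>UNIV. tess_vec (k, \<beta>) i * tess_vec (k, \<beta>) j)"
    by (simp add: sum.cartesian_product)
  also have "\<dots> = (\<Sum>k\<le>m. (if k = Suc i then if i = j then 2 else 0 else 0) + (if k = i then if i = j then 2 else 0 else 0))"
    by (intro sum.cong refl) (auto simp: UNIV_bool tess_vec_def)
  also have "\<dots> = (if i = j then 4 else 0)" using assms by (simp add: sum.distrib)
  finally show ?thesis .
qed

text \<open>With \<open>G = CC^T\<close>, the orthogonality of the columns gives
  \<open>G^2 = 4G\<close>, hence \<open>(2 - G)^2 = 4\<close>.\<close>

lemma tess_square:
  assumes p: "p \<in> {..m} \<times> UNIV" and q: "q \<in> {..m} \<times> UNIV"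
  shows "(\<Sum>x\<in>{..m} \<times> UNIV. tess m p x * tess m x q) = (if p = q then 4 else 0)"
proof -
  let ?V = "{..m} \<times> (UNIV :: bool set)"
  define G where "G p q = (\<Sum>j<m. tess_vec p j * tess_vec q j)" for p q
  have tG: "tess m p q = (if p = q then 2 else 0) - G p q" for p q by (simp add: tess_def G_def)
  have GG: "(\<Sum>x\<in>?V. G p x * G x q) = 4 * G p q"
  proof -
    have "(\<Sum>x\<in>?V. G p x * G x q)
        = (\<Sum>x\<in>?V. \<Sum>i<m. \<Sum>j<m. tess_vec p i * tess_vec x i * (tess_vec x j * tess_vec q j))"
      by (simp add: G_def sum_product)
    also have "\<dots> = (\<Sum>i<m. \<Sum>x\<in>?V. \<Sum>j<m. tess_vec p i * tess_vec x i * (tess_vec x j * tess_vec q j))"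
      by (rule sum.swap)
    also have "\<dots> = (\<Sum>i<m. \<Sum>j<m. \<Sum>x\<in>?V. tess_vec p i * tess_vec x i * (tess_vec x j * tess_vec q j))"
      by (intro sum.cong refl sum.swap)
    also have "\<dots> = (\<Sum>i<m. \<Sum>j<m. tess_vec p i * tess_vec q j * (\<Sum>x\<in>?V. tess_vec x i * tess_vec x j))"
      by (intro sum.cong refl) (simp add: sum_distrib_left mult_ac)
    also have "\<dots> = (\<Sum>i<m. \<Sum>j<m. if j = i then 4 * (tess_vec p i * tess_vec q i) else 0)"
      by (intro sum.cong refl) (auto simp: tess_columns)
    also have "\<dots> = 4 * G p q" by (simp add: G_def sum_distrib_left)
    finally show ?thesis .
  qed
  have "(\<Sum>x\<in>?V. tess m p x * tess m x q)
      = (\<Sum>x\<in>?V. (if x = p then (if p = q then 4 else 0) else 0) - (if x = p then 2 * G p q else 0)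
        - (if x = q then 2 * G p q else 0) + G p x * G x q)"
    unfolding tG by (intro sum.cong refl) (auto simp: algebra_simps)
  also have "\<dots> = (if p = q then 4 else 0)"
    using p q by (simp add: sum.distrib sum_subtractf GG)
  finally show ?thesis .
qed

text \<open>Consecutive columns are completely joined, so a vertex of column 0 reaches its twin
  through column 1 and back; \<open>m > 0\<close> provides that column.\<close>

lemma tess_connected:
  assumes m: "m > 0" and X: "X \<noteq> {}" "X \<subseteq> {..m} \<times> UNIV"
    and cl: "\<And>p q. p \<in> X \<Longrightarrow> q \<in> {..m} \<times> UNIV \<Longrightarrow> tess m p q \<noteq> 0 \<Longrightarrow> q \<in> X"
  shows "X = {..m} \<times> UNIV"
proof -
  have G: "(\<Sum>j<m. tess_vec (k, \<beta>) j * tess_vec (Suc k, \<gamma>) j) = (if \<beta> then 1 else - 1)" if "k < m" for k \<beta> \<gamma>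
  proof -
    have "(\<Sum>j<m. tess_vec (k, \<beta>) j * tess_vec (Suc k, \<gamma>) j) = (\<Sum>j<m. if j = k then if \<beta> then 1 else - 1 else 0)"
      by (intro sum.cong) (auto simp: tess_vec_def)
    then show ?thesis using that by simp
  qed
  have up: "(Suc k, \<gamma>) \<in> X" if "(k, \<beta>) \<in> X" "k < m" for k \<beta> \<gamma>
    by (rule cl[OF that(1)]) (use that G[OF that(2), of \<beta> \<gamma>] in \<open>auto simp: tess_def\<close>)
  have down: "(k, \<gamma>) \<in> X" if "(Suc k, \<beta>) \<in> X" "k < m" for k \<beta> \<gamma>
    by (rule cl[OF that(1)])
      (use that G[OF that(2), of \<gamma> \<beta>] in \<open>auto simp: tess_def mult.commute[of "tess_vec (Suc k, \<beta>) _"]\<close>)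
  obtain k \<beta> where k: "(k, \<beta>) \<in> X" "k \<le> m" using X by auto
  have "(k, \<beta>) \<in> X \<Longrightarrow> k \<le> m \<Longrightarrow> (0, \<gamma>) \<in> X" for k \<beta> \<gamma>
  proof (induction k arbitrary: \<beta> \<gamma>)
    case 0
    then have "(Suc 0, \<gamma>) \<in> X" using up m by blast
    then show ?case using down m by blast
  next
    case (Suc k)
    then have "(k, \<gamma>) \<in> X" using down[of k] by simp
    then show ?case using Suc by simp
  qed
  then have z: "(0, \<gamma>) \<in> X" for \<gamma> using k by blast
  have "k \<le> m \<Longrightarrow> (k, \<gamma>) \<in> X" for k \<gamma>
  proof (induction k arbitrary: \<gamma>)
    case (Suc k)
    then show ?case using up[of k] by simp
  qed (rule z)
  then show ?thesis using X(2) by auto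
qed

lemma tess_maximal:
  assumes A: "A \<in> carrier_mat n n" and m: "m > 0" and \<phi>: "inj_on \<phi> {..<n}" "\<phi> ` {..<n} \<subseteq> {..m} \<times> UNIV"
    and s: "\<And>i. \<bar>s i\<bar> = 1" "\<bar>\<epsilon>\<bar> = 1"
    and At: "\<And>i j. i < n \<Longrightarrow> j < n \<Longrightarrow> A $$ (i, j) = real_of_int (\<epsilon> * s i * s j * tess m (\<phi> i) (\<phi> j))"
  shows "\<exists>B. maximal_indec_cyclotomic Zsqrt3 B \<and> principal_submatrix A B"
proof -
  have ee: "\<epsilon> * \<epsilon> = 1" using s(2) by (metis abs_mult_self_eq mult_1)
  have "\<exists>B. maximal_indec_cyclotomic Zsqrt3 B \<and> principal_submatrix A B \<and> dim_row B = card ({..m} \<times> (UNIV :: bool set))"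
  proof (rule embed_in_maximal[where t = "\<lambda>p q. real_of_int (\<epsilon> * tess m p q)" and s = "\<lambda>i. real_of_int (s i)",
        OF _ _ _ _ _ _ A \<phi>])
    let ?V = "{..m} \<times> (UNIV :: bool set)"
    show "finite ?V" "?V \<noteq> {}" by auto
    show "real_of_int (\<epsilon> * tess m p q) = real_of_int (\<epsilon> * tess m q p)" for p q
      by (auto simp: tess_def mult.commute)
    show "real_of_int (\<epsilon> * tess m p q) \<in> Zsqrt3" for p q by (rule Zsqrt3_consts)
    show "(\<Sum>x\<in>?V. real_of_int (\<epsilon> * tess m p x) * real_of_int (\<epsilon> * tess m x q)) = (if p = q then 4 else 0)"
      if "p \<in> ?V" "q \<in> ?V" for p q
    proof -
      have "(\<Sum>x\<in>?V. real_of_int (\<epsilon> * tess m p x) * real_of_int (\<epsilon> * tess m x q))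
          = real_of_int (\<epsilon> * \<epsilon> * (\<Sum>x\<in>?V. tess m p x * tess m x q))"
        by (simp add: sum_distrib_left mult_ac)
      then show ?thesis using that by (simp add: ee tess_square)
    qed
    show "X = ?V" if "X \<noteq> {}" "X \<subseteq> ?V"
      "\<And>p q. p \<in> X \<Longrightarrow> q \<in> ?V \<Longrightarrow> real_of_int (\<epsilon> * tess m p q) \<noteq> 0 \<Longrightarrow> q \<in> X" for X
      by (rule tess_connected[OF m that(1,2)]) (use that(3) s(2) in auto)
    show "\<bar>real_of_int (s i)\<bar> = 1" for i using s(1)[of i] by linarith
    show "A $$ (i, j) = real_of_int (s i) * real_of_int (s j) * real_of_int (\<epsilon> * tess m (\<phi> i) (\<phi> j))"
      if "i < n" "j < n" for i j using At[OF that] by simp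
  qed
  then show ?thesis by blast
qed

lemma principal_submatrix_refl: "square_mat A \<Longrightarrow> principal_submatrix A A"
  unfolding principal_submatrix_def by (auto intro!: exI[of _ "\<lambda>i. i"] simp: strict_mono_on_def)

lemma principal_submatrix_trans:
  assumes "principal_submatrix A B" "principal_submatrix B C"
  shows "principal_submatrix A C"
proof -
  obtain f where f: "strict_mono_on {..<dim_row A} f" "\<forall>i<dim_row A. f i < dim_row B"
    "\<forall>i<dim_row A. \<forall>j<dim_row A. A $$ (i, j) = B $$ (f i, f j)" "square_mat A"
    using assms(1) unfolding principal_submatrix_def by blast
  obtain g where g: "strict_mono_on {..<dim_row B} g" "\<forall>i<dim_row B. g i < dim_row C"
    "\<forall>i<dim_row B. \<forall>j<dim_row B. B $$ (i, j) = C $$ (g i, g j)" "square_mat C"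
    using assms(2) unfolding principal_submatrix_def by blast
  have "strict_mono_on {..<dim_row A} (\<lambda>i. g (f i))"
    using f(1,2) g(1) unfolding strict_mono_on_def by simp
  then show ?thesis
    unfolding principal_submatrix_def using f g by (intro conjI exI[of _ "\<lambda>i. g (f i)"]) auto
qed

section \<open>Growing integer matrices\<close>

definition uncontained :: "real mat \<Rightarrow> bool" where
  "uncontained A \<longleftrightarrow> over_ring \<int> A \<and> indecomposable A \<and> cyclotomic A \<and>
    \<not> (\<exists>B. maximal_indec_cyclotomic Zsqrt3 B \<and> principal_submatrix A B)"

text \<open>Growth appends a last row and column. Written as corners of arrays on all of
  \<open>nat\<close>, the matrices keep their entries in place and have a limit.\<close>

definition corner :: "nat \<Rightarrow> (nat \<Rightarrow> nat \<Rightarrow> int) \<Rightarrow> real mat" where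
  "corner n a = mat n n (\<lambda>(i, j). real_of_int (a i j))"

lemma corner_carrier [simp]: "corner n a \<in> carrier_mat n n" "dim_row (corner n a) = n" "dim_col (corner n a) = n"
  and corner_index [simp]: "i < n \<Longrightarrow> j < n \<Longrightarrow> corner n a $$ (i, j) = real_of_int (a i j)"
  by (simp_all add: corner_def)

lemma over_ring_Ints_Zsqrt3: "over_ring \<int> A \<Longrightarrow> over_ring Zsqrt3 A"
  unfolding over_ring_def using Zsqrt3_consts(4) by (metis Ints_cases)

lemma sq_bound_cong:
  assumes "\<And>u v. u \<in> V \<Longrightarrow> v \<in> V \<Longrightarrow> a u v = b u v"
  shows "sq_bound V a \<longleftrightarrow> sq_bound V b"
proof -
  have "(\<Sum>u\<in>V. (\<Sum>v\<in>V. a u v * z v)\<^sup>2) = (\<Sum>u\<in>V. (\<Sum>v\<in>V. b u v * z v)\<^sup>2)" for z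
    by (intro sum.cong arg_cong2[where f = "\<lambda>x y. x ^ y"] refl) (simp add: assms)
  then show ?thesis by (simp add: sq_bound_def)
qed

lemma corner_sq_bound:
  assumes "cyclotomic (corner n a)"
  shows "sq_bound {..<n} a"
proof -
  have "sq_bound {..<n} (\<lambda>i j. corner n a $$ (i, j))"
    by (rule cyclotomic_sq_bound[OF assms]) simp
  then have "sq_bound {..<n} (\<lambda>i j. real_of_int (a i j))"
    by (subst (asm) sq_bound_cong[where b = "\<lambda>i j. real_of_int (a i j)"]) auto
  then show ?thesis by (rule sq_bound_of_int)
qed

lemma noninteger_embedding:
  assumes "over_ring Zsqrt3 A" "indecomposable A" "cyclotomic A" "\<not> over_ring \<int> A"
  obtains S where "S \<in> {S2', S2dag, S4sqrt3}" "embeds A S"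
proof -
  interpret cyc_matrix A "dim_row A"
    by unfold_locales (use assms in \<open>auto simp: indecomposable_def\<close>)
  show ?thesis using noninteger_embeds[OF assms(4)] that by blast
qed

text \<open>One vertex is added at a time, joined to an old one. In the limit every late vertex then
  has an earlier neighbour, which is what \<open>exists_ray\<close> asks for.\<close>

lemma uncontained_extend:
  assumes unc: "uncontained (corner n a)"
  shows "\<exists>a'. uncontained (corner (Suc n) a') \<and> (\<forall>i<n. \<forall>j<n. a' i j = a i j) \<and> (\<exists>i<n. a' n i \<noteq> 0)"
proof -
  let ?M = "corner n a"
  have ind: "indecomposable ?M" and cyc: "cyclotomic ?M" and ints: "over_ring \<int> ?M"
    and nomax: "\<And>B. maximal_indec_cyclotomic Zsqrt3 B \<Longrightarrow> \<not> principal_submatrix ?M B"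
    using unc by (auto simp: uncontained_def)
  have n1: "n \<ge> 1" using ind by (simp add: indecomposable_def)
  have "\<not> maximal_indec_cyclotomic Zsqrt3 ?M"
    using nomax principal_submatrix_refl[of ?M] by auto
  then obtain B where B: "over_ring Zsqrt3 B" "indecomposable B" "cyclotomic B" and pB: "proper_principal_submatrix ?M B"
    using ind cyc over_ring_Ints_Zsqrt3[OF ints] unfolding maximal_indec_cyclotomic_def by blast
  define m where "m = dim_row B"
  have Bm: "B \<in> carrier_mat m m" using B(2) by (auto simp: indecomposable_def m_def)
  have MB: "principal_submatrix ?M B" using pB by (simp add: proper_principal_submatrix_def)
  \<comment> \<open>An irrational entry would place \<open>B\<close>, and with it the corner, inside
    a maximal matrix of the size of \<open>S2'\<close>, \<open>S2dag\<close> or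
    \<open>S4sqrt3\<close>.\<close>
  have intB: "over_ring \<int> B"
  proof (rule ccontr)
    assume no: "\<not> ?thesis"
    obtain S where "S \<in> {S2', S2dag, S4sqrt3}" "embeds B S" using noninteger_embedding[OF B no] by blast
    from embeds_maximal[OF Bm this(2,1)] obtain C where "maximal_indec_cyclotomic Zsqrt3 C" "principal_submatrix B C"
      by blast
    then show False using nomax principal_submatrix_trans[OF MB] by blast
  qed
  obtain f where f: "strict_mono_on {..<n} f" "\<And>i. i < n \<Longrightarrow> f i < m"
    "\<And>i j. i < n \<Longrightarrow> j < n \<Longrightarrow> ?M $$ (i, j) = B $$ (f i, f j)" and nm: "n < m"
    using pB by (auto simp: proper_principal_submatrix_def principal_submatrix_def m_def)
  have sym: "B $$ (i, j) = B $$ (j, i)" if "i < m" "j < m" for i j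
    using B(3) Bm that unfolding cyclotomic_def by (metis carrier_matD index_transpose_mat(1))
  have injf: "inj_on f {..<n}" using f(1) by (rule strict_mono_on_imp_inj_on)
  have "f ` {..<n} \<noteq> {..<m}"
    using nm card_image[OF injf] by (metis card_lessThan less_irrefl)
  moreover have "f ` {..<n} = {..<m}" if "\<And>i j. i \<in> f ` {..<n} \<Longrightarrow> j < m \<Longrightarrow> B $$ (i, j) \<noteq> 0 \<Longrightarrow> j \<in> f ` {..<n}"
    by (rule indecomposable_closed[OF B(2)]) (use f(2) n1 that in \<open>auto simp: m_def lessThan_empty_iff bot_nat_def\<close>)
  ultimately obtain i0 w where i0: "i0 < n" and w: "w < m" "B $$ (f i0, w) \<noteq> 0" "w \<notin> f ` {..<n}"
    by blast
  \<comment> \<open>Of the new vertices of \<open>B\<close> only \<open>w\<close> is kept, and it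
    goes last whatever its position in \<open>B\<close>.\<close>
  define g where "g i = (if i < n then f i else w)" for i
  have gm: "g i < m" for i using f(2) w(1) by (simp add: g_def)
  have injg: "inj_on g {..<Suc n}"
    using injf w(3) by (auto simp: inj_on_def g_def less_Suc_eq)
  define a' where "a' i j = \<lfloor>B $$ (g i, g j)\<rfloor>" for i j
  have a': "real_of_int (a' i j) = B $$ (g i, g j)" for i j
    using intB Bm gm by (simp add: a'_def over_ring_def)
  have old: "a' i j = a i j" if "i < n" "j < n" for i j
  proof -
    have "real_of_int (a' i j) = real_of_int (a i j)"
      unfolding a' using f(3)[OF that] that by (simp add: g_def)
    then show ?thesis by simp
  qed
  let ?M' = "corner (Suc n) a'"
  have new: "a' n i0 \<noteq> 0" and new': "a' i0 n \<noteq> 0"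
  proof -
    have "real_of_int (a' i0 n) \<noteq> 0" unfolding a' using i0 w by (simp add: g_def)
    then show "a' i0 n \<noteq> 0" by simp
    have "real_of_int (a' n i0) \<noteq> 0" unfolding a' using i0 w sym[of w "f i0"] f(2) by (simp add: g_def)
    then show "a' n i0 \<noteq> 0" by simp
  qed
  have sym': "a' i j = a' j i" for i j using sym[OF gm gm] by (simp add: a'_def)
  have "cyclotomic ?M'"
  proof (rule int_matrix_cyclotomic)
    show "transpose_mat ?M' = ?M'" by (intro eq_matI) (auto simp: sym')
    show "over_ring \<int> ?M'" by (simp add: over_ring_def)
    have "sq_bound {..<m} (\<lambda>i j. B $$ (i, j))" by (rule cyclotomic_sq_bound[OF B(3) Bm])
    then have "sq_bound (g ` {..<Suc n}) (\<lambda>i j. B $$ (i, j))"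
      using gm by (rule_tac sq_bound_subset[of "{..<m}"]) auto
    then have "sq_bound {..<Suc n} (\<lambda>i j. B $$ (g i, g j))" using injg by (rule sq_bound_reindex)
    then show "sq_bound {..<Suc n} (\<lambda>i j. ?M' $$ (i, j))"
      by (subst sq_bound_cong[where b = "\<lambda>i j. B $$ (g i, g j)"]) (auto simp: a')
  qed simp
  moreover have "indecomposable ?M'"
  proof (rule indecomposableI)
    fix X assume X: "X \<noteq> {}" "X \<subseteq> {..<Suc n}"
      and cl: "\<And>i j. i \<in> X \<Longrightarrow> j < Suc n \<Longrightarrow> ?M' $$ (i, j) \<noteq> 0 \<Longrightarrow> j \<in> X"
    have cl': "j \<in> X" if "i \<in> X" "j < Suc n" "a' i j \<noteq> 0" for i j
      using cl[OF that(1,2)] X(2) that by auto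
    have ne: "X \<inter> {..<n} \<noteq> {}"
    proof
      assume e: "X \<inter> {..<n} = {}"
      then have "n \<in> X" using X unfolding lessThan_Suc by blast
      then show False using cl'[of n i0] new i0 e by auto
    qed
    have "X \<inter> {..<n} = {..<n}"
      by (rule indecomposable_closed[OF ind]) (use ne cl' old in auto)
    then have all: "{..<n} \<subseteq> X" by blast
    then have "n \<in> X" using cl'[of i0 n] new' i0 by auto
    then show "X = {..<Suc n}" using all X(2) unfolding lessThan_Suc by blast
  qed simp_all
  moreover have "\<not> principal_submatrix ?M' C" if "maximal_indec_cyclotomic Zsqrt3 C" for C
  proof
    assume "principal_submatrix ?M' C"
    moreover have "principal_submatrix ?M ?M'"
      unfolding principal_submatrix_def
      by (intro conjI exI[of _ "\<lambda>i. i"]) (auto simp: strict_mono_on_def old)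
    ultimately show False using nomax[OF that] principal_submatrix_trans by blast
  qed
  moreover have "over_ring \<int> ?M'" by (simp add: over_ring_def)
  ultimately have "uncontained ?M'" unfolding uncontained_def by blast
  then show ?thesis using old new i0 by blast
qed

lemma integer_contained:
  assumes "over_ring \<int> A" "indecomposable A" "cyclotomic A"
  shows "\<exists>B. maximal_indec_cyclotomic Zsqrt3 B \<and> principal_submatrix A B"
proof (rule ccontr)
  assume no: "\<not> ?thesis"
  define n0 where "n0 = dim_row A"
  have A: "A \<in> carrier_mat n0 n0" using assms(2) by (auto simp: indecomposable_def n0_def)
  have "A = corner n0 (\<lambda>i j. \<lfloor>A $$ (i, j)\<rfloor>)"
    using A assms(1) by (intro eq_matI) (auto simp: over_ring_def)
  then have start: "uncontained (corner n0 (\<lambda>i j. \<lfloor>A $$ (i, j)\<rfloor>))"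
    using assms no by (simp add: uncontained_def)
  obtain c where c0: "c 0 = (\<lambda>i j. \<lfloor>A $$ (i, j)\<rfloor>)" and unc: "\<And>k. uncontained (corner (n0 + k) (c k))"
    and step: "\<And>k i j. i < n0 + k \<Longrightarrow> j < n0 + k \<Longrightarrow> c (Suc k) i j = c k i j"
    and new: "\<And>k. \<exists>i<n0 + k. c (Suc k) (n0 + k) i \<noteq> 0"
  proof -
    obtain nx where nx: "\<And>n a. uncontained (corner n a) \<Longrightarrow> uncontained (corner (Suc n) (nx n a)) \<and>
        (\<forall>i<n. \<forall>j<n. nx n a i j = a i j) \<and> (\<exists>i<n. nx n a n i \<noteq> 0)"
      using uncontained_extend by metis
    define c where "c = rec_nat (\<lambda>i j. \<lfloor>A $$ (i, j)\<rfloor>) (\<lambda>k x. nx (n0 + k) x)"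
    have c: "c 0 = (\<lambda>i j. \<lfloor>A $$ (i, j)\<rfloor>)" "\<And>k. c (Suc k) = nx (n0 + k) (c k)" by (simp_all add: c_def)
    have u: "uncontained (corner (n0 + k) (c k))" for k
    proof (induction k)
      case 0
      then show ?case using start c(1) by simp
    next
      case (Suc k)
      then show ?case using nx[OF Suc] c(2)[of k] by simp
    qed
    show ?thesis using that[of c] c u nx by metis
  qed
  have agree: "c (k + l) i j = c k i j" if "i < n0 + k" "j < n0 + k" for k l i j
    by (induction l) (use that step in auto)
  \<comment> \<open>Stage \<open>Suc (max i j)\<close> certainly contains both indices, and all
    stages containing them agree.\<close>
  define \<alpha> where "\<alpha> i j = c (Suc (max i j)) i j" for i j
  have \<alpha>: "c k i j = \<alpha> i j" if "i < n0 + k" "j < n0 + k" for k i j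
  proof -
    have "c (k + Suc (max i j)) i j = c k i j" by (rule agree) (use that in auto)
    moreover have "c (Suc (max i j) + k) i j = \<alpha> i j" unfolding \<alpha>_def by (rule agree) auto
    ultimately show ?thesis by (simp add: add.commute)
  qed
  have sym: "\<alpha> u v = \<alpha> v u" for u v
  proof -
    define k where "k = Suc (max u v)"
    have uv: "u < n0 + k" "v < n0 + k" by (auto simp: k_def)
    have "transpose_mat (corner (n0 + k) (c k)) = corner (n0 + k) (c k)"
      using unc[of k] by (simp add: uncontained_def cyclotomic_def)
    then have "corner (n0 + k) (c k) $$ (u, v) = corner (n0 + k) (c k) $$ (v, u)"
      using uv by (metis corner_carrier(2,3) index_transpose_mat(1))
    then show ?thesis using uv by (simp add: \<alpha>)
  qed
  have bound: "sq_bound V \<alpha>" if V: "finite V" for V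
  proof -
    obtain k where k: "V \<subseteq> {..<k}" using V finite_nat_iff_bounded by blast
    have "sq_bound {..<n0 + k} (c k)" using unc[of k] by (intro corner_sq_bound) (simp add: uncontained_def)
    then have "sq_bound V (c k)" using k by (rule_tac sq_bound_subset[of "{..<n0 + k}"]) auto
    moreover have "c k u v = \<alpha> u v" if "u \<in> V" "v \<in> V" for u v using that k by (intro \<alpha>) auto
    ultimately show ?thesis using sq_bound_cong[of V "c k" \<alpha>] by blast
  qed
  have conn: "X = UNIV" if X: "X \<noteq> {}" and cl: "\<And>x y. x \<in> X \<Longrightarrow> \<alpha> x y \<noteq> 0 \<Longrightarrow> y \<in> X" for X
  proof -
    obtain x where x: "x \<in> X" using X by blast
    have "y \<in> X" for y
    proof -
      define k where "k = Suc (max x y)"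
      have xy: "x < n0 + k" "y < n0 + k" by (auto simp: k_def)
      have "X \<inter> {..<n0 + k} = {..<n0 + k}"
      proof (rule indecomposable_closed)
        show "indecomposable (corner (n0 + k) (c k))" using unc[of k] by (simp add: uncontained_def)
        show "X \<inter> {..<n0 + k} \<noteq> {}" using x xy by blast
        show "j \<in> X \<inter> {..<n0 + k}"
          if "i \<in> X \<inter> {..<n0 + k}" "j < n0 + k" "corner (n0 + k) (c k) $$ (i, j) \<noteq> 0" for i j
          using that cl[of i j] by (simp add: \<alpha>)
      qed simp_all
      then show ?thesis using xy by blast
    qed
    then show ?thesis by blast
  qed
  \<comment> \<open>An entry of modulus at least 2 fills its row and its column, so \<open>u\<close>
    and \<open>v\<close> would make up the whole infinite graph.\<close>
  have small: "\<bar>\<alpha> u v\<bar> \<le> 1" for u v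
  proof (rule ccontr)
    assume "\<not> ?thesis"
    then have "2 \<le> \<bar>\<alpha> u v\<bar>" by simp
    from power_mono[OF this, of 2] have big: "4 \<le> (\<alpha> u v)\<^sup>2" by simp
    have only: "\<alpha> x z = 0" if "4 \<le> (\<alpha> x y)\<^sup>2" "z \<noteq> y" for x y z
    proof -
      have "(\<alpha> y x)\<^sup>2 + (\<alpha> z x)\<^sup>2 = (\<Sum>w\<in>{y, z}. (\<alpha> w x)\<^sup>2)" using that by simp
      also have "\<dots> \<le> (\<Sum>w\<in>{x, y, z}. (\<alpha> w x)\<^sup>2)" by (intro sum_mono2) auto
      also have "\<dots> \<le> 4" using sq_bound_row[OF bound, of "{x, y, z}" x] by simp
      finally have "(\<alpha> x y)\<^sup>2 + (\<alpha> x z)\<^sup>2 \<le> 4" by (simp only: sym[of y x] sym[of z x])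
      then have "(\<alpha> x z)\<^sup>2 \<le> 0" using that(1) by linarith
      then show ?thesis by simp
    qed
    have big': "4 \<le> (\<alpha> v u)\<^sup>2" using big sym by simp
    have "{u, v} = UNIV" by (rule conn) (use only[OF big] only[OF big'] in auto)
    then show False by (metis finite.emptyI finite.insertI infinite_UNIV_nat)
  qed
  have graph: "cyc_graph \<alpha>" unfolding cyc_graph_def using sym bound small by blast
  obtain r where r: "ray \<alpha> r"
  proof -
    have "\<exists>m<n. \<alpha> n m \<noteq> 0" if n: "n \<ge> n0" for n
    proof -
      obtain i where i: "i < n" "c (Suc (n - n0)) n i \<noteq> 0"
        using new[of "n - n0"] unfolding le_add_diff_inverse[OF n] by blast
      then show ?thesis using \<alpha>[of n "Suc (n - n0)" i] n by (intro exI[of _ i]) simp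
    qed
    then show ?thesis using exists_ray[OF graph] that by blast
  qed
  have "\<exists>m \<phi> s \<epsilon>. m > 0 \<and> inj_on \<phi> {..<n0} \<and> \<phi> ` {..<n0} \<subseteq> {..m} \<times> UNIV \<and> (\<forall>x. \<bar>s x\<bar> = 1) \<and> \<bar>\<epsilon>\<bar> = 1 \<and>
      (\<forall>x\<in>{..<n0}. \<forall>y\<in>{..<n0}. \<alpha> x y = \<epsilon> * s x * s y * tess m (\<phi> x) (\<phi> y))"
    by (rule finite_piece_embedding[OF graph r finite_lessThan]) (rule conn)
  then obtain m \<phi> s \<epsilon> where emb: "m > 0" "inj_on \<phi> {..<n0}" "\<phi> ` {..<n0} \<subseteq> {..m} \<times> UNIV"
    "\<forall>x. \<bar>s x\<bar> = 1" "\<bar>\<epsilon>\<bar> = 1"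
    "\<forall>x\<in>{..<n0}. \<forall>y\<in>{..<n0}. \<alpha> x y = \<epsilon> * s x * s y * tess m (\<phi> x) (\<phi> y)"
    by (elim exE conjE)
  have "A $$ (i, j) = real_of_int (\<epsilon> * s i * s j * tess m (\<phi> i) (\<phi> j))" if "i < n0" "j < n0" for i j
  proof -
    have "A $$ (i, j) = real_of_int (c 0 i j)"
      using that A assms(1) by (simp add: c0 over_ring_def)
    then show ?thesis using \<alpha>[of i 0 j] emb(6) that by simp
  qed
  from tess_maximal[OF A emb(1-3) spec[OF emb(4)] emb(5) this] show False using no by blast
qed

theorem theorem7:
  shows "(\<forall>A. maximal_indec_cyclotomic Zsqrt3 A \<and> \<not> over_ring \<int> A \<longrightarrow>
            equivalent A S2' \<or> equivalent A S2dag \<or> equivalent A S4sqrt3)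
       \<and> (\<forall>A. over_ring Zsqrt3 A \<and> indecomposable A \<and> cyclotomic A \<longrightarrow>
            (\<exists>B. maximal_indec_cyclotomic Zsqrt3 B \<and> principal_submatrix A B))"
proof (intro conjI allI impI)
  fix A assume A: "maximal_indec_cyclotomic Zsqrt3 A \<and> \<not> over_ring \<int> A"
  then have props: "over_ring Zsqrt3 A" "indecomposable A" "cyclotomic A"
    by (auto simp: maximal_indec_cyclotomic_def)
  define n where "n = dim_row A"
  have Am: "A \<in> carrier_mat n n" using props(2) by (auto simp: indecomposable_def n_def)
  obtain S where S: "S \<in> {S2', S2dag, S4sqrt3}" "embeds A S" using noninteger_embedding[OF props] A by blast
  obtain B where B: "maximal_indec_cyclotomic Zsqrt3 B" "principal_submatrix A B" "dim_row B = dim_row S"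
    using embeds_maximal[OF Am S(2,1)] by blast
  \<comment> \<open>The matrix \<open>B\<close> has the size of \<open>S\<close> and contains
    \<open>A\<close>. Maximality of \<open>A\<close> makes the sizes equal, and then the embedding
    is an equivalence.\<close>
  have "\<not> proper_principal_submatrix A B"
    using A B(1) unfolding maximal_indec_cyclotomic_def by blast
  then have "dim_row S \<le> n" using B(2,3) by (simp add: proper_principal_submatrix_def n_def)
  moreover obtain \<phi> where "inj_on \<phi> {..<n}" "\<phi> ` {..<n} \<subseteq> {..<dim_row S}"
    using S(2) unfolding embeds_def n_def by blast
  then have "n \<le> dim_row S" using card_inj_on_le[of \<phi> "{..<n}" "{..<dim_row S}"] by simp
  ultimately have "dim_row S = n" by simp
  moreover have "dim_col S = dim_row S"
    using S(1) by (auto simp: S2'_def S2dag_def S4sqrt3_def mat_of_rows_list_def)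
  ultimately have "S \<in> carrier_mat n n" by auto
  then show "equivalent A S2' \<or> equivalent A S2dag \<or> equivalent A S4sqrt3"
    using embeds_equivalent[OF Am _ S(2)] S(1) by blast
next
  fix A assume A: "over_ring Zsqrt3 A \<and> indecomposable A \<and> cyclotomic A"
  then have Am: "A \<in> carrier_mat (dim_row A) (dim_row A)" by (auto simp: indecomposable_def)
  show "\<exists>B. maximal_indec_cyclotomic Zsqrt3 B \<and> principal_submatrix A B"
  proof (cases "over_ring \<int> A")
    case True
    then show ?thesis using integer_contained A by blast
  next
    case False
    obtain S where S: "S \<in> {S2', S2dag, S4sqrt3}" "embeds A S"
      using noninteger_embedding[OF _ _ _ False] A by blast
    from embeds_maximal[OF Am S(2,1)] show ?thesis by blast
  qed
qed

end
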